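(* Let $\alpha>0$, $\beta>0$, $\gamma\ge 0$, $\delta\ge 0$, $0\le q<1$, and let $$\rho_0=\frac{1-q+\alpha+\gamma-\sqrt{(1-q-\alpha+\gamma)^2+4\alpha\gamma}}{2(1-q)},\qquad \rho_1=\frac{1-q-\beta-\delta+\sqrt{(1-q-\beta+\delta)^2+4\beta\delta}}{2(1-q)}.$$ Suppose that $\rho_0>\rho_1$. For each $N\geq 2$ let $\pi_N$ be the invariant probability measure on $\{0,1\}^N$ of the ASEP on $\{1,\dots,N\}$ with open boundaries and parameters $\alpha,\beta,\gamma,\delta,q$, let $(\tau_1,\dots,\tau_N)$ have law $\pi_N$, and let $\bar\tau_N=\frac1N\sum_{j=1}^N\tau_j$. Then the sequence $\{\bar\tau_N\}$ satisfies the large deviations principle with speed $N$ and rate function $$I(x)=\begin{cases} h(x|\rho_0)+L_0+\log(\rho_0(1-\rho_0)) & \text{if } 0\le x<1-\rho_0,\\ 2h(x|\tfrac12)+L_0-\log4 & \text{if } 1-\rho_0\le x\le 1-\rho_1,\\ h(x|\rho_1)+L_0+\log(\rho_1(1-\rho_1)) & \text{if } 1-\rho_1<x\le1,\\ \infty & \text{if } x<0 \text{ or } x>1,\end{cases}$$ where $L_0=-\sup_{\rho_1\le\rho\le\rho_0}\log(\rho(1-\rho))$. That is, for any $0\le a<b\le1$, $$\lim_{N\to\infty}\frac1N\log\pi_N(\bar\tau_N\in(a,b))=-\inf_{x\in(a,b)}I(x).$$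
   Context: **ASEP with open boundaries.** It is the continuous-time Markov chain on $\{0,1\}^N$ (state $(\tau_1,\dots,\tau_N)$, $\tau_j=1$ iff site $j$ is occupied) with the following transitions and rates: for $1\le j\le N-1$ a particle at $j$ jumps to $j+1$ at rate $1$ if $j+1$ is empty; a particle at $j+1$ jumps to $j$ at rate $q$ if $j$ is empty; a particle is inserted at site $1$ at rate $\alpha$ if it is empty and removed from site $1$ at rate $\gamma$ if it is occupied; a particle is inserted at site $N$ at rate $\delta$ if it is empty and removed from site $N$ at rate $\beta$ if it is occupied. It has a unique invariant probability measure $\pi_N$. **Relative entropy.** $h(x|p)=x\log\frac xp+(1-x)\log\frac{1-x}{1-p}$ for $x\in[0,1]$, $p\in(0,1)$ (with $0\log0=0$). One has $\rho_0\in(0,1]$ and $\rho_1\in[0,1)$; if $\rho_0=1$ the first case in $I$ is empty, and if $\rho_1=0$ the third case is empty. *)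

theory Defs
  imports "HOL-Probability.Probability"
begin

section \<open>Continuous-time Markov chains on a finite state space\<close>

text \<open>A chain is given by its finite state space \<open>S\<close> and its jump rates \<open>r x y\<close>, \<open>x \<noteq> y\<close>.
  Its transition function is the matrix exponential \<open>exp (t Q)\<close> of the generator matrix \<open>Q\<close>,
  written entrywise as a power series.\<close>

definition ctmc_generator :: "'a set \<Rightarrow> ('a \<Rightarrow> 'a \<Rightarrow> real) \<Rightarrow> 'a \<Rightarrow> 'a \<Rightarrow> real" where
  "ctmc_generator S r x y = (if x = y then - (\<Sum>z\<in>S - {x}. r x z) else r x y)"

fun ctmc_generator_power :: "'a set \<Rightarrow> ('a \<Rightarrow> 'a \<Rightarrow> real) \<Rightarrow> nat \<Rightarrow> 'a \<Rightarrow> 'a \<Rightarrow> real" where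
  "ctmc_generator_power S r 0 x y = (if x = y then 1 else 0)"
| "ctmc_generator_power S r (Suc n) x y =
     (\<Sum>z\<in>S. ctmc_generator_power S r n x z * ctmc_generator S r z y)"

definition ctmc_transition :: "'a set \<Rightarrow> ('a \<Rightarrow> 'a \<Rightarrow> real) \<Rightarrow> real \<Rightarrow> 'a \<Rightarrow> 'a \<Rightarrow> real" where
  "ctmc_transition S r t x y = (\<Sum>n. t ^ n / fact n * ctmc_generator_power S r n x y)"

definition ctmc_invariant :: "'a set \<Rightarrow> ('a \<Rightarrow> 'a \<Rightarrow> real) \<Rightarrow> 'a pmf \<Rightarrow> bool" where
  "ctmc_invariant S r \<mu> \<longleftrightarrow> set_pmf \<mu> \<subseteq> S \<and>
     (\<forall>t\<ge>0. \<forall>y\<in>S. (\<Sum>x\<in>S. pmf \<mu> x * ctmc_transition S r t x y) = pmf \<mu> y)"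


section \<open>ASEP with open boundaries\<close>

definition asep_states :: "nat \<Rightarrow> (nat \<Rightarrow> nat) set" where
  "asep_states N = {1..N} \<rightarrow>\<^sub>E {0, 1}"

definition asep_rate ::
  "real \<Rightarrow> real \<Rightarrow> real \<Rightarrow> real \<Rightarrow> real \<Rightarrow> nat \<Rightarrow> (nat \<Rightarrow> nat) \<Rightarrow> (nat \<Rightarrow> nat) \<Rightarrow> real" where
  "asep_rate \<alpha> \<beta> \<gamma> \<delta> q N \<tau> \<sigma> =
     (\<Sum>j\<in>{1..<N}.
        (if \<tau> j = 1 \<and> \<tau> (j + 1) = 0 \<and> \<sigma> = \<tau>(j := 0, j + 1 := 1) then 1 else 0)
      + (if \<tau> j = 0 \<and> \<tau> (j + 1) = 1 \<and> \<sigma> = \<tau>(j := 1, j + 1 := 0) then q else 0))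
   + (if \<tau> 1 = 0 \<and> \<sigma> = \<tau>(1 := 1) then \<alpha> else 0)
   + (if \<tau> 1 = 1 \<and> \<sigma> = \<tau>(1 := 0) then \<gamma> else 0)
   + (if \<tau> N = 0 \<and> \<sigma> = \<tau>(N := 1) then \<delta> else 0)
   + (if \<tau> N = 1 \<and> \<sigma> = \<tau>(N := 0) then \<beta> else 0)"

definition asep_invariant ::
  "real \<Rightarrow> real \<Rightarrow> real \<Rightarrow> real \<Rightarrow> real \<Rightarrow> nat \<Rightarrow> (nat \<Rightarrow> nat) pmf \<Rightarrow> bool" where
  "asep_invariant \<alpha> \<beta> \<gamma> \<delta> q N \<mu> \<longleftrightarrow>
     ctmc_invariant (asep_states N) (asep_rate \<alpha> \<beta> \<gamma> \<delta> q N) \<mu>"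

definition mean_density :: "nat \<Rightarrow> (nat \<Rightarrow> nat) \<Rightarrow> real" where
  "mean_density N \<tau> = (\<Sum>j=1..N. real (\<tau> j)) / real N"


section \<open>Large deviations\<close>

text \<open>The logarithm on \<open>[0, \<infinity>)\<close> with \<open>log 0 = -\<infinity>\<close>; the library's real logarithm has \<open>ln 0 = 0\<close>.\<close>

definition elog :: "real \<Rightarrow> ereal" where
  "elog x = (if x > 0 then ereal (ln x) else -\<infinity>)"

definition rate_function :: "('a::topological_space \<Rightarrow> ereal) \<Rightarrow> bool" where
  "rate_function I \<longleftrightarrow> (\<forall>x. 0 \<le> I x) \<and> (\<forall>c::real. closed {x. I x \<le> ereal c})"

definition large_deviations_principle ::
  "(nat \<Rightarrow> 'a::topological_space measure) \<Rightarrow> (nat \<Rightarrow> real) \<Rightarrow> ('a \<Rightarrow> ereal) \<Rightarrow> bool" where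
  "large_deviations_principle M s I \<longleftrightarrow> rate_function I \<and>
     (\<forall>F. closed F \<longrightarrow>
        limsup (\<lambda>n. elog (measure (M n) F) / ereal (s n)) \<le> - (INF x\<in>F. I x)) \<and>
     (\<forall>G. open G \<longrightarrow>
        - (INF x\<in>G. I x) \<le> liminf (\<lambda>n. elog (measure (M n) G) / ereal (s n)))"

text \<open>At \<open>x = 0\<close> and \<open>x = 1\<close> the vanishing factor gives the convention \<open>0 log 0 = 0\<close>, as \<open>ln\<close> is total.\<close>

definition relative_entropy :: "real \<Rightarrow> real \<Rightarrow> real" where
  "relative_entropy x p = x * ln (x / p) + (1 - x) * ln ((1 - x) / (1 - p))"

text \<open>For \<open>\<rho>0 = 1\<close> or \<open>\<rho>1 = 0\<close> the endpoints of the supremum contribute \<open>log 0 = -\<infinity>\<close>.\<close>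

definition asep_L0 :: "real \<Rightarrow> real \<Rightarrow> ereal" where
  "asep_L0 \<rho>0 \<rho>1 = - (SUP \<rho>\<in>{\<rho>1..\<rho>0}. elog (\<rho> * (1 - \<rho>)))"

definition asep_rate_function :: "real \<Rightarrow> real \<Rightarrow> real \<Rightarrow> ereal" where
  "asep_rate_function \<rho>0 \<rho>1 x =
     (if 0 \<le> x \<and> x < 1 - \<rho>0 then
        ereal (relative_entropy x \<rho>0) + asep_L0 \<rho>0 \<rho>1 + elog (\<rho>0 * (1 - \<rho>0))
      else if 1 - \<rho>0 \<le> x \<and> x \<le> 1 - \<rho>1 then
        ereal (2 * relative_entropy x (1 / 2)) + asep_L0 \<rho>0 \<rho>1 - ereal (ln 4)
      else if 1 - \<rho>1 < x \<and> x \<le> 1 then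
        ereal (relative_entropy x \<rho>1) + asep_L0 \<rho>0 \<rho>1 + elog (\<rho>1 * (1 - \<rho>1))
      else \<infinity>)"

end

theory Submission
  imports Defs "HOL-Real_Asymp.Real_Asymp"
begin

text \<open>Let \<open>a \<ge> 0 \<ge> b > -1\<close> be the roots of \<open>\<beta> z\<^sup>2 - (1 - q - \<beta> + \<delta>) z - \<delta>\<close> and \<open>c \<ge> 0 \<ge> d > -1\<close> those
  of \<open>\<alpha> z\<^sup>2 - (1 - q - \<alpha> + \<gamma>) z - \<gamma>\<close>, so that \<open>\<rho>0 = 1 / (1 + c)\<close>, \<open>\<rho>1 = a / (1 + a)\<close>, and \<open>\<rho>0 > \<rho>1\<close> means
  \<open>a c < 1\<close>. The matrix product ansatz then has a representation by bidiagonal matrices \<open>D\<close>, \<open>E\<close> and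
  boundary vectors that are all nonnegative and explicit, and \<open>a c < 1\<close> makes the products converge.

  Since \<open>D\<close> and \<open>E\<close> multiply the sequence \<open>u ^ n\<close> by at most \<open>1 + u\<close> and \<open>1 + 1 / u\<close>, every
  \<open>a < u < 1 / c\<close>, that is every \<open>F = u / (1 + u)\<close> in \<open>(\<rho>1, \<rho>0)\<close>, bounds the weight of a configuration
  with \<open>k\<close> particles by a constant times \<open>(1 - F) ^ (-k) * F ^ (-(N - k))\<close>. Optimising over \<open>F\<close> gives
  the upper bound. Conversely, expanding the matrix products into paths and keeping those in which a
  fraction \<open>F\<close> of the particles steps up and a fraction \<open>1 - F\<close> of the holes steps down gives the same
  exponential rate, where \<open>F\<close> is the point of \<open>[\<rho>1, \<rho>0]\<close> closest to \<open>1 - x\<close>. The rate function is thus a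
  constant minus an infimum of affine functions, and its three cases are the three positions of \<open>1 - x\<close>
  relative to \<open>[\<rho>1, \<rho>0]\<close>.\<close>

section \<open>A nonnegative representation of the matrix product algebra\<close>

text \<open>Without cancellation, any family of paths gives a lower bound for a matrix product.
  Along a path, a particle raises the level by one or keeps it, a hole lowers it by one or keeps it;
  the left vector charges \<open>c ^ n\<close> for the initial level, the right vector about
  \<open>a ^ n\<close> for the final one. If a fraction \<open>F\<close> of the particles steps up
  and a fraction \<open>1 - F\<close> of the holes steps down, the net drift per site is
  \<open>x + F - 1\<close>. It vanishes for \<open>F = 1 - x\<close>; otherwise a positive drift is
  paid for with \<open>a\<close>, a negative one with \<open>c\<close>. At the endpoints \<rho>1 and
  \<rho>0 these prices are \<open>F / (1 - F)\<close> and \<open>(1 - F) / F\<close>, exactly what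
  makes the lower bound agree with the upper one. The obstacle is that entries at low levels may be
  smaller than 1, so that lingering there costs an exponential factor. As the entries tend to 1 with
  growing level, paths are first lifted to a fixed height, at a cost independent of
  \<open>N\<close>. The cases \<open>a = 0\<close> and \<open>c = 0\<close>, that is \<rho>1 = 0 and
  \<rho>0 = 1, need care, since then a drift of one sign has weight zero.\<close>

lemma qpochhammer_bounded_below:
  fixes z q :: real
  assumes z: "0 \<le> z" "z < 1" and q: "0 \<le> q" "q < 1"
  shows "\<exists>K>0. \<forall>n. K \<le> (\<Prod>k<n. 1 - z * q ^ k)"
proof -
  have zk: "z * q ^ k < 1" for k
    using mult_left_mono[OF power_le_one[of q k], of z] z q by simp
  have zk0: "0 \<le> z * q ^ k" for k using z q by simp
  have fac: "0 < 1 - z * q ^ k" for k using zk[of k] by simp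
  have "summable (\<lambda>k. norm ((1 - z * q ^ k) - 1))"
    using z q by (simp add: abs_mult summable_mult summable_geometric)
  then have conv: "convergent_prod (\<lambda>k. 1 - z * q ^ k)"
    by (intro abs_convergent_prod_imp_convergent_prod summable_imp_abs_convergent_prod)
  \<comment> \<open>The partial products decrease to their limit, which is nonzero because no factor
    vanishes and the sum of the \<open>z * q ^ k\<close> converges. The limit therefore bounds all
    of them from below.\<close>
  define P where "P n = (\<Prod>k<n. 1 - z * q ^ k)" for n
  have lim: "P \<longlonglongrightarrow> prodinf (\<lambda>k. 1 - z * q ^ k)"
    using convergent_prod_LIMSEQ[OF conv] unfolding P_def by (simp add: LIMSEQ_lessThan_iff_atMost)
  have nz: "prodinf (\<lambda>k. 1 - z * q ^ k) \<noteq> 0"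
    
    using has_prod_eq_0_iff[OF convergent_prod_has_prod[OF conv]] fac by (auto simp: less_imp_neq)
  have dec: "decseq P"
    unfolding decseq_Suc_iff P_def using fac zk0
    by (auto simp: mult_left_le prod_nonneg less_imp_le)
  have Ppos: "P n > 0" for n unfolding P_def using fac by (simp add: prod_pos)
  have le: "prodinf (\<lambda>k. 1 - z * q ^ k) \<le> P n" for n
    using decseq_ge[OF dec lim] .
  have "0 \<le> prodinf (\<lambda>k. 1 - z * q ^ k)"
    using LIMSEQ_le_const[OF lim, of 0] Ppos less_imp_le by blast
  with nz le show ?thesis unfolding P_def by (intro exI[of _ "prodinf (\<lambda>k. 1 - z * q ^ k)"]) auto
qed

locale matrix_ansatz =
  fixes a b c d q :: real
  assumes a0: "0 \<le> a" and b1: "-1 < b" and b0: "b \<le> 0"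
    and c0: "0 \<le> c" and d1: "-1 < d" and d0: "d \<le> 0"
    and q0: "0 \<le> q" and q1: "q < 1" and ac1: "a * c < 1"
begin

text \<open>These are \<open>1 - q\<close> times the matrices of the usual ansatz, so that
  \<open>D E - q E D = (1 - q) (D + E)\<close>. The nonpositive parameters \<open>b\<close> and \<open>d\<close> enter only through the
  diagonals and the product \<open>b d\<close>. The left boundary vector is \<open>c ^ n\<close>.\<close>

definition opD :: "(nat \<Rightarrow> real) \<Rightarrow> nat \<Rightarrow> real" where
  "opD f n = (1 + b * q ^ n) * f n + (1 - q ^ Suc n) * f (Suc n)"

definition opE :: "(nat \<Rightarrow> real) \<Rightarrow> nat \<Rightarrow> real" where
  "opE f n = (1 + d * q ^ n) * f n
     + (case n of 0 \<Rightarrow> 0 | Suc m \<Rightarrow> (1 - b * d * q ^ m) * f m)"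

fun word :: "nat list \<Rightarrow> (nat \<Rightarrow> real) \<Rightarrow> nat \<Rightarrow> real" where
  "word [] f = f"
| "word (x # xs) f = (if x = 1 then opD (word xs f) else opE (word xs f))"

text \<open>The right boundary vector: \<open>a ^ n\<close> times the ratio of q-Pochhammer symbols
  \<open>(b d; q)_n / (q; q)_n\<close>, as dictated by the recursion \<open>V_Suc\<close>. For
  \<open>a = 0\<close> only the entry at level 0 survives.\<close>

definition V :: "nat \<Rightarrow> real" where
  "V n = a ^ n * (\<Prod>k<n. (1 - b * d * q ^ k) / (1 - q ^ Suc k))"

definition phi :: "nat list \<Rightarrow> real" where
  "phi xs = (\<Sum>n. c ^ n * word xs V n)"

definition dominated :: "real \<Rightarrow> (nat \<Rightarrow> real) \<Rightarrow> bool" where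
  "dominated u f \<longleftrightarrow> (\<exists>K. \<forall>n. \<bar>f n\<bar> \<le> K * u ^ n)"

lemma bd: "0 \<le> b * d" "b * d < 1"
proof -
  show "0 \<le> b * d" using b0 d0 by (simp add: mult_nonpos_nonpos)
  have "(-b) * (-d) < 1 * 1"
    using b0 d0 b1 d1 by (intro mult_strict_mono') auto
  then show "b * d < 1" by simp
qed

lemma qpow: "0 \<le> q ^ n" "q ^ n \<le> 1" "q ^ Suc n < 1"
  using q0 q1 by (auto simp: power_le_one power_less_one_iff simp del: power_Suc)

lemma bdq: "b * d * q ^ n < 1" "0 \<le> b * d * q ^ n"
proof -
  have "b * d * q ^ n \<le> b * d * 1" using bd qpow by (intro mult_left_mono) auto
  then show "b * d * q ^ n < 1" using bd by simp
  show "0 \<le> b * d * q ^ n" using bd qpow by simp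
qed

lemma diagonal_bounds:
  assumes "-1 < z" "z \<le> 0"
  shows "1 + z \<le> 1 + z * q ^ n" "1 + z * q ^ n \<le> 1" "0 < 1 + z * q ^ n"
proof -
  have "-z * q ^ n \<le> -z * 1" using assms qpow by (intro mult_left_mono) auto
  then show "1 + z \<le> 1 + z * q ^ n" by simp
  with assms show "0 < 1 + z * q ^ n" by linarith
  show "1 + z * q ^ n \<le> 1" using assms qpow by (simp add: mult_nonpos_nonneg)
qed

lemmas b_diag = diagonal_bounds[OF b1 b0]
lemmas d_diag = diagonal_bounds[OF d1 d0]

section \<open>The defining relations of the matrix ansatz\<close>

lemma opD_linear: "opD (\<lambda>n. r * f n + s * g n) n = r * opD f n + s * opD g n"
  by (simp add: opD_def algebra_simps)

lemma opE_linear: "opE (\<lambda>n. r * f n + s * g n) n = r * opE f n + s * opE g n"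
  by (simp add: opE_def algebra_simps split: nat.split)

lemma word_linear: "word xs (\<lambda>n. r * f n + s * g n) n = r * word xs f n + s * word xs g n"
proof (induction xs arbitrary: n)
  case (Cons x xs)
  have eq: "word xs (\<lambda>n. r * f n + s * g n) = (\<lambda>n. r * word xs f n + s * word xs g n)"
    using Cons by auto
  show ?case by (simp add: eq opD_linear opE_linear)
qed simp

lemma word_append: "word (xs @ ys) f = word xs (word ys f)"
  by (induction xs) auto

lemma opD_opE: "opD (opE f) n = q * opE (opD f) n + (1 - q) * (opD f n + opE f n)"
  by (cases n) (simp_all add: opD_def opE_def algebra_simps)

lemma V_Suc: "(1 - q ^ Suc n) * V (Suc n) = a * (1 - b * d * q ^ n) * V n"
  using qpow(3)[of n] by (simp add: V_def field_simps)

text \<open>\<open>V_Suc\<close>, read in both directions, turns the two off-diagonal terms into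
  multiples of \<open>V n\<close>. The coefficients of \<open>q ^ n\<close> then add up to
  \<open>b - a b d + a b d - b = 0\<close>. At level 0 the missing lower neighbour agrees with the
  factor \<open>1 - q ^ 0 = 0\<close>.\<close>

lemma right_boundary: "opD V n + a * b * opE V n = (1 + a) * (1 + b) * V n"
proof (cases n)
  case 0
  have "opD V 0 + a * b * opE V 0 = (1 + b) * V 0 + (1 - q ^ Suc 0) * V (Suc 0) + a * b * (1 + d) * V 0"
    by (simp add: opD_def opE_def)
  also have "\<dots> = (1 + a) * (1 + b) * V 0" unfolding V_Suc[of 0] by (simp add: algebra_simps)
  finally show ?thesis using 0 by simp
next
  case (Suc m)
  have "opD V n + a * b * opE V n = (1 + b * q ^ n) * V n + (1 - q ^ Suc n) * V (Suc n)
      + a * b * (1 + d * q ^ n) * V n + b * (a * (1 - b * d * q ^ m) * V m)"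
    using Suc by (simp add: opD_def opE_def algebra_simps)
  also have "\<dots> = (1 + a) * (1 + b) * V n"
    unfolding V_Suc[of n] V_Suc[of m, symmetric] by (simp add: Suc algebra_simps)
  finally show ?thesis .
qed

section \<open>Convergence of the matrix products\<close>

lemma dominated_opD: "dominated u f \<Longrightarrow> u > 0 \<Longrightarrow> dominated u (opD f)"
proof -
  assume "dominated u f" and u: "u > 0"
  then obtain K where K: "\<And>n. \<bar>f n\<bar> \<le> K * u ^ n" unfolding dominated_def by auto
  have "\<bar>opD f n\<bar> \<le> (K + K * u) * u ^ n" for n
  proof -
    have "\<bar>opD f n\<bar> \<le> (1 + b * q ^ n) * \<bar>f n\<bar> + (1 - q ^ Suc n) * \<bar>f (Suc n)\<bar>"
      unfolding opD_def using b_diag(3)[of n] qpow(3)[of n]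
      by (intro order.trans[OF abs_triangle_ineq]) (simp add: abs_mult)
    also have "\<dots> \<le> 1 * (K * u ^ n) + 1 * (K * u ^ Suc n)"
      using b_diag[of n] qpow(3)[of n] qpow(1)[of "Suc n"] K[of n] K[of "Suc n"]
      by (intro add_mono mult_mono) auto
    finally show ?thesis by (simp add: algebra_simps)
  qed
  then show ?thesis unfolding dominated_def by blast
qed

lemma dominated_opE: "dominated u f \<Longrightarrow> u > 0 \<Longrightarrow> dominated u (opE f)"
proof -
  assume "dominated u f" and u: "u > 0"
  then obtain K where K: "\<And>n. \<bar>f n\<bar> \<le> K * u ^ n" unfolding dominated_def by auto
  have K0: "0 \<le> K" using K[of 0] by simp
  have "\<bar>opE f n\<bar> \<le> (K + K / u) * u ^ n" for n
  proof (cases n)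
    case 0
    have "\<bar>opE f 0\<bar> = (1 + d) * \<bar>f 0\<bar>" using d1 by (simp add: opE_def abs_mult)
    also have "\<dots> \<le> 1 * K" using d0 d1 K[of 0] by (intro mult_mono) auto
    also have "\<dots> \<le> K + K / u" using K0 u by simp
    finally show ?thesis using 0 by simp
  next
    case (Suc m)
    have "\<bar>opE f n\<bar> \<le> (1 + d * q ^ n) * \<bar>f n\<bar> + (1 - b * d * q ^ m) * \<bar>f m\<bar>"
      unfolding opE_def Suc using d_diag(3)[of "Suc m"] bdq[of m]
      by (intro order.trans[OF abs_triangle_ineq]) (simp add: abs_mult)
    also have "\<dots> \<le> 1 * (K * u ^ n) + 1 * (K * u ^ m)"
      using d_diag[of n] bdq[of m] K by (intro add_mono mult_mono) auto
    also have "\<dots> = (K + K / u) * u ^ n" using Suc u by (simp add: field_simps)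
    finally show ?thesis .
  qed
  then show ?thesis unfolding dominated_def by blast
qed

lemma dominated_word: "dominated u f \<Longrightarrow> u > 0 \<Longrightarrow> dominated u (word xs f)"
  by (induction xs) (auto simp: dominated_opD dominated_opE)

text \<open>The ratio in \<open>V\<close> consists of two q-Pochhammer products, each between a
  positive constant and 1, so it distorts \<open>a ^ n\<close> only by a bounded factor.\<close>

lemma V_bounds: "\<exists>K>0. \<forall>n. K * a ^ n \<le> V n \<and> V n \<le> a ^ n / K"
proof -
  obtain K1 where K1: "K1 > 0" "\<And>n. K1 \<le> (\<Prod>k<n. 1 - b * d * q ^ k)"
    using qpochhammer_bounded_below[of "b * d" q] bd q0 q1 by auto
  obtain K2 where K2: "K2 > 0" "\<And>n. K2 \<le> (\<Prod>k<n. 1 - q * q ^ k)"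
    using qpochhammer_bounded_below[of q q] q0 q1 by auto
  have r: "(\<Prod>k<n. (1 - b * d * q ^ k) / (1 - q ^ Suc k)) =
      (\<Prod>k<n. 1 - b * d * q ^ k) / (\<Prod>k<n. 1 - q * q ^ k)" for n
    by (simp add: prod_dividef)
  have u1: "(\<Prod>k<n. 1 - b * d * q ^ k) \<le> 1" for n
    using bdq by (intro prod_le_1) (auto simp: less_imp_le)
  have u2: "(\<Prod>k<n. 1 - q * q ^ k) \<le> 1" for n
    using qpow(3) qpow(1)[of "Suc _"] by (intro prod_le_1) (auto simp: less_imp_le)
  have lo: "K1 \<le> (\<Prod>k<n. 1 - b * d * q ^ k) / (\<Prod>k<n. 1 - q * q ^ k)" for n
  proof -
    have "K1 / 1 \<le> (\<Prod>k<n. 1 - b * d * q ^ k) / (\<Prod>k<n. 1 - q * q ^ k)"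
      using K1 K2(1) K2(2)[of n] u2[of n] by (intro frac_le) (auto intro: order.trans[OF less_imp_le])
    then show ?thesis by simp
  qed
  have hi: "(\<Prod>k<n. 1 - b * d * q ^ k) / (\<Prod>k<n. 1 - q * q ^ k) \<le> 1 / K2" for n
    using u1[of n] K2 K1(1) K1(2)[of n] by (intro frac_le) auto
  define K where "K = min K1 K2"
  have "K > 0" using K1 K2 by (simp add: K_def)
  moreover have "K * a ^ n \<le> V n" for n
    unfolding V_def r using mult_right_mono[OF order.trans[OF _ lo[of n]], of K "a ^ n"] a0
    by (simp add: K_def mult.commute)
  moreover have "V n \<le> a ^ n / K" for n
  proof -
    have "1 / K2 \<le> 1 / K" using K1 K2 by (simp add: K_def frac_le)
    then show ?thesis unfolding V_def r
      using mult_left_mono[OF order.trans[OF hi[of n]], of "1 / K" "a ^ n"] a0 by simp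
  qed
  ultimately show ?thesis by blast
qed

lemma V_nonneg: "0 \<le> V n"
proof -
  obtain K where "K > 0" "K * a ^ n \<le> V n" using V_bounds by blast
  then show ?thesis using a0 by (meson order.trans zero_le_mult_iff zero_le_power less_imp_le)
qed

lemma V_0 [simp]: "V 0 = 1" by (simp add: V_def)

lemma dominated_V: "a \<le> u \<Longrightarrow> dominated u V"
proof -
  assume u: "a \<le> u"
  obtain K where K: "K > 0" "\<And>n. V n \<le> a ^ n / K" using V_bounds by blast
  have "\<bar>V n\<bar> \<le> 1 / K * u ^ n" for n
  proof -
    have "V n \<le> a ^ n / K" by (rule K)
    also have "\<dots> \<le> u ^ n / K" using u a0 K by (intro divide_right_mono power_mono) auto
    finally show ?thesis using V_nonneg[of n] by simp
  qed
  then show ?thesis unfolding dominated_def by blast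
qed

text \<open>\<open>a\<close> itself is such a rate unless it is zero. The rate must be positive
  because a step down multiplies \<open>u ^ n\<close> by \<open>1 / u\<close>.\<close>

lemma exists_ratio: "\<exists>u>0. a \<le> u \<and> c * u < 1"
proof (cases "a = 0")
  case True
  show ?thesis
  proof (intro exI[of _ "1 / (2 * (c + 1))"] conjI)
    show "c * (1 / (2 * (c + 1))) < 1" using c0 by (simp add: field_simps)
  qed (use c0 True in auto)
next
  case False
  then show ?thesis using a0 ac1 by (intro exI[of _ a]) (auto simp: mult.commute)
qed

lemma dominated_summable:
  assumes "dominated u f" "u > 0" "c * u < 1"
  shows "summable (\<lambda>n. c ^ n * f n)"
proof -
  obtain K where K: "\<And>n. \<bar>f n\<bar> \<le> K * u ^ n" using assms unfolding dominated_def by auto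
  have "summable (\<lambda>n. K * (c * u) ^ n)"
    using assms c0 by (intro summable_mult summable_geometric) auto
  then show ?thesis
  proof (rule summable_comparison_test')
    show "norm (c ^ n * f n) \<le> K * (c * u) ^ n" for n
      using mult_left_mono[OF K[of n], of "c ^ n"] c0
      by (simp add: abs_mult power_mult_distrib algebra_simps)
  qed
qed

lemma summable_word: "summable (\<lambda>n. c ^ n * word xs V n)"
proof -
  obtain u where "u > 0" "a \<le> u" "c * u < 1" using exists_ratio by auto
  then show ?thesis using dominated_summable dominated_word dominated_V by blast
qed

section \<open>Algebraic relations for \<open>phi\<close>\<close>

lemma phi_linear:
  assumes "\<And>n. word xs V n = r * word ys V n + s * word zs V n + t * word ws V n"
  shows "phi xs = r * phi ys + s * phi zs + t * phi ws"
proof -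
  have "phi xs = (\<Sum>n. r * (c ^ n * word ys V n) + s * (c ^ n * word zs V n) + t * (c ^ n
      * word ws V n))"
    unfolding phi_def assms by (simp add: algebra_simps)
  also have "\<dots> = r * phi ys + s * phi zs + t * phi ws"
    unfolding phi_def
    by (simp add: suminf_add[symmetric] suminf_mult summable_word summable_add summable_mult)
  finally show ?thesis .
qed

lemma phi_bulk: "phi (xs @ 1 # 0 # ys) =
    q * phi (xs @ 0 # 1 # ys) + (1 - q) * phi (xs @ 1 # ys) + (1 - q) * phi (xs @ 0 # ys)"
proof (rule phi_linear)
  fix n
  define f where "f = word ys V"
  have eq: "opD (opE f) = (\<lambda>n. 1 * (q * opE (opD f) n + (1 - q) * opD f n) + (1 - q) * opE f n)"
    by (auto simp: opD_opE algebra_simps)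
  have "word xs (opD (opE f)) n = 1 * word xs (\<lambda>n. q * opE (opD f) n + (1 - q) * opD f n) n
      + (1 - q) * word xs (opE f) n"
    unfolding eq by (rule word_linear)
  then show "word (xs @ 1 # 0 # ys) V n = q * word (xs @ 0 # 1 # ys) V n
      + (1 - q) * word (xs @ 1 # ys) V n + (1 - q) * word (xs @ 0 # ys) V n"
    by (simp add: word_append f_def[symmetric] word_linear)
qed

lemma phi_right: "phi (xs @ [1]) + a * b * phi (xs @ [0]) = (1 + a) * (1 + b) * phi xs"
proof -
  have eq: "opD V = (\<lambda>n. ((1 + a) * (1 + b)) * V n + (- a * b) * opE V n)"
    using right_boundary by (auto simp: algebra_simps)
  have "word xs (opD V) n = ((1 + a) * (1 + b)) * word xs V n + (- a * b) * word xs (opE V) n" for n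
    unfolding eq by (rule word_linear)
  then have "word (xs @ [1]) V n = (1 + a) * (1 + b) * word xs V n
      + (- a * b) * word (xs @ [0]) V n + 0 * word xs V n" for n
    by (simp add: word_append)
  from phi_linear[OF this] show ?thesis by simp
qed

text \<open>In contrast to \<open>right_boundary\<close>, this holds only after summation over the
  levels: the off-diagonal terms are reindexed until all carry the same \<open>f n\<close>. The
  coefficients of \<open>q ^ n\<close> then add up to
  \<open>d + b c d - b c d - d = 0\<close>.\<close>

lemma phi_left: "phi (0 # xs) + c * d * phi (1 # xs) = (1 + c) * (1 + d) * phi xs"
proof -
  obtain u where u: "u > 0" "a \<le> u" "c * u < 1" using exists_ratio by auto
  define f where "f = word xs V"
  have sf: "summable (\<lambda>n. c ^ n * f n)" unfolding f_def by (rule summable_word)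
  have qf: "summable (\<lambda>n. c ^ n * (z * q ^ n * f n))" for z
  proof -
    obtain K where K: "\<And>n. \<bar>f n\<bar> \<le> K * u ^ n"
      using dominated_word[OF dominated_V[OF u(2)] u(1), of xs] unfolding dominated_def f_def by auto
    show ?thesis
    proof (rule summable_comparison_test')
    show "summable (\<lambda>n. \<bar>z\<bar> * (K * (c * u) ^ n))"
      using u c0 by (intro summable_mult summable_geometric) auto
    fix n
    have "norm (c ^ n * (z * q ^ n * f n)) = c ^ n * (\<bar>z\<bar> * q ^ n * \<bar>f n\<bar>)"
      using c0 q0 by (simp add: abs_mult)
    also have "\<dots> \<le> c ^ n * (\<bar>z\<bar> * 1 * (K * u ^ n))"
      using c0 qpow K by (intro mult_left_mono mult_mono) auto
    finally show "norm (c ^ n * (z * q ^ n * f n)) \<le> \<bar>z\<bar> * (K * (c * u) ^ n)"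
      by (simp add: power_mult_distrib algebra_simps)
    qed
  qed
  \<comment> \<open>\<open>h\<close> collects the down steps of \<open>opE\<close> and
    \<open>g (Suc n)\<close> the up steps of \<open>opD\<close>. Both sequences vanish at 0, so
    shifting the index loses nothing.\<close>
  define h where "h n = (case n of 0 \<Rightarrow> 0 | Suc m \<Rightarrow> c ^ n * (1 - b * d * q ^ m) * f m)" for n
  define g where "g n = d * c ^ n * (1 - q ^ n) * f n" for n
  have hSuc: "h (Suc n) = c * (c ^ n * f n) - c * (c ^ n * (b * d * q ^ n * f n))" for n
    by (simp add: h_def algebra_simps)
  have gn: "g n = d * (c ^ n * f n) - c ^ n * (d * q ^ n * f n)" for n
    by (simp add: g_def algebra_simps)
  have "(\<lambda>n. h (Suc n)) sums (c * (\<Sum>n. c ^ n * f n) - c * (\<Sum>n. c ^ n * (b * d * q ^ n * f n)))"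
    unfolding hSuc by (intro sums_diff sums_mult summable_sums sf qf)
  then have h: "h sums (c * (\<Sum>n. c ^ n * f n) - c * (\<Sum>n. c ^ n * (b * d * q ^ n * f n)))"
    unfolding sums_Suc_iff by (simp add: h_def)
  have "g sums (d * (\<Sum>n. c ^ n * f n) - (\<Sum>n. c ^ n * (d * q ^ n * f n)))"
    unfolding gn by (intro sums_diff sums_mult summable_sums sf qf)
  then have g: "(\<lambda>n. g (Suc n)) sums (d * (\<Sum>n. c ^ n * f n) - (\<Sum>n. c ^ n * (d * q ^ n * f n)))"
    unfolding sums_Suc_iff by (simp add: g_def[of 0])
  have eq: "c ^ n * opE f n + c * d * (c ^ n * opD f n)
      = (1 + c * d) * (c ^ n * f n) + c ^ n * (d * q ^ n * f n)
        + c * (c ^ n * (b * d * q ^ n * f n)) + h n + g (Suc n)" for n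
    unfolding opE_def opD_def h_def g_def by (cases n) (simp_all add: algebra_simps)
  have "(\<lambda>n. c ^ n * opE f n + c * d * (c ^ n * opD f n)) sums
     ((1 + c * d) * (\<Sum>n. c ^ n * f n) + (\<Sum>n. c ^ n * (d * q ^ n * f n))
        + c * (\<Sum>n. c ^ n * (b * d * q ^ n * f n))
        + (c * (\<Sum>n. c ^ n * f n) - c * (\<Sum>n. c ^ n * (b * d * q ^ n * f n)))
        + (d * (\<Sum>n. c ^ n * f n) - (\<Sum>n. c ^ n * (d * q ^ n * f n))))"
    unfolding eq by (intro sums_add sums_mult summable_sums sf qf g h)
  moreover have "(\<lambda>n. c ^ n * opE f n + c * d * (c ^ n * opD f n)) sums
      (phi (0 # xs) + c * d * phi (1 # xs))"
    unfolding phi_def f_def using summable_word[of "0 # xs"] summable_word[of "1 # xs"]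
    by (intro sums_add sums_mult) (auto intro!: summable_sums)
  ultimately have "phi (0 # xs) + c * d * phi (1 # xs) =
      (1 + c * d) * (\<Sum>n. c ^ n * f n) + (\<Sum>n. c ^ n * (d * q ^ n * f n))
        + c * (\<Sum>n. c ^ n * (b * d * q ^ n * f n))
        + (c * (\<Sum>n. c ^ n * f n) - c * (\<Sum>n. c ^ n * (b * d * q ^ n * f n)))
        + (d * (\<Sum>n. c ^ n * f n) - (\<Sum>n. c ^ n * (d * q ^ n * f n)))"
    by (rule sums_unique2[rotated])
  also have "\<dots> = (1 + c) * (1 + d) * (\<Sum>n. c ^ n * f n)"
  proof -
    have "(1 + c * d) * S + T + c * U + (c * S - c * U) + (d * S - T) = (1 + c) * (1 + d) * S"
      for S T U :: real by (simp add: algebra_simps)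
    then show ?thesis .
  qed
  finally show ?thesis by (simp add: phi_def f_def)
qed

section \<open>Monotonicity, positivity and the upper bound for \<open>phi\<close>\<close>

lemma opD_mono: "(\<And>n. f n \<le> g n) \<Longrightarrow> opD f n \<le> opD g n"
  unfolding opD_def using b_diag(3)[of n] qpow(3)[of n]
  by (intro add_mono mult_left_mono) auto

lemma opE_mono: "(\<And>n. f n \<le> g n) \<Longrightarrow> opE f n \<le> opE g n"
  unfolding opE_def using d_diag(3)[of n] bdq
  by (intro add_mono mult_left_mono) (auto intro!: mult_left_mono simp: less_imp_le split: nat.split)

lemma word_mono: "(\<And>n. f n \<le> g n) \<Longrightarrow> word xs f n \<le> word xs g n"
  by (induction xs arbitrary: n) (auto intro!: opD_mono opE_mono)

lemma word_zero: "word xs (\<lambda>_. 0) n = 0"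
  using word_linear[of xs 0 "\<lambda>_. 0" 0 "\<lambda>_. 0" n] by simp

lemma word_nonneg: "(\<And>n. 0 \<le> f n) \<Longrightarrow> 0 \<le> word xs f n"
  using word_mono[of "\<lambda>_. 0" f xs n] by (simp add: word_zero)

lemma word_scale: "word xs (\<lambda>n. r * f n) n = r * word xs f n"
  using word_linear[of xs r f 0 "\<lambda>_. 0" n] by simp

lemma phi_ge: "c ^ n * word xs V n \<le> phi xs"
  unfolding phi_def using sum_le_suminf[OF summable_word, of "{n}" xs] word_nonneg[OF V_nonneg] c0
  by auto

lemma opD_ge:
  assumes "\<And>n. 0 \<le> f n" shows "(1 + b) * f n \<le> opD f n"
proof -
  have "0 \<le> (1 - q ^ Suc n) * f (Suc n)" using assms qpow(3)[of n] by simp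
  then show ?thesis unfolding opD_def using mult_right_mono[OF b_diag(1)[of n] assms[of n]] by simp
qed

lemma opE_ge:
  assumes "\<And>n. 0 \<le> f n" shows "(1 + d) * f n \<le> opE f n"
proof -
  have "0 \<le> (case n of 0 \<Rightarrow> 0 | Suc m \<Rightarrow> (1 - b * d * q ^ m) * f m)"
    using assms bdq by (auto simp: less_imp_le split: nat.split)
  then show ?thesis unfolding opE_def using mult_right_mono[OF d_diag(1)[of n] assms[of n]] by simp
qed

text \<open>The path that stays at level 0 contributes a product of factors \<open>1 + b\<close> and
  \<open>1 + d\<close>, which are positive.\<close>

lemma phi_pos: "0 < phi xs"
proof -
  have "0 < word xs V 0"
  proof (induction xs)
    case (Cons x xs)
    have nn: "\<And>n. 0 \<le> word xs V n" by (rule word_nonneg[OF V_nonneg])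
    show ?case using opD_ge[where f = "word xs V" and n = 0, OF nn] opE_ge[where f
        = "word xs V" and n = 0, OF nn]
        mult_pos_pos[of "1 + b" "word xs V 0"] mult_pos_pos[of "1 + d" "word xs V 0"] Cons b1 d1
      by (auto simp del: zero_less_mult_iff mult_pos_pos)
  qed simp
  then show ?thesis using phi_ge[of 0 xs] by simp
qed

lemma word_geometric_le:
  assumes u: "u > 0"
  shows "word xs (\<lambda>n. u ^ n) n \<le>
    (1 + u) ^ length (filter (\<lambda>x. x = 1) xs) * (1 + 1 / u) ^ length (filter (\<lambda>x. x \<noteq> 1) xs) * u ^ n"
proof (induction xs arbitrary: n)
  case (Cons x xs)
  define R where "R = (1 + u) ^ length (filter (\<lambda>x. x
      = 1) xs) * (1 + 1 / u) ^ length (filter (\<lambda>x. x \<noteq> 1) xs)"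
  have R0: "R \<ge> 0" using u by (simp add: R_def)
  have IH: "word xs (\<lambda>n. u ^ n) n \<le> R * u ^ n" for n using Cons unfolding R_def .
  have D: "opD (\<lambda>n. R * u ^ n) n \<le> (1 + u) * R * u ^ n"
  proof -
    have "opD (\<lambda>n. R * u ^ n) n \<le> 1 * (R * u ^ n) + 1 * (R * u ^ Suc n)"
      unfolding opD_def using b_diag[of n] qpow(3)[of n] qpow(1)[of "Suc n"] R0 u
      by (intro add_mono mult_right_mono) auto
    then show ?thesis by (simp add: algebra_simps)
  qed
  have E: "opE (\<lambda>n. R * u ^ n) n \<le> (1 + 1 / u) * R * u ^ n"
  proof (cases n)
    case 0
    have "(1 + d) * R \<le> 1 * R" using d0 R0 by (intro mult_right_mono) auto
    also have "\<dots> \<le> (1 + 1 / u) * R" using R0 u by (intro mult_right_mono) auto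
    finally show ?thesis using 0 by (simp add: opE_def)
  next
    case (Suc m)
    have "opE (\<lambda>n. R * u ^ n) n \<le> 1 * (R * u ^ n) + 1 * (R * u ^ m)"
      unfolding opE_def Suc using d_diag[of "Suc m"] bdq[of m] R0 u
      by (simp only: nat.case) (intro add_mono mult_right_mono, auto)
    also have "\<dots> = (1 + 1 / u) * R * u ^ n" using Suc u by (simp add: field_simps)
    finally show ?thesis .
  qed
  show ?case
  proof (cases "x = 1")
    case True
    have "opD (word xs ((^) u)) n \<le> (1 + u) * R * u ^ n"
      using opD_mono[of "word xs ((^) u)" "\<lambda>n. R * u ^ n" n, OF IH] D by simp
    then show ?thesis using True by (simp add: R_def)
  next
    case False
    have "opE (word xs ((^) u)) n \<le> (1 + 1 / u) * R * u ^ n"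
      using opE_mono[of "word xs ((^) u)" "\<lambda>n. R * u ^ n" n, OF IH] E by simp
    then show ?thesis using False by (simp add: R_def mult.assoc mult.left_commute)
  qed
qed simp

text \<open>The condition \<open>a \<le> u\<close> dominates the right vector by
  \<open>u ^ n\<close>, and \<open>c * u < 1\<close> makes the sum against the left vector converge.
  The constant depends on \<open>u\<close> but not on the length of the word.\<close>

lemma phi_upper:
  assumes u: "u > 0" "a \<le> u" "c * u < 1"
  shows "\<exists>K>0. \<forall>xs. phi xs \<le>
    K * ((1 + u) ^ length (filter (\<lambda>x. x = 1) xs) * (1 + 1 / u) ^ length (filter (\<lambda>x. x \<noteq> 1) xs))"
proof -
  obtain K where K: "\<And>n. \<bar>V n\<bar> \<le> K * u ^ n"
    using dominated_V[OF u(2)] unfolding dominated_def by auto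
  have K1: "1 \<le> K" using K[of 0] by simp
  define R where "R xs = (1 + u) ^ length (filter (\<lambda>x. x
      = 1) xs) * (1 + 1 / u) ^ length (filter (\<lambda>x. x \<noteq> 1) xs)" for xs :: "nat list"
  have "phi xs \<le> K / (1 - c * u) * R xs" for xs
  proof -
    have "phi xs \<le> (\<Sum>n. K * R xs * (c * u) ^ n)"
      unfolding phi_def
    proof (intro suminf_le summable_word summable_mult summable_geometric)
      show "norm (c * u) < 1" using u c0 by simp
      fix n
      have "word xs V n \<le> word xs (\<lambda>n. K * u ^ n) n"
        using K by (intro word_mono) (auto intro: order.trans[OF abs_ge_self])
      also have "\<dots> \<le> K * (R xs * u ^ n)"
        unfolding word_scale R_def using word_geometric_le[OF u(1)] K1
        by (intro mult_left_mono) auto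
      finally have "c ^ n * word xs V n \<le> c ^ n * (K * (R xs * u ^ n))"
        using c0 by (intro mult_left_mono) auto
      then show "c ^ n * word xs V n \<le> K * R xs * (c * u) ^ n"
        by (simp add: power_mult_distrib algebra_simps)
    qed
    also have "\<dots> = K * R xs * (1 / (1 - c * u))"
      using u c0 by (subst suminf_mult) (auto intro!: summable_geometric simp: suminf_geometric)
    finally show ?thesis by simp
  qed
  then show ?thesis unfolding R_def using K1 u
    by (intro exI[of _ "K / (1 - c * u)"]) auto
qed

end

section \<open>The invariant measure\<close>

text \<open>This is the derivative at time 0 of the invariance of \<mu> under the transition
  function. Invariance is available for nonnegative times only, so the derivative of the everywhere
  convergent power series is evaluated as a one-sided limit.\<close>

lemma ctmc_invariant_generator:
  assumes fin: "finite S" and inv: "ctmc_invariant S r \<mu>" and y: "y \<in> S"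
  shows "(\<Sum>x\<in>S. pmf \<mu> x * ctmc_generator S r x y) = 0"
proof -
  let ?Q = "ctmc_generator S r"
  let ?P = "ctmc_generator_power S r"
  \<comment> \<open>\<open>K\<close> bounds every entry of the generator, so the entries of its n-th
    power are at most \<open>(card S * K) ^ n\<close> and the series is dominated by an exponential
    one.\<close>
  define K where "K = (\<Sum>x\<in>S. \<Sum>z\<in>S. \<bar>?Q x z\<bar>)"
  have K: "\<bar>?Q x z\<bar> \<le> K" if "x \<in> S" "z \<in> S" for x z
  proof -
    have "\<bar>?Q x z\<bar> \<le> (\<Sum>z\<in>S. \<bar>?Q x z\<bar>)"
      using fin that by (intro member_le_sum) auto
    also have "\<dots> \<le> K" unfolding K_def
      using fin that by (intro member_le_sum[of x S "\<lambda>x. \<Sum>z\<in>S. \<bar>?Q x z\<bar>"]) (auto intro: sum_nonneg)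
    finally show ?thesis .
  qed
  have K0: "0 \<le> K" unfolding K_def by (intro sum_nonneg) auto
  have P: "\<bar>?P n x z\<bar> \<le> (real (card S) * K) ^ n" if "x \<in> S" "z \<in> S" for n x z
    using that
  proof (induction n arbitrary: z)
    case (Suc n)
    have "\<bar>?P (Suc n) x z\<bar> \<le> (\<Sum>v\<in>S. \<bar>?P n x v * ?Q v z\<bar>)"
      by (simp add: sum_abs)
    also have "\<dots> \<le> (\<Sum>v\<in>S. (real (card S) * K) ^ n * K)"
      unfolding abs_mult using Suc K K0 by (intro sum_mono mult_mono) auto
    finally show ?case by (simp add: algebra_simps)
  qed auto
  have summ: "summable (\<lambda>n. t ^ n / fact n * ?P n x y)" if "x \<in> S" for t x
  proof (rule summable_comparison_test')
    show "summable (\<lambda>n. (\<bar>t\<bar> * (real (card S) * K)) ^ n /\<^sub>R fact n)"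
      by (rule summable_exp_generic)
    show "norm (t ^ n / fact n * ?P n x y) \<le> (\<bar>t\<bar> * (real (card S) * K)) ^ n /\<^sub>R fact n" for n
      using mult_left_mono[OF P[OF that y, of n], of "\<bar>t\<bar> ^ n / fact n"]
      by (simp add: abs_mult power_abs power_mult_distrib divide_inverse algebra_simps)
  qed
  define k where "k n = (\<Sum>x\<in>S. pmf \<mu> x * ?P n x y) / fact n" for n
  have kt: "k n * t ^ n = (\<Sum>x\<in>S. pmf \<mu> x * (t ^ n / fact n * ?P n x y))" for n t
    by (simp add: k_def sum_divide_distrib sum_distrib_left sum_distrib_right mult_ac)
  have summk: "summable (\<lambda>n. k n * t ^ n)" for t
    unfolding kt by (intro summable_sum summable_mult summ)
  have const: "(\<Sum>n. k n * t ^ n) = pmf \<mu> y" if "t \<ge> 0" for t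
  proof -
    have "(\<Sum>n. k n * t ^ n) = (\<Sum>x\<in>S. pmf \<mu> x * ctmc_transition S r t x y)"
    proof -
      have "(\<Sum>n. k n * t ^ n) = (\<Sum>x\<in>S. \<Sum>n. pmf \<mu> x * (t ^ n / fact n * ?P n x y))"
        unfolding kt by (rule suminf_sum) (intro summable_mult summ)
      also have "\<dots> = (\<Sum>x\<in>S. pmf \<mu> x * ctmc_transition S r t x y)"
        unfolding ctmc_transition_def by (intro sum.cong refl suminf_mult summ)
      finally show ?thesis .
    qed
    then show ?thesis using inv y that unfolding ctmc_invariant_def by auto
  qed
  have "((\<lambda>t. \<Sum>n. k n * t ^ n) has_field_derivative (\<Sum>n. diffs k n * 0 ^ n)) (at 0)"
    by (rule termdiffs_strong_converges_everywhere) (rule summk)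
  moreover have "(\<Sum>n. diffs k n * 0 ^ n) = k 1"
    by (subst powser_zero) (simp add: diffs_def)
  ultimately have "((\<lambda>h. ((\<Sum>n. k n * h ^ n) - (\<Sum>n. k n * 0 ^ n)) / h) \<longlongrightarrow> k 1) (at 0)"
    by (simp add: has_field_derivative_iff)
  then have "((\<lambda>h. ((\<Sum>n. k n * h ^ n) - (\<Sum>n. k n * 0 ^ n)) / h) \<longlongrightarrow> k 1) (at_right 0)"
    by (rule tendsto_mono[OF at_le[OF subset_UNIV]])
  moreover have "((\<lambda>h. ((\<Sum>n. k n * h ^ n) - (\<Sum>n. k n * 0 ^ n)) / h) \<longlongrightarrow> 0) (at_right 0)"
  proof (rule tendsto_eventually)
    have "eventually (\<lambda>h::real. h > 0) (at_right 0)" by (rule eventually_at_right_less)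
    then show "eventually (\<lambda>h. ((\<Sum>n. k n * h ^ n) - (\<Sum>n. k n * 0 ^ n)) / h = 0) (at_right 0)"
      by eventually_elim (simp add: const del: powser_zero)
  qed
  ultimately have "k 1 = 0"
    using tendsto_unique trivial_limit_at_right_real by blast
  moreover have "?P 1 x y = ?Q x y" if "x \<in> S" for x
    using fin that by (simp add: if_distrib[of "\<lambda>u. u * _"] sum.delta cong: if_cong)
  ultimately show ?thesis by (simp add: k_def)
qed

text \<open>Subtracting from \<open>\<mu>\<close> the largest multiple of \<open>w\<close> below it leaves a nonnegative stationary vector
  with a zero, and zeros propagate backwards along jumps.\<close>

lemma stationary_unique:
  fixes w \<mu> :: "'a \<Rightarrow> real"
  assumes fin: "finite S" and ne: "S \<noteq> {}"
    and r0: "\<And>x y. 0 \<le> r x y"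
    and w: "\<And>x. x \<in> S \<Longrightarrow> 0 < w x"
    and sw: "\<And>y. y \<in> S \<Longrightarrow> (\<Sum>x\<in>S. w x * ctmc_generator S r x y) = 0"
    and sm: "\<And>y. y \<in> S \<Longrightarrow> (\<Sum>x\<in>S. \<mu> x * ctmc_generator S r x y) = 0"
    and irr: "\<And>Z. Z \<subseteq> S \<Longrightarrow> Z \<noteq> {} \<Longrightarrow>
        (\<And>x y. x \<in> S \<Longrightarrow> y \<in> Z \<Longrightarrow> x \<noteq> y \<Longrightarrow> 0 < r x y \<Longrightarrow> x \<in> Z) \<Longrightarrow> Z = S"
  shows "\<exists>k. \<forall>x\<in>S. \<mu> x = k * w x"
proof -
  define k where "k = Min ((\<lambda>x. \<mu> x / w x) ` S)"
  define f where "f x = \<mu> x - k * w x" for x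
  have f0: "0 \<le> f x" if "x \<in> S" for x
  proof -
    have "k \<le> \<mu> x / w x" unfolding k_def using fin that by (intro Min_le) auto
    then show ?thesis using w[OF that] by (simp add: f_def field_simps)
  qed
  have "k \<in> (\<lambda>x. \<mu> x / w x) ` S" unfolding k_def using fin ne by (intro Min_in) auto
  then obtain x0 where x0: "x0 \<in> S" "f x0 = 0" using w by (force simp: f_def)
  define Z where "Z = {x \<in> S. f x = 0}"
  have "Z = S"
  proof (rule irr)
    fix x y assume x: "x \<in> S" and y: "y \<in> Z" and ne: "x \<noteq> y" and r: "0 < r x y"
    have yS: "y \<in> S" and fy: "f y = 0" using y by (auto simp: Z_def)
    have "(\<Sum>x\<in>S. f x * ctmc_generator S r x y)
        = (\<Sum>x\<in>S. \<mu> x * ctmc_generator S r x y) - k * (\<Sum>x\<in>S. w x * ctmc_generator S r x y)"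
      by (simp add: f_def sum_subtractf sum_distrib_left algebra_simps)
    also have "\<dots> = 0" using sw sm yS by simp
    finally have "(\<Sum>x\<in>S. f x * ctmc_generator S r x y) = 0" .
    \<comment> \<open>At a zero \<open>y\<close> of \<open>f\<close> the diagonal term drops out, so
      stationarity at \<open>y\<close> is a vanishing sum of nonnegative terms.\<close>
    moreover have "0 \<le> f z * ctmc_generator S r z y" if "z \<in> S" for z
      using f0[OF that] r0 fy by (cases "z = y") (auto simp: ctmc_generator_def)
    ultimately have "f x * ctmc_generator S r x y = 0"
      using fin x by (simp add: sum_nonneg_eq_0_iff)
    then show "x \<in> Z" using r ne x by (simp add: Z_def ctmc_generator_def)
  qed (use x0 in \<open>auto simp: Z_def\<close>)
  then show ?thesis by (intro exI[of _ k]) (auto simp: Z_def f_def)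
qed

section \<open>Irreducibility of the ASEP\<close>

lemma asep_states_upd:
  "\<tau> \<in> asep_states N \<Longrightarrow> j \<in> {1..N} \<Longrightarrow> x \<in> {0, 1} \<Longrightarrow> \<tau>(j := x) \<in> asep_states N"
  unfolding asep_states_def by (auto simp: PiE_iff extensional_def)

lemma asep_states_01: "\<tau> \<in> asep_states N \<Longrightarrow> j \<in> {1..N} \<Longrightarrow> \<tau> j = 0 \<or> \<tau> j = 1"
  unfolding asep_states_def by auto

lemma finite_asep_states [simp]: "finite (asep_states N)"
  unfolding asep_states_def by (intro finite_PiE) auto

lemma asep_rate_nonneg:
  assumes "\<alpha> \<ge> 0" "\<beta> \<ge> 0" "\<gamma> \<ge> 0" "\<delta> \<ge> 0" "q \<ge> 0"
  shows "0 \<le> asep_rate \<alpha> \<beta> \<gamma> \<delta> q N \<tau> \<sigma>"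
  unfolding asep_rate_def using assms by (intro add_nonneg_nonneg sum_nonneg) auto

lemma asep_rate_self: "asep_rate \<alpha> \<beta> \<gamma> \<delta> q N \<tau> \<tau> = 0"
proof -
  have "\<tau> \<noteq> \<tau>(j := 0, j + 1 := 1)" if "\<tau> j = 1" for j
    using that by (auto simp: fun_eq_iff intro!: exI[of _ j])
  moreover have "\<tau> \<noteq> \<tau>(j := 1, j + 1 := 0)" if "\<tau> j = 0" for j
    using that by (auto simp: fun_eq_iff intro!: exI[of _ j])
  moreover have "\<tau> \<noteq> \<tau>(j := x)" if "\<tau> j \<noteq> x" for j x
    using that by (auto simp: fun_eq_iff intro!: exI[of _ j])
  ultimately show ?thesis unfolding asep_rate_def by (auto intro!: sum.neutral)
qed

lemma asep_rate_right_jump: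
  assumes "\<alpha> \<ge> 0" "\<beta> \<ge> 0" "\<gamma> \<ge> 0" "\<delta> \<ge> 0" "q \<ge> 0"
    and "1 \<le> j" "j < N" "\<tau> j = 1" "\<tau> (j + 1) = 0"
  shows "0 < asep_rate \<alpha> \<beta> \<gamma> \<delta> q N \<tau> (\<tau>(j := 0, j + 1 := 1))"
proof -
  let ?\<sigma> = "\<tau>(j := 0, j + 1 := 1)"
  let ?f = "\<lambda>j. (if \<tau> j = 1 \<and> \<tau> (j + 1) = 0 \<and> ?\<sigma> = \<tau>(j := 0, j + 1 := 1) then 1 else 0)
      + (if \<tau> j = 0 \<and> \<tau> (j + 1) = 1 \<and> ?\<sigma> = \<tau>(j := 1, j + 1 := 0) then q else 0)"
  have "?f j \<le> (\<Sum>j\<in>{1..<N}. ?f j)"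
    using assms by (intro member_le_sum) auto
  moreover have "?f j \<ge> 1" using assms by auto
  ultimately have "(\<Sum>j\<in>{1..<N}. ?f j) \<ge> 1" by linarith
  then show ?thesis unfolding asep_rate_def using assms by (intro add_pos_nonneg) auto
qed

text \<open>Only entry at site 1, jumps to the right and exit at site \<open>N\<close> are certain
  to have positive rate, as \<gamma>, \<delta> and \<open>q\<close> may vanish. They suffice: every
  configuration can be emptied through the right end and built up from the empty one through the
  left end.\<close>

lemma asep_irreducible:
  assumes p: "\<alpha> > 0" "\<beta> > 0" "\<gamma> \<ge> 0" "\<delta> \<ge> 0" "q \<ge> 0" and N: "N \<ge> 1"
    and Z: "Z \<subseteq> asep_states N" "Z \<noteq> {}"
    and cl: "\<And>x y. x \<in> asep_states N \<Longrightarrow> y \<in> Z \<Longrightarrow> x \<noteq> y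
        \<Longrightarrow> 0 < asep_rate \<alpha> \<beta> \<gamma> \<delta> q N x y \<Longrightarrow> x \<in> Z"
  shows "Z = asep_states N"
proof -
  let ?S = "asep_states N"
  define e where "e = restrict (\<lambda>_. 0::nat) {1..N}"
  have e_iff: "\<tau> = e" if "\<tau> \<in> ?S" "\<And>j. j \<in> {1..N} \<Longrightarrow> \<tau> j = 0" for \<tau>
    using that unfolding e_def asep_states_def by (intro PiE_ext[where k = "{1..N}"]) auto
  have rate_0: "0 < asep_rate \<alpha> \<beta> \<gamma> \<delta> q N \<tau> (\<tau>(1 := 1))" if "\<tau> 1 = 0" for \<tau>
    unfolding asep_rate_def
    by (rule add_pos_nonneg, rule add_pos_nonneg, rule add_pos_nonneg, rule add_nonneg_pos, rule
        sum_nonneg)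
      (use p that in auto)
  have rate_N: "0 < asep_rate \<alpha> \<beta> \<gamma> \<delta> q N \<tau> (\<tau>(N := 0))" if "\<tau> N = 1" for \<tau>
    unfolding asep_rate_def
    by (rule add_nonneg_pos, intro add_nonneg_nonneg sum_nonneg) (use p that in auto)
  \<comment> \<open>A member of \<open>Z\<close> is dismantled backwards in time: its first particle
    is moved to the left and finally taken out at site 1, where it entered. The sum of the positions
    decreases.\<close>
  have to_e: "\<tau> \<in> Z \<Longrightarrow> e \<in> Z" for \<tau>
  proof (induction "\<Sum>j\<in>{1..N}. j * \<tau> j" arbitrary: \<tau> rule: less_induct)
    case less
    have \<tau>S: "\<tau> \<in> ?S" using less.prems Z by auto
    show ?case
    proof (cases "\<exists>j\<in>{1..N}. \<tau> j \<noteq> 0")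
      case False
      then show ?thesis using e_iff[OF \<tau>S] less.prems by auto
    next
      case True
      define j where "j = Min {j \<in> {1..N}. \<tau> j \<noteq> 0}"
      have "j \<in> {j \<in> {1..N}. \<tau> j \<noteq> 0}" unfolding j_def using True by (intro Min_in) auto
      then have j: "j \<in> {1..N}" "\<tau> j \<noteq> 0" by auto
      have jl: "\<tau> i = 0" if "i \<in> {1..N}" "i < j" for i
        using Min_le[of "{j \<in> {1..N}. \<tau> j \<noteq> 0}" i] that unfolding j_def by fastforce
      have j1: "\<tau> j = 1" using asep_states_01[OF \<tau>S j(1)] j(2) by auto
      show ?thesis
      proof (cases "j = 1")
        case True
        define \<sigma> where "\<sigma> = \<tau>(1 := 0)"
        have \<sigma>S: "\<sigma> \<in> ?S" unfolding \<sigma>_def using \<tau>S N by (intro asep_states_upd) auto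
        have "\<tau> = \<sigma>(1 := 1)" using j1 True by (auto simp: \<sigma>_def fun_eq_iff)
        then have "0 < asep_rate \<alpha> \<beta> \<gamma> \<delta> q N \<sigma> \<tau>" using rate_0[of \<sigma>] by (simp add: \<sigma>_def)
        moreover have "\<sigma> \<noteq> \<tau>" using j1 True by (auto simp: \<sigma>_def fun_eq_iff)
        ultimately have \<sigma>Z: "\<sigma> \<in> Z" using cl \<sigma>S less.prems by blast
        have "(\<Sum>j\<in>{1..N}. j * \<sigma> j) < (\<Sum>j\<in>{1..N}. j * \<tau> j)"
          using j1 True N by (intro sum_strict_mono_ex1) (auto simp: \<sigma>_def intro!: bexI[of _ 1])
        then show ?thesis using less.hyps \<sigma>Z by blast
      next
        case False
        define i where "i = j - 1"
        have ij: "j = i + 1" "1 \<le> i" "i < N" using False j by (auto simp: i_def)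
        have i0: "\<tau> i = 0" using jl ij by auto
        define \<sigma> where "\<sigma> = \<tau>(i := 1, j := 0)"
        have \<sigma>S: "\<sigma> \<in> ?S" unfolding \<sigma>_def using \<tau>S ij by (intro asep_states_upd) auto
        have "\<tau> = \<sigma>(i := 0, i + 1 := 1)" using j1 i0 ij by (auto simp: \<sigma>_def fun_eq_iff)
        then have "0 < asep_rate \<alpha> \<beta> \<gamma> \<delta> q N \<sigma> \<tau>"
          using asep_rate_right_jump[of \<alpha> \<beta> \<gamma> \<delta> q i N \<sigma>] p ij by (simp add: \<sigma>_def)
        moreover have "\<sigma> \<noteq> \<tau>" using i0 ij by (auto simp: \<sigma>_def fun_eq_iff intro!: exI[of _ i])
        ultimately have \<sigma>Z: "\<sigma> \<in> Z" using cl \<sigma>S less.prems by blast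
        have split: "(\<Sum>j\<in>{1..N}. j * \<rho> j) = i * \<rho> i + j * \<rho> j + (\<Sum>j\<in>{1..N} - {i, j}. j * \<rho> j)"
          for \<rho> :: "nat \<Rightarrow> nat"
        proof -
          have "{1..N} = insert i (insert j ({1..N} - {i, j}))" using ij j by auto
          then have "(\<Sum>j\<in>{1..N}. j * \<rho> j) = (\<Sum>j\<in>insert i (insert j ({1..N} - {i, j})). j * \<rho> j)" by simp
          also have "\<dots> = i * \<rho> i + j * \<rho> j + (\<Sum>j\<in>{1..N} - {i, j}. j * \<rho> j)"
            using ij by (subst sum.insert) auto
          finally show ?thesis .
        qed
        have "(\<Sum>j\<in>{1..N} - {i, j}. j * \<sigma> j) = (\<Sum>j\<in>{1..N} - {i, j}. j * \<tau> j)"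
          by (intro sum.cong) (auto simp: \<sigma>_def)
        then have "(\<Sum>j\<in>{1..N}. j * \<sigma> j) < (\<Sum>j\<in>{1..N}. j * \<tau> j)"
          unfolding split using i0 j1 ij by (simp add: \<sigma>_def)
        then show ?thesis using less.hyps \<sigma>Z by blast
      qed
    qed
  qed
  have eZ: "e \<in> Z" using to_e Z by auto
  \<comment> \<open>Forwards in time, the last particle is moved to the right and out at site
    \<open>N\<close>. The induction is on the total distance to the exit, and \<open>cl\<close>
    carries membership back from the successor.\<close>
  have from_e: "\<tau> \<in> ?S \<Longrightarrow> \<tau> \<in> Z" for \<tau>
  proof (induction "\<Sum>j\<in>{1..N}. (N + 1 - j) * \<tau> j" arbitrary: \<tau> rule: less_induct)
    case less
    have \<tau>S: "\<tau> \<in> ?S" using less.prems by auto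
    show ?case
    proof (cases "\<exists>j\<in>{1..N}. \<tau> j \<noteq> 0")
      case False
      then show ?thesis using e_iff[OF \<tau>S] eZ by auto
    next
      case True
      define j where "j = Max {j \<in> {1..N}. \<tau> j \<noteq> 0}"
      have "j \<in> {j \<in> {1..N}. \<tau> j \<noteq> 0}" unfolding j_def using True by (intro Max_in) auto
      then have j: "j \<in> {1..N}" "\<tau> j \<noteq> 0" by auto
      have jl: "\<tau> i = 0" if "i \<in> {1..N}" "i > j" for i
        using Max_ge[of "{j \<in> {1..N}. \<tau> j \<noteq> 0}" i] that unfolding j_def by fastforce
      have j1: "\<tau> j = 1" using asep_states_01[OF \<tau>S j(1)] j(2) by auto
      show ?thesis
      proof (cases "j = N")
        case True
        define \<sigma> where "\<sigma> = \<tau>(N := 0)"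
        have \<sigma>S: "\<sigma> \<in> ?S" unfolding \<sigma>_def using \<tau>S N by (intro asep_states_upd) auto
        have r: "0 < asep_rate \<alpha> \<beta> \<gamma> \<delta> q N \<tau> \<sigma>" using rate_N[of \<tau>] j1 True by (simp add: \<sigma>_def)
        have ne: "\<tau> \<noteq> \<sigma>" using j1 True by (auto simp: \<sigma>_def fun_eq_iff)
        have "(\<Sum>j\<in>{1..N}. (N + 1 - j) * \<sigma> j) < (\<Sum>j\<in>{1..N}. (N + 1 - j) * \<tau> j)"
          using j1 True N by (intro sum_strict_mono_ex1) (auto simp: \<sigma>_def intro!: bexI[of _ N])
        then have "\<sigma> \<in> Z" using less.hyps \<sigma>S by blast
        then show ?thesis using cl[OF \<tau>S _ ne r] by blast
      next
        case False
        define i where "i = j + 1"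
        have ij: "i = j + 1" "1 \<le> j" "j < N" using False j by (auto simp: i_def)
        have i0: "\<tau> i = 0" using jl ij by auto
        define \<sigma> where "\<sigma> = \<tau>(j := 0, j + 1 := 1)"
        have \<sigma>S: "\<sigma> \<in> ?S" unfolding \<sigma>_def using \<tau>S ij by (intro asep_states_upd) auto
        have r: "0 < asep_rate \<alpha> \<beta> \<gamma> \<delta> q N \<tau> \<sigma>"
          unfolding \<sigma>_def using asep_rate_right_jump[of \<alpha> \<beta> \<gamma> \<delta> q j N \<tau>] p ij i0 j1 by simp
        have ne: "\<tau> \<noteq> \<sigma>" using j1 ij by (auto simp: \<sigma>_def fun_eq_iff intro!: exI[of _ j])
        have split: "(\<Sum>j\<in>{1..N}. (N + 1 - j) * \<rho> j) =
            (N + 1 - i) * \<rho> i + (N + 1 - j) * \<rho> j + (\<Sum>j\<in>{1..N} - {i, j}. (N + 1 - j) * \<rho> j)"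
          for \<rho> :: "nat \<Rightarrow> nat"
        proof -
          have "{1..N} = insert i (insert j ({1..N} - {i, j}))" using ij j by auto
          then have "(\<Sum>j\<in>{1..N}. (N + 1 - j) * \<rho> j) =
              (\<Sum>j\<in>insert i (insert j ({1..N} - {i, j})). (N + 1 - j) * \<rho> j)" by simp
          also have "\<dots> = (N + 1 - i) * \<rho> i + (N + 1 - j) * \<rho> j + (\<Sum>j\<in>{1..N} - {i, j}. (N + 1 - j)
              * \<rho> j)"
            using ij by (subst sum.insert) auto
          finally show ?thesis .
        qed
        have "(\<Sum>j\<in>{1..N} - {i, j}. (N + 1 - j) * \<sigma> j) = (\<Sum>j\<in>{1..N} - {i, j}. (N + 1 - j) * \<tau> j)"
          using ij by (intro sum.cong) (auto simp: \<sigma>_def)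
        then have "(\<Sum>j\<in>{1..N}. (N + 1 - j) * \<sigma> j) < (\<Sum>j\<in>{1..N}. (N + 1 - j) * \<tau> j)"
          unfolding split using i0 j1 ij by (simp add: \<sigma>_def)
        then have "\<sigma> \<in> Z" using less.hyps \<sigma>S by blast
        then show ?thesis using cl[OF \<tau>S _ ne r] by blast
      qed
    qed
  qed
  show ?thesis using from_e Z by auto
qed

section \<open>Stationarity of the matrix product weights\<close>

context matrix_ansatz
begin

definition weight :: "nat \<Rightarrow> (nat \<Rightarrow> nat) \<Rightarrow> real" where
  "weight N \<tau> = phi (map \<tau> [1..<Suc N])"

text \<open>The matrix product with site \<open>j\<close> deleted: the net flow through a bond is a difference of
  two such terms, so the stationarity equation telescopes.\<close>

definition deleted_weight :: "nat \<Rightarrow> (nat \<Rightarrow> nat) \<Rightarrow> nat \<Rightarrow> real" where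
  "deleted_weight N \<tau> j = (if \<tau> j = 1 then 1 else -1) * phi (map \<tau> [1..<j] @ map \<tau> [Suc j..<Suc N])"

text \<open>For unequal neighbours this is \<open>phi_bulk\<close>: the signs in
  \<open>deleted_weight\<close> turn the sum of the two shorter words into a difference. For equal
  neighbours both deletions leave the same word with the same sign.\<close>

lemma bond_balance:
  assumes \<tau>: "\<tau> \<in> asep_states N" and j: "1 \<le> j" "j < N"
  shows "(if \<tau> j = 0 \<and> \<tau> (j + 1) = 1 then weight N (\<tau>(j := 1, j + 1 := 0)) else 0)
    + (if \<tau> j = 1 \<and> \<tau> (j + 1) = 0 then q * weight N (\<tau>(j := 0, j + 1 := 1)) else 0)
    - (weight N \<tau> * (if \<tau> j = 1 \<and> \<tau> (j + 1) = 0 then 1 else 0)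
       + weight N \<tau> * (if \<tau> j = 0 \<and> \<tau> (j + 1) = 1 then q else 0))
    = (1 - q) * (deleted_weight N \<tau> (Suc j) - deleted_weight N \<tau> j)"
proof -
  define l where "l = map \<tau> [1..<j]"
  define r where "r = map \<tau> [Suc (Suc j)..<Suc N]"
  have split: "[1..<Suc N] = [1..<j] @ j # Suc j # [Suc (Suc j)..<Suc N]"
  proof -
    have "[1..<Suc N] = [1..<j] @ [j..<Suc N]" using j upt_add_eq_append[of 1 j "Suc N - j"] by simp
    then show ?thesis using j by (simp add: upt_conv_Cons)
  qed
  have w: "weight N (\<tau>(j := x, j + 1 := y)) = phi (l @ x # y # r)" for x y
    unfolding weight_def split l_def r_def by (auto intro!: arg_cong[of _ _ phi])
  have w0: "weight N \<tau> = phi (l @ \<tau> j # \<tau> (j + 1) # r)"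
    unfolding weight_def split l_def r_def by simp
  have d1: "deleted_weight N \<tau> j = (if \<tau> j = 1 then 1 else -1) * phi (l @ \<tau> (j + 1) # r)"
    unfolding deleted_weight_def l_def r_def using j by (simp add: upt_conv_Cons del: upt_Suc)
  have d2: "deleted_weight N \<tau> (Suc j) = (if \<tau> (j + 1) = 1 then 1 else -1) * phi (l @ \<tau> j # r)"
    unfolding deleted_weight_def l_def r_def using j by simp
  have "\<tau> j = 0 \<or> \<tau> j = 1" "\<tau> (j + 1) = 0 \<or> \<tau> (j + 1) = 1"
    using asep_states_01[OF \<tau>] j by auto
  then show ?thesis
    unfolding w w0 d1 d2 using phi_bulk[of l r] by (auto simp: algebra_simps)
qed

text \<open>The assumptions on \<alpha> and \<gamma> give the values at -1 and 0 of the quadratic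
  with roots \<open>c\<close> and \<open>d\<close> and leading coefficient \<alpha>. They turn
  \<open>phi_left\<close> into the relation \<open>rel\<close>, whose right-hand side is the word
  with site 1 deleted.\<close>

lemma left_balance:
  assumes \<tau>: "\<tau> \<in> asep_states N" and N: "1 \<le> N"
    and \<alpha>: "\<alpha> * ((1 + c) * (1 + d)) = 1 - q" and \<gamma>: "\<gamma> = - c * d * \<alpha>"
  shows "(if \<tau> 1 = 1 then \<alpha> * weight N (\<tau>(1 := 0)) else 0)
    + (if \<tau> 1 = 0 then \<gamma> * weight N (\<tau>(1 := 1)) else 0)
    - (weight N \<tau> * (if \<tau> 1 = 0 then \<alpha> else 0) + weight N \<tau> * (if \<tau> 1 = 1 then \<gamma> else 0))
    = (1 - q) * deleted_weight N \<tau> 1"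
proof -
  define r where "r = map \<tau> [Suc 1..<Suc N]"
  have split: "[1..<Suc N] = 1 # [Suc 1..<Suc N]" using N by (simp add: upt_conv_Cons)
  have w: "weight N (\<tau>(1 := x)) = phi (x # r)" for x
    unfolding weight_def split r_def by (auto intro!: arg_cong[of _ _ phi])
  have w0: "weight N \<tau> = phi (\<tau> 1 # r)" unfolding weight_def split r_def by simp
  have d: "deleted_weight N \<tau> 1 = (if \<tau> 1 = 1 then 1 else -1) * phi r"
    unfolding deleted_weight_def r_def by simp
  have rel: "\<alpha> * phi (0 # r) - \<gamma> * phi (1 # r) = (1 - q) * phi r"
    using arg_cong[OF phi_left[of r], of "\<lambda>x. \<alpha> * x"] unfolding \<alpha>[symmetric] \<gamma>
    by (simp add: algebra_simps)
  show ?thesis using asep_states_01[OF \<tau>, of 1] N rel unfolding w w0 d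
    by (auto simp: algebra_simps)
qed

lemma right_balance:
  assumes \<tau>: "\<tau> \<in> asep_states N" and N: "1 \<le> N"
    and \<beta>: "\<beta> * ((1 + a) * (1 + b)) = 1 - q" and \<delta>: "\<delta> = - a * b * \<beta>"
  shows "(if \<tau> N = 1 then \<delta> * weight N (\<tau>(N := 0)) else 0)
    + (if \<tau> N = 0 then \<beta> * weight N (\<tau>(N := 1)) else 0)
    - (weight N \<tau> * (if \<tau> N = 0 then \<delta> else 0) + weight N \<tau> * (if \<tau> N = 1 then \<beta> else 0))
    = - (1 - q) * deleted_weight N \<tau> N"
proof -
  define l where "l = map \<tau> [1..<N]"
  have split: "[1..<Suc N] = [1..<N] @ [N]" using N by simp
  have w: "weight N (\<tau>(N := x)) = phi (l @ [x])" for x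
    unfolding weight_def split l_def by (auto intro!: arg_cong[of _ _ phi])
  have w0: "weight N \<tau> = phi (l @ [\<tau> N])" unfolding weight_def split l_def by simp
  have d: "deleted_weight N \<tau> N = (if \<tau> N = 1 then 1 else -1) * phi l"
    unfolding deleted_weight_def l_def by simp
  have rel: "\<beta> * phi (l @ [1]) - \<delta> * phi (l @ [0]) = (1 - q) * phi l"
    using arg_cong[OF phi_right[of l], of "\<lambda>x. \<beta> * x"] unfolding \<beta>[symmetric] \<delta>
    by (simp add: algebra_simps)
  show ?thesis using asep_states_01[OF \<tau>, of N] N rel unfolding w w0 d
    by (auto simp: algebra_simps)
qed

lemma weight_stationary:
  assumes \<tau>: "\<tau> \<in> asep_states N" and N: "1 \<le> N"
    and \<alpha>: "\<alpha> * ((1 + c) * (1 + d)) = 1 - q" and \<gamma>: "\<gamma> = - c * d * \<alpha>"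
    and \<beta>: "\<beta> * ((1 + a) * (1 + b)) = 1 - q" and \<delta>: "\<delta> = - a * b * \<beta>"
  shows "(\<Sum>\<sigma>\<in>asep_states N. weight N \<sigma> *
      ctmc_generator (asep_states N) (asep_rate \<alpha> \<beta> \<gamma> \<delta> q N) \<sigma> \<tau>) = 0"
proof -
  let ?S = "asep_states N" and ?r = "asep_rate \<alpha> \<beta> \<gamma> \<delta> q N" and ?w = "weight N"
  have gen: "ctmc_generator ?S ?r \<sigma> \<tau> = ?r \<sigma> \<tau> - (if \<sigma> = \<tau> then (\<Sum>\<sigma>\<in>?S. ?r \<tau> \<sigma>) else 0)" for \<sigma>
    using sum.remove[OF finite_asep_states \<tau>, of "?r \<tau>"]
    by (auto simp: ctmc_generator_def asep_rate_self)
  \<comment> \<open>For each type of transition at most one state \<open>\<rho>\<close> leads to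
    \<tau>, so summing the indicator over all states picks out a single weight.\<close>
  have pick_in: "(\<Sum>\<sigma>\<in>?S. ?w \<sigma> * (if A \<sigma> then k else 0)) = (if B then k * ?w \<rho> else 0)"
    if "\<And>\<sigma>. A \<sigma> \<longleftrightarrow> B \<and> \<sigma> = \<rho>" "B \<Longrightarrow> \<rho> \<in> ?S" for A B \<rho> and k :: real
  proof -
    have "(\<Sum>\<sigma>\<in>?S. ?w \<sigma> * (if A \<sigma> then k else 0)) = (\<Sum>\<sigma>\<in>?S. if \<sigma>
        = \<rho> then (if B then k * ?w \<rho> else 0) else 0)"
      using that by (intro sum.cong) auto
    then show ?thesis using that by (simp add: sum.delta)
  qed
  have pick_out: "(\<Sum>\<sigma>\<in>?S. (if A \<and> B \<and> \<sigma> = \<rho> then k else 0)) = (if A \<and> B then k else 0)"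
    if "A \<Longrightarrow> B \<Longrightarrow> \<rho> \<in> ?S" for A B \<rho> and k :: real
  proof -
    have "(\<Sum>\<sigma>\<in>?S. (if A \<and> B \<and> \<sigma> = \<rho> then k else 0)) = (\<Sum>\<sigma>\<in>?S. if \<sigma> = \<rho> then (if A
        \<and> B then k else 0) else 0)"
      by (intro sum.cong) auto
    then show ?thesis using that by (simp add: sum.delta)
  qed
  have pick_out1: "(\<Sum>\<sigma>\<in>?S. (if A \<and> \<sigma> = \<rho> then k else 0)) = (if A then k else 0)"
    if "A \<Longrightarrow> \<rho> \<in> ?S" for A \<rho> and k :: real
    using pick_out[of A True \<rho> k] that by simp
  have upd: "\<tau>(j := x, j + 1 := y) \<in> ?S" if "j \<in> {1..<N}" "x \<in> {0, 1}" "y \<in> {0, 1}" for j x y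
    using \<tau> that by (intro asep_states_upd) auto
  have upd1: "\<tau>(1 := x) \<in> ?S" "\<tau>(N := x) \<in> ?S" if "x \<in> {0, 1}" for x
    using \<tau> N that by (auto intro!: asep_states_upd)
  have inflow: "(\<Sum>\<sigma>\<in>?S. ?w \<sigma> * ?r \<sigma> \<tau>) =
      (\<Sum>j\<in>{1..<N}. (if \<tau> j = 0 \<and> \<tau> (j + 1) = 1 then ?w (\<tau>(j := 1, j + 1 := 0)) else 0)
         + (if \<tau> j = 1 \<and> \<tau> (j + 1) = 0 then q * ?w (\<tau>(j := 0, j + 1 := 1)) else 0))
      + (if \<tau> 1 = 1 then \<alpha> * ?w (\<tau>(1 := 0)) else 0) + (if \<tau> 1 = 0 then \<gamma> * ?w (\<tau>(1 := 1)) else 0)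
      + (if \<tau> N = 1 then \<delta> * ?w (\<tau>(N := 0)) else 0) + (if \<tau> N = 0 then \<beta> * ?w (\<tau>(N := 1)) else 0)"
    unfolding asep_rate_def distrib_left sum.distrib sum_distrib_left
  proof (subst sum.swap, intro arg_cong2[where f = "(+)"])
    show "(\<Sum>j\<in>{1..<N}. \<Sum>\<sigma>\<in>?S. ?w \<sigma> * (if \<sigma> j = 1 \<and> \<sigma> (j + 1) = 0 \<and> \<tau>
        = \<sigma>(j := 0, j + 1 := 1) then 1 else 0))
      = (\<Sum>j\<in>{1..<N}. if \<tau> j = 0 \<and> \<tau> (j + 1) = 1 then ?w (\<tau>(j := 1, j + 1 := 0)) else 0)"
    proof (intro sum.cong refl)
      fix j assume j: "j \<in> {1..<N}"
      have "(\<Sum>\<sigma>\<in>?S. ?w \<sigma> * (if \<sigma> j = 1 \<and> \<sigma> (j + 1) = 0 \<and> \<tau> = \<sigma>(j := 0, j + 1 := 1) then 1 else 0))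
        = (if \<tau> j = 0 \<and> \<tau> (j + 1) = 1 then 1 * ?w (\<tau>(j := 1, j + 1 := 0)) else 0)"
        by (rule pick_in) (use upd[OF j] in \<open>auto simp: fun_eq_iff\<close>)
      then show "(\<Sum>\<sigma>\<in>?S. ?w \<sigma> * (if \<sigma> j = 1 \<and> \<sigma> (j + 1) = 0 \<and> \<tau> = \<sigma>(j := 0, j + 1 := 1) then 1 else 0))
        = (if \<tau> j = 0 \<and> \<tau> (j + 1) = 1 then ?w (\<tau>(j := 1, j + 1 := 0)) else 0)" by simp
    qed
    show "(\<Sum>\<sigma>\<in>?S. \<Sum>j\<in>{1..<N}. ?w \<sigma> * (if \<sigma> j = 0 \<and> \<sigma> (j + 1) = 1 \<and> \<tau>
        = \<sigma>(j := 1, j + 1 := 0) then q else 0))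
      = (\<Sum>j\<in>{1..<N}. if \<tau> j = 1 \<and> \<tau> (j + 1) = 0 then q * ?w (\<tau>(j := 0, j + 1 := 1)) else 0)"
      by (subst sum.swap, intro sum.cong refl pick_in) (use upd in \<open>auto simp: fun_eq_iff\<close>)
  qed (rule pick_in; use upd1 in \<open>auto simp: fun_eq_iff\<close>)+
  have outflow: "(\<Sum>\<sigma>\<in>?S. ?r \<tau> \<sigma>) =
      (\<Sum>j\<in>{1..<N}. (if \<tau> j = 1 \<and> \<tau> (j + 1) = 0 then 1 else 0) + (if \<tau> j = 0 \<and> \<tau> (j + 1)
          = 1 then q else 0))
      + (if \<tau> 1 = 0 then \<alpha> else 0) + (if \<tau> 1 = 1 then \<gamma> else 0)
      + (if \<tau> N = 0 then \<delta> else 0) + (if \<tau> N = 1 then \<beta> else 0)"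
    unfolding asep_rate_def sum.distrib
  proof (subst sum.swap, intro arg_cong2[where f = "(+)"])
    show "(\<Sum>\<sigma>\<in>?S. \<Sum>j\<in>{1..<N}. (if \<tau> j = 0 \<and> \<tau> (j + 1) = 1 \<and> \<sigma> = \<tau>(j := 1, j + 1 := 0) then q else 0))
      = (\<Sum>j\<in>{1..<N}. if \<tau> j = 0 \<and> \<tau> (j + 1) = 1 then q else 0)"
      by (subst sum.swap, intro sum.cong refl pick_out) (use upd in auto)
  qed (intro sum.cong refl pick_out pick_out1; use upd upd1 in auto)+
  have "(\<Sum>\<sigma>\<in>?S. ?w \<sigma> * ctmc_generator ?S ?r \<sigma> \<tau>) =
      (\<Sum>\<sigma>\<in>?S. ?w \<sigma> * ?r \<sigma> \<tau>) - ?w \<tau> * (\<Sum>\<sigma>\<in>?S. ?r \<tau> \<sigma>)"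
    unfolding gen using \<tau> by (simp add: right_diff_distrib sum_subtractf if_distrib[of "\<lambda>x. _
        * x"] sum.delta cong: if_cong)
  also have "\<dots> = (\<Sum>j\<in>{1..<N}. (1 - q) * (deleted_weight N \<tau> (Suc j) - deleted_weight N \<tau> j))
      + (1 - q) * deleted_weight N \<tau> 1 + - (1 - q) * deleted_weight N \<tau> N"
    unfolding left_balance[OF \<tau> N \<alpha> \<gamma>, symmetric] right_balance[OF \<tau> N \<beta> \<delta>, symmetric]
    using bond_balance[OF \<tau>, symmetric]
    by (simp add: inflow outflow sum_subtractf sum.distrib sum_distrib_left distrib_left)
  also have "\<dots> = 0"
    unfolding sum_distrib_left[symmetric] sum_Suc_diff'[OF N] by (simp add: algebra_simps)
  finally show ?thesis .
qed

lemma invariant_eq_weight: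
  assumes inv: "asep_invariant \<alpha> \<beta> \<gamma> \<delta> q N \<mu>" and N: "1 \<le> N"
    and \<alpha>: "\<alpha> * ((1 + c) * (1 + d)) = 1 - q" and \<gamma>: "\<gamma> = - c * d * \<alpha>"
    and \<beta>: "\<beta> * ((1 + a) * (1 + b)) = 1 - q" and \<delta>: "\<delta> = - a * b * \<beta>"
    and pos: "\<alpha> > 0" "\<beta> > 0" "\<gamma> \<ge> 0" "\<delta> \<ge> 0" and \<tau>: "\<tau> \<in> asep_states N"
  shows "pmf \<mu> \<tau> = weight N \<tau> / (\<Sum>\<sigma>\<in>asep_states N. weight N \<sigma>)"
proof -
  let ?S = "asep_states N"
  have wpos: "0 < weight N \<sigma>" for \<sigma> unfolding weight_def by (rule phi_pos)
  have cinv: "ctmc_invariant ?S (asep_rate \<alpha> \<beta> \<gamma> \<delta> q N) \<mu>"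
    using inv unfolding asep_invariant_def .
  have "\<exists>k. \<forall>x\<in>?S. pmf \<mu> x = k * weight N x"
  proof (rule stationary_unique[where r = "asep_rate \<alpha> \<beta> \<gamma> \<delta> q N"])
    show "?S \<noteq> {}" using \<tau> by auto
    show "0 \<le> asep_rate \<alpha> \<beta> \<gamma> \<delta> q N x y" for x y using pos q0 by (intro asep_rate_nonneg) auto
    show "(\<Sum>x\<in>?S. weight N x * ctmc_generator ?S (asep_rate \<alpha> \<beta> \<gamma> \<delta> q N) x y) = 0" if "y \<in> ?S" for y
      by (rule weight_stationary[OF that N \<alpha> \<gamma> \<beta> \<delta>])
    show "(\<Sum>x\<in>?S. pmf \<mu> x * ctmc_generator ?S (asep_rate \<alpha> \<beta> \<gamma> \<delta> q N) x y) = 0" if "y \<in> ?S" for y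
      using ctmc_invariant_generator[OF _ cinv that] by simp
    show "Z = ?S" if "Z \<subseteq> ?S" "Z \<noteq> {}" "\<And>x y. x \<in> ?S \<Longrightarrow> y \<in> Z \<Longrightarrow> x \<noteq> y
        \<Longrightarrow> 0 < asep_rate \<alpha> \<beta> \<gamma> \<delta> q N x y \<Longrightarrow> x \<in> Z" for Z
      using asep_irreducible[OF pos q0 N that] .
  qed (use wpos in auto)
  then obtain k where k: "\<And>x. x \<in> ?S \<Longrightarrow> pmf \<mu> x = k * weight N x" by auto
  have "(\<Sum>x\<in>?S. pmf \<mu> x) = 1"
    using cinv by (intro sum_pmf_eq_1) (auto simp: ctmc_invariant_def)
  then have "k * (\<Sum>x\<in>?S. weight N x) = 1" by (simp add: k sum_distrib_left)
  then have "k = 1 / (\<Sum>x\<in>?S. weight N x)" by (metis mult_zero_right nonzero_eq_divide_eq zero_neq_one)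
  then show ?thesis using k[OF \<tau>] by simp
qed

end

section \<open>Lower bounds by paths\<close>

definition words :: "nat \<Rightarrow> nat \<Rightarrow> nat list set" where
  "words N k = {xs. length xs = N \<and> set xs \<subseteq> {0, 1} \<and> sum_list xs = k}"

lemma finite_words [simp]: "finite (words N k)"
proof (rule finite_subset)
  show "words N k \<subseteq> {xs. set xs \<subseteq> {0, 1} \<and> length xs = N}" by (auto simp: words_def)
qed (rule finite_lists_length_eq, simp)

lemma words_Cons: "x # xs \<in> words (Suc N) k \<longleftrightarrow> (x = 0 \<and> xs \<in> words N k) \<or> (x = 1 \<and> k > 0
    \<and> xs \<in> words N (k - 1))"
  by (auto simp: words_def)

lemma words_append: "xs \<in> words n k \<Longrightarrow> ys \<in> words m l \<Longrightarrow> xs @ ys \<in> words (n + m) (k + l)"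
  by (auto simp: words_def)

lemma words_le: "xs \<in> words n k \<Longrightarrow> k \<le> n"
proof (induction xs arbitrary: n k)
  case (Cons x xs)
  then obtain m where n: "n = Suc m" by (auto simp: words_def)
  show ?case using Cons.IH[of m k] Cons.IH[of m "k - 1"] Cons.prems unfolding n words_Cons by auto
qed (auto simp: words_def)

lemma card_words: "card (words n k) = n choose k"
proof (induction n arbitrary: k)
  case 0
  have "words 0 k = (if k = 0 then {[]} else {})" by (auto simp: words_def)
  then show ?case by simp
next
  case (Suc n)
  have eq: "words (Suc n) k = (#) 0 ` words n k \<union> (if k = 0 then {} else (#) 1 ` words n (k - 1))"
  proof (intro set_eqI)
    fix xs show "xs \<in> words (Suc n) k \<longleftrightarrow> xs \<in> (#) 0 ` words n k \<union> (if k
        = 0 then {} else (#) 1 ` words n (k - 1))"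
      by (cases xs) (auto simp: words_Cons, auto simp: words_def)
  qed
  have "card (words (Suc n) k) = card ((#) (0::nat) ` words n k) + card (if k
      = 0 then {} else (#) 1 ` words n (k - 1))"
    unfolding eq by (intro card_Un_disjoint) auto
  also have "\<dots> = Suc n choose k"
    by (cases k) (simp_all add: card_image Suc)
  finally show ?case .
qed

context matrix_ansatz
begin

definition wordsum :: "nat \<Rightarrow> nat \<Rightarrow> (nat \<Rightarrow> real) \<Rightarrow> nat \<Rightarrow> real" where
  "wordsum N k f n = (\<Sum>xs\<in>words N k. word xs f n)"

definition mass :: "nat \<Rightarrow> nat \<Rightarrow> real" where
  "mass N k = (\<Sum>xs\<in>words N k. phi xs)"

lemma word_sum: "finite A \<Longrightarrow> word xs (\<lambda>n. \<Sum>y\<in>A. g y n) n = (\<Sum>y\<in>A. word xs (g y) n)"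
proof (induction A rule: finite_induct)
  case (insert y A)
  then show ?case using word_linear[of xs 1 "g y" 1 "\<lambda>n. \<Sum>y\<in>A. g y n" n] by simp
qed (simp add: word_zero)

lemma wordsum_nonneg: "(\<And>n. 0 \<le> f n) \<Longrightarrow> 0 \<le> wordsum N k f n"
  unfolding wordsum_def by (intro sum_nonneg word_nonneg)

lemma wordsum_ge_word: "(\<And>n. 0 \<le> f n) \<Longrightarrow> xs \<in> words N k \<Longrightarrow> word xs f n \<le> wordsum N k f n"
  unfolding wordsum_def by (rule member_le_sum) (auto intro!: word_nonneg)

text \<open>Concatenation is injective on words of fixed lengths, and its image consists of those
  words whose first \<open>n\<close> letters contain exactly \<open>k\<close> ones. The other words
  only add nonnegative terms.\<close>

lemma wordsum_append:
  assumes f: "\<And>n. 0 \<le> f n"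
  shows "wordsum n k (wordsum m l f) i \<le> wordsum (n + m) (k + l) f i"
proof -
  have inj: "inj_on (\<lambda>(xs, ys). xs @ ys) (words n k \<times> words m l)"
    by (auto simp: inj_on_def words_def)
  have "wordsum n k (wordsum m l f) i = (\<Sum>xs\<in>words n k. \<Sum>ys\<in>words m l. word (xs @ ys) f i)"
    unfolding wordsum_def word_append by (simp add: word_sum)
  also have "\<dots> = (\<Sum>p\<in>words n k \<times> words m l. word (fst p @ snd p) f i)"
    by (simp add: sum.cartesian_product case_prod_beta)
  also have "\<dots> = (\<Sum>xs\<in>(\<lambda>(xs, ys). xs @ ys) ` (words n k \<times> words m l). word xs f i)"
    using inj by (subst sum.reindex) (auto simp: case_prod_beta)
  also have "\<dots> \<le> wordsum (n + m) (k + l) f i"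
    unfolding wordsum_def using f by (intro sum_mono2 finite_words) (auto intro: words_append
        word_nonneg)
  finally show ?thesis .
qed

text \<open>Counts the paths in which \<open>i\<close> of the \<open>k\<close> ones step up and
  \<open>j\<close> of the zeros step down; Pascal's rule handles the choice between step and stay at
  the first letter. Starting at height \<open>n0 + l\<close>, a path of \<open>l\<close> steps never
  leaves the levels where the entries are at least \<theta>.\<close>

lemma word_block_ge:
  assumes \<theta>: "0 \<le> \<theta>"
    and ev: "\<And>n. n0 \<le> n \<Longrightarrow> \<theta> \<le> 1 + b * q ^ n \<and> \<theta> \<le> 1 - q ^ Suc n \<and> \<theta> \<le> 1 + d * q ^ n \<and> \<theta>
        \<le> 1 - b * d * q ^ n"
    and f: "\<And>n. 0 \<le> f n" and xs: "xs \<in> words l k" and n: "n0 + l \<le> n"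
  shows "\<theta> ^ l * real (k choose i) * real ((l - k) choose j) * f (n + i - j) \<le> word xs f n"
  using xs n
proof (induction xs arbitrary: l k n i j)
  case Nil
  have "real (0 choose i) * real (0 choose j) * f (n + i - j) \<le> f n"
    using f by (cases i; cases j) auto
  then show ?case using Nil by (simp add: words_def)
next
  case (Cons x xs)
  then obtain m where l: "l = Suc m" by (auto simp: words_def)
  define g where "g = word xs f"
  have g0: "0 \<le> g n" for n unfolding g_def using f by (rule word_nonneg)
  define B where "B k i j = \<theta> ^ m * real (k choose i) * real ((m - k) choose j)" for k i j
  have nn: "n0 \<le> n" using Cons.prems l by simp
  consider "x = 1" "k > 0" "xs \<in> words m (k - 1)" | "x = 0" "xs \<in> words m k"
    using Cons.prems unfolding l words_Cons by auto
  then show ?case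
  proof cases
    case 1
    then obtain k' where k: "k = Suc k'" by (cases k) auto
    have xs: "xs \<in> words m k'" using 1 k by simp
    have A1: "B k' i' j * f (n + i' - j) \<le> g n" for i'
      unfolding B_def g_def using Cons.IH[OF xs] Cons.prems l by simp
    have A2: "B k' i' j * f (Suc n + i' - j) \<le> g (Suc n)" for i'
      unfolding B_def g_def using Cons.IH[OF xs, of "Suc n"] Cons.prems l by simp
    have "\<theta> * g n + \<theta> * g (Suc n) \<le> opD g n"
      unfolding opD_def using ev[OF nn] g0 by (intro add_mono mult_right_mono) auto
    moreover have "real (Suc k' choose i) * real ((m - k') choose j) * \<theta> ^ m * f (n + i - j)
        \<le> g n + g (Suc n)"
    proof (cases i)
      case 0
      then show ?thesis using A1[of 0] g0[of "Suc n"] by (simp add: B_def algebra_simps)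
    next
      case (Suc i')
      have "real (Suc k' choose i) * real ((m - k') choose j) * \<theta> ^ m * f (n + i - j)
          = B k' i j * f (n + i - j) + B k' i' j * f (Suc n + i' - j)"
        by (simp add: Suc B_def algebra_simps)
      then show ?thesis using A1[of i] A2[of i'] by linarith
    qed
    then have "\<theta> * (real (Suc k' choose i) * real ((m - k') choose j) * \<theta> ^ m * f (n + i - j))
        \<le> \<theta> * (g n + g (Suc n))"
      using \<theta> by (rule mult_left_mono)
    ultimately have "\<theta> * (real (Suc k' choose i) * real ((m - k') choose j) * \<theta> ^ m * f (n + i - j))
        \<le> opD g n"
      by (simp add: distrib_left)
    then show ?thesis using 1 by (simp add: l k g_def mult_ac)
  next
    case 2
    have xs: "xs \<in> words m k" by fact
    have km: "k \<le> m" using words_le[OF xs] .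
    obtain n' where n': "n = Suc n'" "n0 \<le> n'" using Cons.prems l by (cases n) auto
    have A1: "B k i j' * f (n + i - j') \<le> g n" for j'
      unfolding B_def g_def using Cons.IH[OF xs] Cons.prems l by simp
    have A2: "B k i j' * f (n' + i - j') \<le> g n'" for j'
      unfolding B_def g_def using Cons.IH[OF xs, of n'] Cons.prems l n' by simp
    have "\<theta> * g n + \<theta> * g n' \<le> opE g n"
      unfolding opE_def using ev[OF nn] ev[OF n'(2)] g0 n' by (auto intro!: add_mono mult_right_mono)
    moreover have "real (k choose i) * real ((Suc m - k) choose j) * \<theta> ^ m * f (n + i - j) \<le> g n + g n'"
    proof (cases j)
      case 0
      then show ?thesis using A1[of 0] g0[of n'] by (simp add: B_def algebra_simps)
    next
      case (Suc j')
      have "real (k choose i) * real ((Suc m - k) choose j) * \<theta> ^ m * f (n + i - j)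
          = B k i j * f (n + i - j) + B k i j' * f (n' + i - j')"
        using km by (simp add: Suc n' B_def algebra_simps Suc_diff_le)
      then show ?thesis using A1[of j] A2[of j'] by linarith
    qed
    then have "\<theta> * (real (k choose i) * real ((Suc m - k) choose j) * \<theta> ^ m * f (n + i - j))
        \<le> \<theta> * (g n + g n')"
      using \<theta> by (rule mult_left_mono)
    ultimately have "\<theta> * (real (k choose i) * real ((Suc m - k) choose j) * \<theta> ^ m * f (n + i - j))
        \<le> opE g n"
      by (simp add: distrib_left)
    then show ?thesis using 2 by (simp add: l g_def mult_ac)
  qed
qed

text \<open>With the next two lemmas this bounds the start and the end of a path, where the level
  may be too low for \<theta>. Following one path through all letters costs a fixed factor per
  letter.\<close>

lemma word_ones_ge:
  assumes f: "\<And>n. 0 \<le> f n"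
  shows "(1 - q) ^ L * f (n + L) \<le> word (replicate L 1) f n"
proof (induction L arbitrary: n)
  case (Suc L)
  have nn: "0 \<le> word (replicate L 1) f n" for n using f by (rule word_nonneg)
  have "q ^ Suc n \<le> q" using qpow[of n] q0 by (simp add: mult_left_le)
  then have "(1 - q) * word (replicate L 1) f (Suc n)
      \<le> (1 - q ^ Suc n) * word (replicate L 1) f (Suc n)"
    using nn by (intro mult_right_mono) auto
  also have "\<dots> \<le> opD (word (replicate L 1) f) n"
    unfolding opD_def using nn[of n] b_diag(3)[of n] by simp
  finally have "(1 - q) * word (replicate L 1) f (Suc n) \<le> word (replicate (Suc L) 1) f n" by simp
  moreover have "(1 - q) * ((1 - q) ^ L * f (Suc n + L)) \<le> (1 - q) * word (replicate L 1) f (Suc n)"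
    using Suc[of "Suc n"] q1 by (intro mult_left_mono) auto
  ultimately show ?case by simp
qed simp

lemma word_zeros_down_ge:
  assumes f: "\<And>n. 0 \<le> f n"
  shows "(1 - b * d) ^ L * f n \<le> word (replicate L 0) f (n + L)"
proof (induction L)
  case (Suc L)
  have nn: "0 \<le> word (replicate L 0) f n" for n using f by (rule word_nonneg)
  have "b * d * q ^ (n + L) \<le> b * d" using qpow[of "n + L"] bd by (simp add: mult_left_le)
  then have "(1 - b * d) * word (replicate L 0) f (n + L)
      \<le> (1 - b * d * q ^ (n + L)) * word (replicate L 0) f (n + L)"
    using nn by (intro mult_right_mono) auto
  also have "\<dots> \<le> opE (word (replicate L 0) f) (Suc (n + L))"
    unfolding opE_def using nn[of "Suc (n + L)"] d_diag(3)[of "Suc (n + L)"] by simp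
  finally have "(1 - b * d) * word (replicate L 0) f (n + L)
      \<le> word (replicate (Suc L) 0) f (n + Suc L)" by simp
  moreover have "(1 - b * d) * ((1 - b * d) ^ L * f n) \<le> (1 - b * d) * word (replicate L 0) f (n + L)"
    using Suc bd by (intro mult_left_mono) auto
  ultimately show ?case by simp
qed simp

lemma word_zeros_ge:
  assumes f: "\<And>n. 0 \<le> f n"
  shows "(1 + d) ^ L * f n \<le> word (replicate L 0) f n"
proof (induction L)
  case (Suc L)
  have "(1 + d) * word (replicate L 0) f n \<le> opE (word (replicate L 0) f) n"
    using f by (intro opE_ge word_nonneg)
  moreover have "(1 + d) * ((1 + d) ^ L * f n) \<le> (1 + d) * word (replicate L 0) f n"
    using Suc d1 by (intro mult_left_mono) auto
  ultimately show ?case by simp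
qed simp

lemma wordsum_block_ge:
  assumes \<theta>: "0 \<le> \<theta>"
    and ev: "\<And>n. n0 \<le> n \<Longrightarrow> \<theta> \<le> 1 + b * q ^ n \<and> \<theta> \<le> 1 - q ^ Suc n \<and> \<theta> \<le> 1 + d * q ^ n \<and> \<theta>
        \<le> 1 - b * d * q ^ n"
    and f: "\<And>n. 0 \<le> f n" and n: "n0 + l \<le> n"
  shows "\<theta> ^ l * real (l choose k) * real (k choose i) * real ((l - k) choose j) * f (n + i - j)
      \<le> wordsum l k f n"
proof -
  have "(\<Sum>xs\<in>words l k. \<theta> ^ l * real (k choose i) * real ((l - k) choose j) * f (n + i - j))
      \<le> wordsum l k f n"
    unfolding wordsum_def using word_block_ge[OF assms(1-3) _ n] by (intro sum_mono) auto
  then show ?thesis by (simp add: card_words mult_ac)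
qed

text \<open>After \<open>t\<close> blocks the level is \<open>n + t * i - t * j\<close>, and it has
  to be at least \<open>n0 + l\<close> before each block. The condition is written additively to
  avoid truncated subtraction.\<close>

lemma wordsum_blocks_ge:
  assumes \<theta>: "0 \<le> \<theta>"
    and ev: "\<And>n. n0 \<le> n \<Longrightarrow> \<theta> \<le> 1 + b * q ^ n \<and> \<theta> \<le> 1 - q ^ Suc n \<and> \<theta> \<le> 1 + d * q ^ n \<and> \<theta>
        \<le> 1 - b * d * q ^ n"
    and f: "\<And>n. 0 \<le> f n" and j: "j \<le> l"
    and n: "\<And>t. t < M \<Longrightarrow> n0 + l + t * j \<le> n + t * i"
  shows "(\<theta> ^ l * real (l choose k) * real (k choose i) * real ((l - k) choose j)) ^ M * f (n + M
      * i - M * j)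
    \<le> wordsum (M * l) (M * k) f n"
  using n
proof (induction M arbitrary: n)
  case 0
  have "words 0 0 = {[]}" by (auto simp: words_def)
  then show ?case by (simp add: wordsum_def)
next
  case (Suc M)
  let ?B = "\<theta> ^ l * real (l choose k) * real (k choose i) * real ((l - k) choose j)"
  let ?g = "wordsum (M * l) (M * k) f"
  have n0: "n0 + l \<le> n" using Suc.prems[of 0] by simp
  have step: "n0 + l + t * j \<le> (n + i - j) + t * i" if "t < M" for t
    using Suc.prems[of "Suc t"] that by (simp add: algebra_simps)
  have "?B ^ Suc M * f (n + Suc M * i - Suc M * j) = ?B * (?B ^ M * f ((n + i - j) + M * i - M * j))"
    using n0 j by (simp add: algebra_simps)
  also have "\<dots> \<le> ?B * ?g (n + i - j)"
    using Suc.IH[OF step] \<theta> by (intro mult_left_mono) auto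
  also have "\<dots> \<le> wordsum l k ?g n"
    using wordsum_block_ge[OF \<theta> ev wordsum_nonneg[OF f] n0] by (simp add: mult_ac)
  also have "\<dots> \<le> wordsum (Suc M * l) (Suc M * k) f n"
    using wordsum_append[where n = l and k = k and m = "M * l" and l = "M * k" and i = n, OF f] by simp
  finally show ?case .
qed

lemma mass_ge: "c ^ n * wordsum N k V n \<le> mass N k"
  unfolding mass_def wordsum_def sum_distrib_left by (intro sum_mono phi_ge)

lemma mass_nonneg: "0 \<le> mass N k"
  unfolding mass_def by (intro sum_nonneg less_imp_le phi_pos)

text \<open>The words counted start with \<open>L\<close> ones, which lift the level above which all nonzero entries
  are at least \<open>\<theta>\<close>, and end with zeros, which bring it down again; in between, each block of length
  \<open>l\<close> with \<open>k\<close> ones moves the level by \<open>i - j\<close>.\<close>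

lemma mass_blocks_ge:
  assumes \<theta>: "0 < \<theta>" "\<theta> < 1" and l: "i \<le> k" "k \<le> l" "j \<le> l - k"
  shows "\<exists>L K. 0 < K \<and> (\<forall>M r. r \<le> l \<longrightarrow>
    K * (\<theta> ^ l * real (l choose k) * real (k choose i) * real ((l - k) choose j)
      * (if j \<le> i then a ^ (i - j) else c ^ (j - i))) ^ M
    \<le> mass (L + (M * l + (L + r))) (L + M * k))"
proof -
  have lim: "(\<lambda>n. q ^ n) \<longlonglongrightarrow> 0" using q0 q1 by (intro LIMSEQ_realpow_zero) auto
  have e1: "\<forall>\<^sub>F n in sequentially. \<theta> < 1 + z * q ^ n" for z
  proof (rule order_tendstoD(1))
    show "(\<lambda>n. 1 + z * q ^ n) \<longlonglongrightarrow> 1 + z * 0" by (intro tendsto_intros lim)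
  qed (use \<theta> in simp)
  have "\<forall>\<^sub>F n in sequentially. \<theta> \<le> 1 + b * q ^ n \<and> \<theta> \<le> 1 - q ^ Suc n \<and> \<theta> \<le> 1 + d * q ^ n \<and> \<theta>
      \<le> 1 - b * d * q ^ n"
    using e1[of b] e1[of "-q"] e1[of d] e1[of "-(b * d)"] by eventually_elim auto
  then obtain n0 where ev: "\<And>n. n0 \<le> n \<Longrightarrow> \<theta> \<le> 1 + b * q ^ n \<and> \<theta> \<le> 1 - q ^ Suc n \<and> \<theta> \<le> 1 + d * q ^ n
      \<and> \<theta> \<le> 1 - b * d * q ^ n"
    unfolding eventually_sequentially by auto
  obtain KV where KV: "KV > 0" "\<And>n. KV * a ^ n \<le> V n" using V_bounds by blast
  \<comment> \<open>High enough for a whole block to run above \<open>n0\<close> even when a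
    downward drift has brought the level close to its final value.\<close>
  define L where "L = n0 + l"
  define K where "K = (1 - q) ^ L * (1 - b * d) ^ L * (1 + d) ^ l * KV"
  define B where "B = \<theta> ^ l * real (l choose k) * real (k choose i) * real ((l - k) choose j)"
  have B0: "0 \<le> B" using \<theta> by (simp add: B_def)
  have K0: "0 < K" unfolding K_def using q1 bd d1 KV by simp
  have "K * (B * (if j \<le> i then a ^ (i - j) else c ^ (j - i))) ^ M
      \<le> mass (L + (M * l + (L + r))) (L + M * k)"
    if r: "r \<le> l" for M r
  proof -
    \<comment> \<open>Apart from the lift by \<open>L\<close>, a path starts at level
      \<open>m0\<close> and ends at level \<open>m1\<close>, one of which is zero: a downward drift
      needs initial height, priced at \<open>c ^ m0\<close>, and an upward drift leaves final
      height, priced at \<open>a ^ m1\<close>.\<close>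
    define m0 where "m0 = M * (j - i)"
    define m1 where "m1 = M * (i - j)"
    have lev: "m0 + L + M * i - M * j = m1 + L"
    proof (cases "j \<le> i")
      case True
      then have "M * j \<le> M * i" by simp
      then show ?thesis using True by (simp add: m0_def m1_def diff_mult_distrib2)
    next
      case False
      then have "M * i \<le> M * j" "m0 = M * j - M * i" "m1 = 0"
        by (simp_all add: m0_def m1_def diff_mult_distrib2)
      then show ?thesis by linarith
    qed
    have lev2: "n0 + l + t * j \<le> m0 + L + t * i" if "t < M" for t
    proof -
      have "t * (j - i) \<le> m0" unfolding m0_def using that by (intro mult_right_mono) auto
      then show ?thesis unfolding L_def by (simp add: diff_mult_distrib2)
    qed
    let ?g3 = "word (replicate (L + r) 0) V"
    let ?g2 = "wordsum (M * l) (M * k) ?g3"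
    have g3: "0 \<le> ?g3 n" for n by (rule word_nonneg[OF V_nonneg])
    have g2: "0 \<le> ?g2 n" for n by (rule wordsum_nonneg[OF g3])
    \<comment> \<open>The last \<open>r\<close> zeros keep the level; they fill up lengths that are
      not a multiple of the block length.\<close>
    have "(1 - b * d) ^ L * ((1 + d) ^ l * (KV * a ^ m1)) \<le> (1 - b * d) ^ L * word (replicate r 0) V m1"
    proof (intro mult_left_mono)
      have "(1 + d) ^ l * (KV * a ^ m1) \<le> (1 + d) ^ r * V m1"
        using r d0 d1 KV a0 by (intro mult_mono power_decreasing) auto
      also have "\<dots> \<le> word (replicate r 0) V m1" by (rule word_zeros_ge[OF V_nonneg])
      finally show "(1 + d) ^ l * (KV * a ^ m1) \<le> word (replicate r 0) V m1" .
    qed (use bd in auto)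
    also have "\<dots> \<le> word (replicate L 0) (word (replicate r 0) V) (m1 + L)"
      by (rule word_zeros_down_ge) (rule word_nonneg[OF V_nonneg])
    also have "\<dots> = ?g3 (m0 + L + M * i - M * j)"
      by (simp add: lev word_append[symmetric] replicate_add[symmetric])
    finally have s3: "(1 - b * d) ^ L * ((1 + d) ^ l * (KV * a ^ m1)) \<le> ?g3 (m0 + L + M * i - M * j)" .
    have "B ^ M * ((1 - b * d) ^ L * ((1 + d) ^ l * (KV * a ^ m1)))
        \<le> B ^ M * ?g3 (m0 + L + M * i - M * j)"
      using s3 B0 by (intro mult_left_mono) auto
    also have "\<dots> \<le> ?g2 (m0 + L)"
      unfolding B_def using \<theta> l lev2 g3 by (intro wordsum_blocks_ge[OF _ ev]) auto
    finally have s2: "B ^ M * ((1 - b * d) ^ L * ((1 + d) ^ l * (KV * a ^ m1))) \<le> ?g2 (m0 + L)" .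
    have "(1 - q) ^ L * (B ^ M * ((1 - b * d) ^ L * ((1 + d) ^ l * (KV * a ^ m1))))
        \<le> (1 - q) ^ L * ?g2 (m0 + L)"
      using s2 q1 by (intro mult_left_mono) auto
    also have "\<dots> \<le> word (replicate L 1) ?g2 m0" by (rule word_ones_ge[OF g2])
    also have "\<dots> \<le> wordsum L L ?g2 m0"
      by (rule wordsum_ge_word[OF g2]) (auto simp: words_def sum_list_replicate)
    also have "\<dots> \<le> wordsum L L (wordsum (M * l) (M * k) (wordsum (L + r) 0 V)) m0"
    proof -
      have "?g3 n \<le> wordsum (L + r) 0 V n" for n
        by (rule wordsum_ge_word[OF V_nonneg]) (auto simp: words_def sum_list_replicate)
      then show ?thesis unfolding wordsum_def[of L] wordsum_def[of "M * l"]
        by (intro sum_mono word_mono)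
    qed
    also have "\<dots> \<le> wordsum L L (wordsum (M * l + (L + r)) (M * k + 0) V) m0"
      unfolding wordsum_def[of L]
      by (intro sum_mono word_mono wordsum_append V_nonneg)
    also have "\<dots> \<le> wordsum (L + (M * l + (L + r))) (L + (M * k + 0)) V m0"
      by (rule wordsum_append[OF V_nonneg])
    finally have "c ^ m0 * ((1 - q) ^ L * (B ^ M * ((1 - b * d) ^ L * ((1 + d) ^ l * (KV * a ^ m1)))))
        \<le> c ^ m0 * wordsum (L + (M * l + (L + r))) (L + M * k) V m0"
      using c0 by (intro mult_left_mono) auto
    also have "\<dots> \<le> mass (L + (M * l + (L + r))) (L + M * k)" by (rule mass_ge)
    also have "c ^ m0 * ((1 - q) ^ L * (B ^ M * ((1 - b * d) ^ L * ((1 + d) ^ l * (KV * a ^ m1)))))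
        = K * (B * (if j \<le> i then a ^ (i - j) else c ^ (j - i))) ^ M"
      unfolding K_def m0_def m1_def
      by (cases "j \<le> i") (simp_all add: power_mult_distrib power_mult[symmetric] mult_ac)
    finally show ?thesis .
  qed
  then show ?thesis unfolding B_def using K0 by blast
qed

end

section \<open>Entropy bounds for binomial coefficients\<close>

lemma fact_power_le:
  fixes j k :: nat
  shows "fact k * k ^ j \<le> fact j * k ^ k"
proof (cases "j \<le> k")
  case True
  have "fact (j + m) \<le> fact j * (j + m) ^ m" for m
  proof (induction m)
    case (Suc m)
    have "fact (j + Suc m) = (j + Suc m) * fact (j + m)" by simp
    also have "\<dots> \<le> (j + Suc m) * (fact j * (j + m) ^ m)" using Suc by (intro mult_left_mono) auto
    also have "\<dots> \<le> (j + Suc m) * (fact j * (j + Suc m) ^ m)" by (intro mult_left_mono power_mono) auto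
    finally show ?case by (simp add: mult_ac)
  qed simp
  from mult_right_mono[OF this[of "k - j"], of "k ^ j"] True show ?thesis
    by (simp add: power_add[symmetric] mult.assoc)
next
  case False
  have "fact k * k ^ (k + m) \<le> fact (k + m) * k ^ k" for m
  proof (induction m)
    case (Suc m)
    have "fact k * k ^ (k + Suc m) = k * (fact k * k ^ (k + m))" by simp
    also have "\<dots> \<le> (k + Suc m) * (fact (k + m) * k ^ k)" by (rule mult_mono[OF _ Suc]) auto
    finally show ?case by (simp add: algebra_simps)
  qed simp
  from this[of "j - k"] False show ?thesis by simp
qed

text \<open>The binomial distribution with success probability \<open>k / n\<close> has its mode at
  \<open>k\<close>. By \<open>fact_power_le\<close> the Poisson-type weights
  \<open>k ^ j / j!\<close> peak at \<open>j = k\<close>; this is applied to \<open>k\<close> and to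
  \<open>n - k\<close>.\<close>

lemma binomial_mode:
  fixes n k j :: nat
  assumes "k \<le> n" "j \<le> n"
  shows "(n choose j) * k ^ j * (n - k) ^ (n - j) \<le> (n choose k) * k ^ k * (n - k) ^ (n - k)"
proof -
  define A where "A = fact j * (fact (n - j) :: nat)"
  define B where "B = fact k * (fact (n - k) :: nat)"
  have A: "A * (n choose j) = fact n" using binomial_fact_lemma[OF assms(2)] by (simp add: A_def)
  have B: "B * (n choose k) = fact n" using binomial_fact_lemma[OF assms(1)] by (simp add: B_def)
  have BA: "B * (k ^ j * (n - k) ^ (n - j)) \<le> A * (k ^ k * (n - k) ^ (n - k))"
    using mult_mono[OF fact_power_le[of k j] fact_power_le[of "n - k" "n - j"]]
    by (simp add: A_def B_def mult_ac)
  have "(A * B) * ((n choose j) * k ^ j * (n - k) ^ (n - j))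
      = (A * (n choose j)) * (B * (k ^ j * (n - k) ^ (n - j)))"
    by (simp add: mult_ac)
  also have "\<dots> \<le> (B * (n choose k)) * (A * (k ^ k * (n - k) ^ (n - k)))"
    unfolding A B using BA by (intro mult_left_mono) auto
  also have "\<dots> = (A * B) * ((n choose k) * k ^ k * (n - k) ^ (n - k))" by (simp add: mult_ac)
  finally show ?thesis by (simp add: A_def B_def)
qed

definition xlnx :: "real \<Rightarrow> real" where
  "xlnx y = y * ln y"

lemma xlnx_0 [simp]: "xlnx 0 = 0" by (simp add: xlnx_def)

lemma exp_xlnx: "exp (xlnx (real k)) = real k ^ k"
  unfolding xlnx_def exp_of_nat_mult by (cases "k = 0") simp_all

text \<open>\<open>n ^ n = (k + (n - k)) ^ n\<close> expands into \<open>n + 1\<close> terms, of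
  which the k-th is the largest. This gives the entropy bound up to a logarithmic error without
  Stirling's formula.\<close>

lemma ln_binomial_ge:
  assumes "k \<le> n"
  shows "xlnx (real n) - xlnx (real k) - xlnx (real (n - k)) - ln (real n + 1) \<le> ln (real (n choose k))"
proof -
  have "n ^ n = (\<Sum>j\<le>n. (n choose j) * k ^ j * (n - k) ^ (n - j))"
    using binomial_ring[of k "n - k" n] assms by simp
  also have "\<dots> \<le> (\<Sum>j\<le>n. (n choose k) * k ^ k * (n - k) ^ (n - k))"
    using binomial_mode[OF assms] by (intro sum_mono) auto
  also have "\<dots> = (n + 1) * ((n choose k) * k ^ k * (n - k) ^ (n - k))" by simp
  finally have "real (n ^ n) \<le> real ((n + 1) * ((n choose k) * k ^ k * (n - k) ^ (n - k)))"
    by (rule of_nat_mono)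
  then have "real n ^ n \<le> (real n + 1) * real (n choose k) * real k ^ k * real (n - k) ^ (n - k)"
    by (simp add: algebra_simps)
  then have "exp (xlnx (real n)) \<le> exp (ln (real n + 1) + ln (real (n choose k)) + xlnx (real k)
      + xlnx (real (n - k)))"
    using assms by (simp only: exp_add exp_xlnx) (simp add: of_nat_diff[symmetric] del: of_nat_diff)
  then show ?thesis by simp
qed

text \<open>The product is the multinomial coefficient of the parts \<open>i\<close>,
  \<open>k - i\<close>, \<open>j\<close>, \<open>l - k - j\<close>. They sum to \<open>l\<close>, so
  the \<open>ln l\<close> terms cancel when the entropy is rewritten in fractions; each binomial
  contributes one logarithmic error.\<close>

lemma ln_multinomial_ge:
  assumes "i \<le> k" "k \<le> l" "j \<le> l - k" "l > 0"
  shows "- real l * (xlnx (real i / real l) + xlnx (real (k - i) / real l) + xlnx (real j / real l)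
      + xlnx (real (l - k - j) / real l)) - 3 * ln (real l + 1)
    \<le> ln (real (l choose k) * real (k choose i) * real ((l - k) choose j))"
proof -
  have scale: "xlnx (real m) = real l * xlnx (real m / real l) + real m * ln (real l)" for m
    using assms(4) by (cases "m = 0") (simp_all add: xlnx_def ln_div algebra_simps)
  have sum: "real i + real (k - i) + real j + real (l - k - j) = real l"
    using assms by simp
  have "ln (real (l choose k) * real (k choose i) * real ((l - k) choose j))
      = ln (real (l choose k)) + ln (real (k choose i)) + ln (real ((l - k) choose j))"
    using assms by (simp add: ln_mult)
  moreover have "ln (real k + 1) \<le> ln (real l + 1)" "ln (real (l - k) + 1) \<le> ln (real l + 1)"
    using assms by auto
  ultimately have "xlnx (real l) - xlnx (real i) - xlnx (real (k - i)) - xlnx (real j)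
      - xlnx (real (l - k - j)) - 3 * ln (real l + 1)
      \<le> ln (real (l choose k) * real (k choose i) * real ((l - k) choose j))"
    using ln_binomial_ge[of k l] ln_binomial_ge[of i k] ln_binomial_ge[of j "l - k"] assms by linarith
  moreover have "xlnx (real l) - xlnx (real i) - xlnx (real (k - i)) - xlnx (real j) - xlnx (real (l
      - k - j))
      = - real l * (xlnx (real i / real l) + xlnx (real (k - i) / real l) + xlnx (real j / real l)
          + xlnx (real (l - k - j) / real l))
        + (real l - (real i + real (k - i) + real j + real (l - k - j))) * ln (real l)"
    unfolding scale[of i] scale[of j] scale[of "k - i"] scale[of "l - k - j"]
    by (simp add: xlnx_def[of "real l"] algebra_simps)
  ultimately show ?thesis unfolding sum by simp
qed

lemma continuous_on_xlnx: "continuous_on {0..} xlnx"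
  unfolding continuous_on_def
proof
  fix y :: real assume y: "y \<in> {0..}"
  show "(xlnx \<longlongrightarrow> xlnx y) (at y within {0..})"
  proof (cases "y = 0")
    case True
    have "((\<lambda>x::real. x * ln x) \<longlongrightarrow> 0) (at_right 0)" by real_asymp
    then have "(xlnx \<longlongrightarrow> xlnx 0) (at_right 0)" by (simp add: xlnx_def[abs_def])
    moreover have "at (0::real) within {0..} = at_right 0"
      by (rule at_within_Ici_at_right)
    ultimately show ?thesis using True by simp
  next
    case False
    then have "isCont xlnx y" unfolding xlnx_def[abs_def] using y by (intro continuous_intros) auto
    then show ?thesis unfolding isCont_def by (rule tendsto_mono[OF at_le[OF subset_UNIV]])
  qed
qed

lemma tendsto_xlnx:
  fixes f :: "nat \<Rightarrow> real"
  assumes "f \<longlonglongrightarrow> y" "\<And>n. 0 \<le> f n"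
  shows "(\<lambda>n. xlnx (f n)) \<longlonglongrightarrow> xlnx y"
  using continuous_on_tendsto_compose[OF continuous_on_xlnx assms(1)] assms LIMSEQ_le_const[OF
      assms(1), of 0]
  by auto

lemma tendsto_nat_floor:
  assumes "0 \<le> (x::real)"
  shows "(\<lambda>n. real (nat \<lfloor>x * real n\<rfloor>) / real n) \<longlonglongrightarrow> x"
proof (rule tendsto_sandwich)
  have "x - 1 / real n \<le> real (nat \<lfloor>x * real n\<rfloor>) / real n \<and> real (nat \<lfloor>x * real n\<rfloor>) / real n
      \<le> x" if "n > 0" for n
  proof -
    have "x * real n - 1 \<le> real (nat \<lfloor>x * real n\<rfloor>)" "real (nat \<lfloor>x * real n\<rfloor>) \<le> x * real n"
      using assms by (auto simp: of_nat_nat)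
    then have "(x * real n - 1) / real n \<le> real (nat \<lfloor>x * real n\<rfloor>) / real n"
      "real (nat \<lfloor>x * real n\<rfloor>) / real n \<le> x * real n / real n"
      by (intro divide_right_mono; simp)+
    with that show ?thesis by (simp add: diff_divide_distrib)
  qed
  then show "\<forall>\<^sub>F n in sequentially. x - 1 / real n \<le> real (nat \<lfloor>x * real n\<rfloor>) / real n"
    "\<forall>\<^sub>F n in sequentially. real (nat \<lfloor>x * real n\<rfloor>) / real n \<le> x"
    by (auto intro!: eventually_mono[OF eventually_gt_at_top[of "0::nat"]])
  show "(\<lambda>n. x - 1 / real n) \<longlonglongrightarrow> x" by real_asymp
qed simp

lemma tendsto_div_nat:
  assumes "l > 0"
  shows "(\<lambda>N. real ((N - L) div l) / real N) \<longlonglongrightarrow> 1 / real l"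
proof (rule tendsto_sandwich)
  have "1 / real l - (real L / real l + 1) / real N \<le> real ((N - L) div l) / real N
      \<and> real ((N - L) div l) / real N \<le> 1 / real l" if "N > 0" for N
  proof -
    have "real (N - L) < real (l + (N - L) div l * l)"
      using dividend_less_div_times[OF assms, of "N - L"] by (rule of_nat_less_iff[THEN iffD2])
    then have "real (N - L) / real l - 1 \<le> real ((N - L) div l)"
      using assms by (simp add: field_simps)
    moreover have "(real N - real L) / real l \<le> real (N - L) / real l" by (intro divide_right_mono) auto
    ultimately have "(real N - real L) / real l - 1 \<le> real ((N - L) div l)" by linarith
    then have "((real N - real L) / real l - 1) / real N \<le> real ((N - L) div l) / real N"
      by (intro divide_right_mono) auto
    moreover have "((real N - real L) / real l - 1) / real N
        = 1 / real l - (real L / real l + 1) / real N"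
      using that assms by (simp add: field_simps)
    moreover have "real ((N - L) div l) \<le> real N / real l"
      by (rule order.trans[OF of_nat_div_le_of_nat]) (intro divide_right_mono, auto)
    then have "real ((N - L) div l) / real N \<le> real N / real l / real N"
        by (intro divide_right_mono) auto
    ultimately show ?thesis using that by auto
  qed
  then show "\<forall>\<^sub>F N in sequentially. 1 / real l - (real L / real l + 1) / real N
      \<le> real ((N - L) div l) / real N"
    "\<forall>\<^sub>F N in sequentially. real ((N - L) div l) / real N \<le> 1 / real l"
    by (auto intro!: eventually_mono[OF eventually_gt_at_top[of "0::nat"]])
  have "(\<lambda>N. 1 / real l - (real L / real l + 1) * (1 / real N)) \<longlonglongrightarrow> 1 / real l - (real L / real l + 1)
      * 0"
    by (intro tendsto_intros lim_1_over_n)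
  then show "(\<lambda>N. 1 / real l - (real L / real l + 1) / real N) \<longlonglongrightarrow> 1 / real l" by simp
qed simp

section \<open>Exponential lower bounds for the masses\<close>

context matrix_ansatz
begin

text \<open>The block is fixed while the number of blocks grows like \<open>N / l\<close>. The end
  pieces and the remainder enter only through a constant, which disappears on the exponential
  scale.\<close>

lemma mass_block_growth:
  assumes \<theta>: "0 < \<theta>" "\<theta> < 1" and l: "i \<le> k" "k \<le> l" "j \<le> l - k" "l > 0" and \<epsilon>: "\<epsilon> > 0"
  defines "B \<equiv> \<theta> ^ l * real (l choose k) * real (k choose i) * real ((l - k) choose j)
      * (if j \<le> i then a ^ (i - j) else c ^ (j - i))"
  assumes B: "B > 0"
  shows "\<forall>\<^sub>F N in sequentially. \<exists>K\<le>N. \<bar>real K / real N - real k / real l\<bar> < \<epsilon>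
    \<and> exp (real N * (ln B / real l - \<epsilon>)) \<le> mass N K"
proof -
  obtain L K0 where K0: "K0 > 0" and
    lo: "\<And>M r. r \<le> l \<Longrightarrow> K0 * B ^ M \<le> mass (L + (M * l + (L + r))) (L + M * k)"
    using mass_blocks_ge[OF \<theta> l(1-3)] unfolding B_def by blast
  define M where "M N = (N - 2 * L) div l" for N
  have M: "(\<lambda>N. real (M N) / real N) \<longlonglongrightarrow> 1 / real l"
    unfolding M_def by (rule tendsto_div_nat[OF l(4)])
  have "(\<lambda>N. real L * (1 / real N) + real k * (real (M N) / real N)) \<longlonglongrightarrow> real L * 0 + real k
      * (1 / real l)"
    by (intro tendsto_intros M lim_1_over_n)
  then have "(\<lambda>N. (real L + real (M N) * real k) / real N) \<longlonglongrightarrow> real k / real l"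
    by (simp add: add_divide_distrib mult.commute)
  then have e1: "\<forall>\<^sub>F N in sequentially. \<bar>(real L + real (M N) * real k) / real N - real k / real l\<bar> < \<epsilon>"
    using \<epsilon> unfolding tendsto_iff dist_real_def by auto
  have "(\<lambda>N. ln K0 * (1 / real N) + ln B * (real (M N) / real N)) \<longlonglongrightarrow> ln K0 * 0 + ln B * (1 / real l)"
    by (intro tendsto_intros M lim_1_over_n)
  then have "\<forall>\<^sub>F N in sequentially. ln B / real l - \<epsilon> < ln K0 * (1 / real N) + ln B
      * (real (M N) / real N)"
    by (rule order_tendstoD) (use \<epsilon> in simp)
  then show ?thesis using e1 eventually_ge_at_top[of "2 * L + 1"]
  proof eventually_elim
    case (elim N)
    define r where "r = (N - 2 * L) mod l"
    have N: "N = L + (M N * l + (L + r))"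
      using elim(3) div_mult_mod_eq[of "N - 2 * L" l] unfolding M_def r_def by linarith
    have "M N * k \<le> M N * l" using l by simp
    then have le: "L + M N * k \<le> N" using N by linarith
    have "real N * (ln B / real l - \<epsilon>) \<le> real N * (ln K0 * (1 / real N) + ln B * (real (M N) / real N))"
      using elim(1) by (intro mult_left_mono) auto
    also have "\<dots> = ln K0 + real (M N) * ln B" using elim(3) by (simp add: field_simps)
    finally have "exp (real N * (ln B / real l - \<epsilon>)) \<le> exp (ln K0 + real (M N) * ln B)" by simp
    also have "\<dots> = K0 * B ^ M N" using K0 B by (simp add: exp_add exp_of_nat_mult)
    also have "\<dots> \<le> mass N (L + M N * k)"
      using lo[of r "M N"] N l by (simp add: r_def)
    finally show ?case using le elim(2) by (intro exI[of _ "L + M N * k"]) auto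
  qed
qed

text \<open>Here \<open>u\<close> and \<open>v\<close> are the fractions of sites at which the path
  steps up and down; at \<open>x - u\<close> and \<open>1 - x - v\<close> it stays, on a particle or
  a hole. \<open>R\<close> is the entropy of these four fractions plus the boundary price of the
  drift \<open>u - v\<close>, and \<open>uv\<close> and \<open>vu\<close> make the base of that
  price positive.\<close>

lemma mass_lower:
  fixes x F :: real
  defines "u \<equiv> x * F" and "v \<equiv> (1 - x) * (1 - F)"
  assumes x: "0 \<le> x" "x \<le> 1" and F: "0 \<le> F" "F \<le> 1" and \<epsilon>: "\<epsilon> > 0"
    and uv: "v < u \<Longrightarrow> a > 0" and vu: "u < v \<Longrightarrow> c > 0"
  defines "R \<equiv> - (xlnx u + xlnx (x - u) + xlnx v + xlnx (1 - x - v))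
      + (if v \<le> u then (u - v) * ln a else (v - u) * ln c)"
  shows "\<forall>\<^sub>F N in sequentially. \<exists>K\<le>N. \<bar>real K / real N - x\<bar> < \<epsilon>
    \<and> exp (real N * (R - \<epsilon>)) \<le> mass N K"
proof -
  have u0: "0 \<le> u" and v0: "0 \<le> v" unfolding u_def v_def using x F by auto
  have ux: "u \<le> x" unfolding u_def using x F by (simp add: mult_left_le)
  have vx: "v \<le> 1 - x" unfolding v_def using x F by (simp add: mult_left_le)
  define i where "i l = nat \<lfloor>u * real l\<rfloor>" for l
  define j where "j l = nat \<lfloor>v * real l\<rfloor>" for l
  define k where "k l = nat \<lfloor>x * real l\<rfloor>" for l
  have ik: "i l \<le> k l" for l
    unfolding i_def k_def using ux by (intro nat_mono floor_mono mult_right_mono) auto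
  have kle: "real (k l) \<le> x * real l" for l
    unfolding k_def using x by (simp add: of_nat_nat)
  have kl: "k l \<le> l" for l
  proof -
    have "real (k l) \<le> 1 * real l" using kle[of l] x
        by (meson mult_right_mono of_nat_0_le_iff order.trans)
    then show ?thesis by simp
  qed
  have jl: "j l \<le> l - k l" for l
  proof -
    have "real (j l) \<le> v * real l" unfolding j_def using v0 by (simp add: of_nat_nat)
    also have "\<dots> \<le> (1 - x) * real l" using vx by (intro mult_right_mono) auto
    also have "\<dots> \<le> real l - real (k l)" using kle[of l] by (simp add: algebra_simps)
    finally show ?thesis using kl[of l] by linarith
  qed
  \<comment> \<open>Monotone rounding never reverses the sign of the drift. A drift of the wrong
    sign could have weight zero, since \<open>a\<close> or \<open>c\<close> may vanish.\<close>
  have ij: "i l \<le> j l" if "u \<le> v" for l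
    unfolding i_def j_def using that by (intro nat_mono floor_mono mult_right_mono) auto
  have ji: "j l \<le> i l" if "v \<le> u" for l
    unfolding i_def j_def using that by (intro nat_mono floor_mono mult_right_mono) auto
  have li: "(\<lambda>l. real (i l) / real l) \<longlonglongrightarrow> u" unfolding i_def by (rule tendsto_nat_floor[OF u0])
  have lj: "(\<lambda>l. real (j l) / real l) \<longlonglongrightarrow> v" unfolding j_def by (rule tendsto_nat_floor[OF v0])
  have lk: "(\<lambda>l. real (k l) / real l) \<longlonglongrightarrow> x" unfolding k_def by (rule tendsto_nat_floor[OF x(1)])
  have lki: "(\<lambda>l. real (k l - i l) / real l) \<longlonglongrightarrow> x - u"
    using tendsto_diff[OF lk li] ik by (simp add: of_nat_diff diff_divide_distrib)
  have llk: "(\<lambda>l. real (l - k l - j l) / real l) \<longlonglongrightarrow> 1 - x - v"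
  proof (rule Lim_transform_eventually)
    show "(\<lambda>l. 1 - real (k l) / real l - real (j l) / real l) \<longlonglongrightarrow> 1 - x - v"
      by (intro tendsto_intros lk lj)
    show "\<forall>\<^sub>F l in sequentially. 1 - real (k l) / real l - real (j l) / real l
        = real (l - k l - j l) / real l"
      using eventually_gt_at_top[of 0]
    proof eventually_elim
      case (elim l)
      have "real (l - k l - j l) = real l - real (k l) - real (j l)" using kl[of l] jl[of l] by linarith
      then show ?case using elim by (simp add: diff_divide_distrib)
    qed
  qed
  define pen where "pen l = (if j l \<le> i l then a ^ (i l - j l) else c ^ (j l - i l))" for l
  define lp where "lp l = (if v \<le> u then (real (i l) / real l - real (j l) / real l) * ln a
      else (real (j l) / real l - real (i l) / real l) * ln c)" for l
  have pen: "pen l > 0 \<and> ln (pen l) / real l = lp l" for l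
  proof (cases "v \<le> u")
    case True
    show ?thesis
    proof (cases "i l = j l")
      case False
      then have "v < u" using True ij[of l] ji[of l] by linarith
      then have "a > 0" by (rule uv)
      then show ?thesis using True ji[OF True, of l]
        by (simp add: pen_def lp_def ln_realpow of_nat_diff diff_divide_distrib[symmetric])
    qed (use True in \<open>simp add: pen_def lp_def\<close>)
  next
    case uv: False
    then have c: "c > 0" by (intro vu) simp
    show ?thesis
    proof (cases "j l \<le> i l")
      case False
      then show ?thesis using uv c
        by (simp add: pen_def lp_def ln_realpow of_nat_diff diff_divide_distrib[symmetric])
    next
      case True
      then have "i l = j l" using ij[of l] uv by simp
      then show ?thesis using uv by (simp add: pen_def lp_def)
    qed
  qed
  have llp: "lp \<longlonglongrightarrow> (if v \<le> u then (u - v) * ln a else (v - u) * ln c)"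
    unfolding lp_def by (cases "v \<le> u") (auto intro!: tendsto_intros li lj)
  \<comment> \<open>This \<theta> costs exactly \<open>\<epsilon> / 4\<close> per site. Another
    \<open>\<epsilon> / 4\<close> goes to the choice of \<open>l\<close>, and
    \<open>\<epsilon> / 2\<close> remains for \<open>mass_block_growth\<close>.\<close>
  define \<theta> where "\<theta> = exp (- \<epsilon> / 4)"
  have \<theta>: "0 < \<theta>" "\<theta> < 1" using \<epsilon> by (auto simp: \<theta>_def)
  define B where "B l = \<theta> ^ l * real (l choose k l) * real (k l choose i l) * real ((l
      - k l) choose j l) * pen l" for l
  have Bpos: "B l > 0" for l
    unfolding B_def using \<theta> pen ik kl jl by simp
  define s where "s l = - (xlnx (real (i l) / real l) + xlnx (real (k l - i l) / real l)
      + xlnx (real (j l) / real l)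
      + xlnx (real (l - k l - j l) / real l)) - 3 * (ln (real l + 1) / real l) + lp l - \<epsilon> / 4" for l
  have sB: "s l \<le> ln (B l) / real l" if "l > 0" for l
  proof -
    let ?C = "real (l choose k l) * real (k l choose i l) * real ((l - k l) choose j l)"
    have C: "?C > 0" using ik[of l] kl[of l] jl[of l] by simp
    have "B l = \<theta> ^ l * ?C * pen l" by (simp add: B_def mult_ac)
    then have "ln (B l) = ln (\<theta> ^ l) + ln ?C + ln (pen l)"
      using \<theta> C pen[of l] by (simp only: ln_mult_pos mult_pos_pos zero_less_power)
    also have "ln (\<theta> ^ l) = real l * (- \<epsilon> / 4)" using \<theta>(1) by (simp add: ln_realpow \<theta>_def)
    finally have "ln (B l) / real l = - \<epsilon> / 4 + ln ?C / real l + lp l"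
      using pen[of l] that by (simp add: add_divide_distrib diff_divide_distrib)
    moreover have "(- real l * (xlnx (real (i l) / real l) + xlnx (real (k l - i l) / real l)
        + xlnx (real (j l) / real l) + xlnx (real (l - k l - j l) / real l))
        - 3 * ln (real l + 1)) / real l \<le> ln ?C / real l"
      using ln_multinomial_ge[OF ik kl jl that] by (intro divide_right_mono) auto
    ultimately show ?thesis using that by (simp add: s_def diff_divide_distrib)
  qed
  have "(\<lambda>l. ln (real l + 1) / real l) \<longlonglongrightarrow> 0" by real_asymp
  then have "s \<longlonglongrightarrow> - (xlnx u + xlnx (x - u) + xlnx v + xlnx (1 - x - v)) - 3 * 0
      + (if v \<le> u then (u - v) * ln a else (v - u) * ln c) - \<epsilon> / 4"
    unfolding s_def by (intro tendsto_intros tendsto_xlnx li lj lki llk llp) auto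
  then have "s \<longlonglongrightarrow> R - \<epsilon> / 4" by (simp add: R_def)
  then have "\<forall>\<^sub>F l in sequentially. R - \<epsilon> / 2 < s l" by (rule order_tendstoD) (use \<epsilon> in simp)
  moreover have "\<forall>\<^sub>F l in sequentially. \<bar>real (k l) / real l - x\<bar> < \<epsilon> / 2"
    using lk \<epsilon> unfolding tendsto_iff dist_real_def by (metis half_gt_zero)
  ultimately have "\<forall>\<^sub>F l in sequentially. R - \<epsilon> / 2 < s l \<and> \<bar>real (k l) / real l - x\<bar> < \<epsilon> / 2 \<and> l > 0"
    using eventually_gt_at_top[of 0] by eventually_elim auto
  then obtain l where l: "R - \<epsilon> / 2 < s l" "\<bar>real (k l) / real l - x\<bar> < \<epsilon> / 2" "l > 0"
    using eventually_happens'[OF sequentially_bot] by blast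
  have RB: "R - \<epsilon> / 2 < ln (B l) / real l" using l(1) sB[OF l(3)] by linarith
  have "\<forall>\<^sub>F N in sequentially. \<exists>K\<le>N. \<bar>real K / real N - real (k l) / real l\<bar> < \<epsilon> / 2
    \<and> exp (real N * (ln (B l) / real l - \<epsilon> / 2)) \<le> mass N K"
    using mass_block_growth[OF \<theta> ik kl jl l(3), of "\<epsilon> / 2"] Bpos[of l] \<epsilon>
    unfolding B_def pen_def by simp
  then show ?thesis
  proof eventually_elim
    case (elim N)
    then obtain K where K: "K \<le> N" "\<bar>real K / real N - real (k l) / real l\<bar> < \<epsilon> / 2"
      "exp (real N * (ln (B l) / real l - \<epsilon> / 2)) \<le> mass N K" by blast
    have "real N * (R - \<epsilon>) \<le> real N * (ln (B l) / real l - \<epsilon> / 2)"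
      using RB by (intro mult_left_mono) auto
    then have "exp (real N * (R - \<epsilon>)) \<le> mass N K" using K(3) by (meson exp_le_cancel_iff order.trans)
    moreover have "\<bar>real K / real N - x\<bar> < \<epsilon>" using K(2) l(2) by linarith
    ultimately show ?case using K(1) by blast
  qed
qed

end

section \<open>Large deviations for infima of affine functions\<close>

lemma linear_le_exp:
  assumes "\<delta> > 0"
  shows "\<forall>\<^sub>F N in sequentially. (real N + 1) * K \<le> exp (real N * \<delta>)"
proof -
  have "((\<lambda>N. (real N + 1) * K * exp (- (real N * \<delta>))) \<longlongrightarrow> 0) sequentially"
    using assms by real_asymp
  then have "\<forall>\<^sub>F N in sequentially. (real N + 1) * K * exp (- (real N * \<delta>)) < 1"
    by (rule order_tendstoD) simp
  then show ?thesis by eventually_elim (simp add: exp_minus field_simps)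
qed

lemma elog_div_le:
  assumes "p \<le> exp (real N * y)" "N > 0"
  shows "elog p / ereal (real N) \<le> ereal y"
proof (cases "p > 0")
  case True
  then have "ln p \<le> real N * y" using assms ln_mono by fastforce
  then show ?thesis using True assms by (simp add: elog_def field_simps)
qed (use assms in \<open>simp add: elog_def\<close>)

lemma elog_div_ge:
  assumes "exp (real N * y) \<le> p" "N > 0"
  shows "ereal y \<le> elog p / ereal (real N)"
proof -
  have p: "p > 0" using assms(1) by (rule less_le_trans[OF exp_gt_zero])
  then have "real N * y \<le> ln p" using assms(1) by (simp add: ln_ge_iff)
  then show ?thesis using p assms by (simp add: elog_def field_simps)
qed

text \<open>Large deviations of a lattice variable with unnormalised weights \<open>m N k\<close> at \<open>k / N\<close>, when
  the exponential growth rate \<open>G\<close> of the weights is an infimum of affine functions \<open>x \<mapsto> x s + r\<close>,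
  each of which gives an upper bound on the weights.\<close>

locale affine_growth =
  fixes m :: "nat \<Rightarrow> nat \<Rightarrow> real" and G :: "real \<Rightarrow> real" and L0 x0 :: real
    and \<Lambda> :: "(real \<times> real) set" and P :: "nat \<Rightarrow> real measure" and I :: "real \<Rightarrow> ereal"
  assumes m_nonneg: "\<And>N k. 0 \<le> m N k"
    and up: "\<And>s r. (s, r) \<in> \<Lambda> \<Longrightarrow> \<exists>K>0. \<forall>N k. k \<le> N \<longrightarrow> m N k \<le> K * exp (real k * s + real N * r)"
    and G_le: "\<And>s r x. (s, r) \<in> \<Lambda> \<Longrightarrow> x \<in> {0..1} \<Longrightarrow> G x \<le> x * s + r"
    and G_near: "\<And>x \<epsilon>. x \<in> {0..1} \<Longrightarrow> \<epsilon> > 0 \<Longrightarrow> \<exists>s r. (s, r) \<in> \<Lambda> \<and> x * s + r < G x + \<epsilon>"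
    and low: "\<And>x \<epsilon>. x \<in> {0..1} \<Longrightarrow> \<epsilon> > 0 \<Longrightarrow> \<forall>\<^sub>F N in sequentially. \<exists>k\<le>N.
        \<bar>real k / real N - x\<bar> < \<epsilon> \<and> exp (real N * (G x - \<epsilon>)) \<le> m N k"
    and flat: "\<And>\<epsilon>. \<epsilon> > 0 \<Longrightarrow> \<exists>r. (0, r) \<in> \<Lambda> \<and> r < L0 + \<epsilon>"
    and x0: "x0 \<in> {0..1}" "G x0 = L0"
    and prob: "\<forall>\<^sub>F N in sequentially. \<forall>X. measure (P N) X =
        (\<Sum>k | k \<le> N \<and> real k / real N \<in> X. m N k) / (\<Sum>k\<le>N. m N k)"
    and I_eq: "\<And>x. I x = (if x \<in> {0..1} then ereal (L0 - G x) else \<infinity>)"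
begin

definition Z :: "nat \<Rightarrow> real" where
  "Z N = (\<Sum>k\<le>N. m N k)"

lemma G_le_L0: "x \<in> {0..1} \<Longrightarrow> G x \<le> L0"
proof (rule field_le_epsilon)
  fix e :: real assume x: "x \<in> {0..1}" and "e > 0"
  then obtain r where "(0, r) \<in> \<Lambda>" "r < L0 + e" using flat by blast
  then show "G x \<le> L0 + e" using G_le[of 0 r x] x by simp
qed

lemma G_concave:
  assumes "x \<in> {0..1}" "z \<in> {0..1}" "t \<in> {0..1}"
  shows "(1 - t) * G x + t * G z \<le> G ((1 - t) * x + t * z)"
proof (rule field_le_epsilon)
  fix e :: real assume e: "e > 0"
  let ?w = "(1 - t) * x + t * z"
  have w: "?w \<in> {0..1}"
    using convexD_alt[OF convex_real_interval(5), of x 0 1 z t] assms by simp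
  obtain s r where sr: "(s, r) \<in> \<Lambda>" "?w * s + r < G ?w + e" using G_near[OF w e] by blast
  have "(1 - t) * G x + t * G z \<le> (1 - t) * (x * s + r) + t * (z * s + r)"
    using G_le[OF sr(1)] assms by (intro add_mono mult_left_mono) auto
  also have "\<dots> = ?w * s + r" by (simp add: algebra_simps)
  finally show "(1 - t) * G x + t * G z \<le> G ?w + e" using sr(2) by linarith
qed

lemma Z_upper:
  assumes "\<epsilon> > 0"
  shows "\<forall>\<^sub>F N in sequentially. Z N \<le> exp (real N * (L0 + \<epsilon>))"
proof -
  obtain r where r: "(0, r) \<in> \<Lambda>" "r < L0 + \<epsilon>" using flat assms by blast
  obtain K where K: "\<And>N k. k \<le> N \<Longrightarrow> m N k \<le> K * exp (real N * r)" using up[OF r(1)] by auto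
  have "\<forall>\<^sub>F N in sequentially. (real N + 1) * K \<le> exp (real N * (L0 + \<epsilon> - r))"
    by (rule linear_le_exp) (use r in simp)
  then show ?thesis
  proof eventually_elim
    case (elim N)
    have "Z N \<le> (\<Sum>k\<le>N. K * exp (real N * r))" unfolding Z_def using K by (intro sum_mono) auto
    also have "\<dots> = (real N + 1) * K * exp (real N * r)" by simp
    also have "\<dots> \<le> exp (real N * (L0 + \<epsilon> - r)) * exp (real N * r)" using elim
        by (intro mult_right_mono) auto
    also have "\<dots> = exp (real N * (L0 + \<epsilon>))" by (simp add: exp_add[symmetric] algebra_simps)
    finally show ?case .
  qed
qed

lemma Z_lower:
  assumes "\<epsilon> > 0"
  shows "\<forall>\<^sub>F N in sequentially. exp (real N * (L0 - \<epsilon>)) \<le> Z N"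
  using low[OF x0(1) assms]
proof eventually_elim
  case (elim N)
  then obtain k where "k \<le> N" "exp (real N * (L0 - \<epsilon>)) \<le> m N k" using x0 by auto
  moreover have "m N k \<le> Z N" unfolding Z_def using \<open>k \<le> N\<close> m_nonneg by (intro member_le_sum) auto
  ultimately show ?case by linarith
qed

text \<open>A Chernoff bound made uniform by compactness: near each point one affine bound is good
  enough, and finitely many neighbourhoods cover the part of \<open>C\<close> in the unit interval.
  Allowing a subset \<open>X\<close> of \<open>C\<close> lets an open interval be estimated through
  its closure.\<close>

lemma measure_upper:
  assumes C: "closed C" "X \<subseteq> C" and y: "\<And>x. x \<in> C \<Longrightarrow> x \<in> {0..1} \<Longrightarrow> G x - L0 < y"
  shows "\<forall>\<^sub>F N in sequentially. measure (P N) X \<le> exp (real N * y)"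
proof -
  define Q where "Q U N \<longleftrightarrow> (\<forall>k\<le>N. real k / real N \<in> U \<longrightarrow> (real N + 1) * m N k
      \<le> exp (real N * y) * Z N)" for U :: "real set" and N
  have loc: "\<exists>U. open U \<and> x \<in> U \<and> eventually (Q U) sequentially" if x: "x \<in> C \<inter> {0..1}" for x
  proof -
    obtain s r where sr: "(s, r) \<in> \<Lambda>" "x * s + r < L0 + y"
      using G_near[of x "L0 + y - G x"] x y[of x] by auto
    \<comment> \<open>The gap is divided in three: for the neighbourhood, for the factor
      \<open>(real N + 1) * K\<close>, and for the lower bound on \<open>Z N\<close>.\<close>
    define \<eta> where "\<eta> = (L0 + y - (x * s + r)) / 3"
    have \<eta>: "\<eta> > 0" using sr by (simp add: \<eta>_def)
    define U where "U = {z. z * s + r < L0 + y - 2 * \<eta>}"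
    have "open U" unfolding U_def by (intro open_Collect_less continuous_intros)
    moreover have "x \<in> U" unfolding U_def using \<eta> by (simp add: \<eta>_def field_simps)
    moreover obtain K where K: "K > 0" "\<And>N k. k \<le> N \<Longrightarrow> m N k \<le> K * exp (real k * s + real N * r)"
      using up[OF sr(1)] by blast
    have "eventually (Q U) sequentially"
      using Z_lower[OF \<eta>] linear_le_exp[OF \<eta>, of K] eventually_gt_at_top[of 0]
    proof eventually_elim
      case (elim N)
      show ?case unfolding Q_def
      proof (intro allI impI)
        fix k assume k: "k \<le> N" "real k / real N \<in> U"
        have "real N * (real k / real N * s + r) \<le> real N * (L0 + y - 2 * \<eta>)"
          using k(2) unfolding U_def by (intro mult_left_mono) auto
        then have le: "real k * s + real N * r \<le> real N * (L0 + y - 2 * \<eta>)"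
          using elim(3) by (simp add: distrib_left)
        have "(real N + 1) * m N k \<le> (real N + 1) * (K * exp (real k * s + real N * r))"
          using K(2)[OF k(1)] by (intro mult_left_mono) auto
        also have "\<dots> \<le> (real N + 1) * K * exp (real N * (L0 + y - 2 * \<eta>))"
          using K le by simp
        also have "\<dots> \<le> exp (real N * \<eta>) * exp (real N * (L0 + y - 2 * \<eta>))"
          using elim(2) by (intro mult_right_mono) auto
        also have "\<dots> = exp (real N * y) * exp (real N * (L0 - \<eta>))"
          by (simp add: exp_add[symmetric] algebra_simps)
        also have "\<dots> \<le> exp (real N * y) * Z N" using elim(1) by (intro mult_left_mono) auto
        finally show "(real N + 1) * m N k \<le> exp (real N * y) * Z N" .
      qed
    qed
    ultimately show ?thesis by blast
  qed
  have comp: "compact (C \<inter> {0..1})" using C by (intro closed_Int_compact) auto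
  define \<U> where "\<U> = {U. open U \<and> eventually (Q U) sequentially}"
  have "C \<inter> {0..1} \<subseteq> \<Union>\<U>" unfolding \<U>_def using loc by blast
  then obtain D where D: "D \<subseteq> \<U>" "finite D" "C \<inter> {0..1} \<subseteq> \<Union>D"
    using compactE[OF comp, of \<U>] unfolding \<U>_def by blast
  have "\<forall>\<^sub>F N in sequentially. \<forall>U\<in>D. Q U N"
    using D by (intro eventually_ball_finite) (auto simp: \<U>_def)
  then show ?thesis using prob Z_lower[of 1, simplified] eventually_gt_at_top[of 0]
  proof eventually_elim
    case (elim N)
    have Zpos: "Z N > 0" using elim(3) by (rule less_le_trans[OF exp_gt_zero])
    have bound: "m N k \<le> exp (real N * y) * Z N / (real N + 1)" if k: "k
        \<le> N" "real k / real N \<in> X" for k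
    proof -
      have "real k / real N \<in> C \<inter> {0..1}" using k C elim(4) by auto
      then obtain U where "U \<in> D" "real k / real N \<in> U" using D(3) by blast
      then have "(real N + 1) * m N k \<le> exp (real N * y) * Z N" using elim(1) k(1) unfolding Q_def
          by blast
      then show ?thesis by (simp add: field_simps)
    qed
    have "(\<Sum>k | k \<le> N \<and> real k / real N \<in> X. m N k)
        \<le> (\<Sum>k | k \<le> N \<and> real k / real N \<in> X. exp (real N * y) * Z N / (real N + 1))"
      using bound by (intro sum_mono) auto
    also have "\<dots> \<le> (\<Sum>k\<le>N. exp (real N * y) * Z N / (real N + 1))"
      using Zpos by (intro sum_mono2) (auto intro!: mult_nonneg_nonneg divide_nonneg_nonneg)
    also have "\<dots> = exp (real N * y) * Z N" by (simp add: field_simps)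
    finally show ?case
      unfolding elim(2)[rule_format] Z_def[symmetric] using Zpos by (simp add: pos_divide_le_eq)
  qed
qed

lemma measure_lower:
  assumes O: "open U" "x \<in> U" "x \<in> {0..1}" and \<epsilon>: "\<epsilon> > 0"
  shows "\<forall>\<^sub>F N in sequentially. exp (real N * (G x - L0 - \<epsilon>)) \<le> measure (P N) U"
proof -
  obtain e where e: "e > 0" "ball x e \<subseteq> U" using O by (meson openE)
  define h where "h = min e (\<epsilon> / 2)"
  have h: "h > 0" "h \<le> e" "h \<le> \<epsilon> / 2" using e \<epsilon> by (auto simp: h_def)
  have e2: "\<epsilon> / 2 > 0" using \<epsilon> by simp
  show ?thesis using low[OF O(3) h(1)] prob Z_upper[OF e2] Z_lower[of 1, simplified]
  proof eventually_elim
    case (elim N)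
    then obtain k where k: "k \<le> N" "\<bar>real k / real N - x\<bar> < h" "exp (real N * (G x - h)) \<le> m N k"
        by blast
    have Zpos: "Z N > 0" using elim(4) by (rule less_le_trans[OF exp_gt_zero])
    have kU: "real k / real N \<in> U" using k(2) h e(2)
        by (auto simp: dist_real_def ball_def abs_minus_commute)
    have "exp (real N * (G x - L0 - \<epsilon>)) * Z N
        \<le> exp (real N * (G x - L0 - \<epsilon>)) * exp (real N * (L0 + \<epsilon> / 2))"
      using elim(3) by (intro mult_left_mono) auto
    also have "\<dots> = exp (real N * (G x - \<epsilon> / 2))" by (simp add: exp_add[symmetric] algebra_simps)
    also have "\<dots> \<le> exp (real N * (G x - h))" using h by (simp add: mult_left_mono)
    also have "\<dots> \<le> m N k" by (rule k(3))
    also have "\<dots> \<le> (\<Sum>k | k \<le> N \<and> real k / real N \<in> U. m N k)"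
      using k(1) kU m_nonneg by (intro member_le_sum) auto
    finally show ?case
      unfolding elim(2)[rule_format] Z_def[symmetric] using Zpos by (simp add: pos_le_divide_eq)
  qed
qed

lemma log_measure_upper:
  assumes C: "closed C" "X \<subseteq> C" and y: "\<And>x. x \<in> C \<Longrightarrow> x \<in> {0..1} \<Longrightarrow> G x - L0 < y"
  shows "\<forall>\<^sub>F N in sequentially. elog (measure (P N) X) / ereal (real N) \<le> ereal y"
proof -
  have "\<forall>\<^sub>F N in sequentially. measure (P N) X \<le> exp (real N * y)"
    by (rule measure_upper[OF C]) (rule y)
  then show ?thesis using eventually_gt_at_top[of 0]
    by eventually_elim (rule elog_div_le)
qed

lemma log_measure_lower:
  assumes O: "open U" and y: "y < - (INF x\<in>U. I x)"
  shows "\<forall>\<^sub>F N in sequentially. y < elog (measure (P N) U) / ereal (real N)"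
proof -
  have "(INF x\<in>U. I x) < - y" using y ereal_less_uminus_reorder by blast
  then obtain x where x: "x \<in> U" "I x < - y" unfolding INF_less_iff by blast
  have x01: "x \<in> {0..1}" using x(2) I_eq[of x] by (auto split: if_splits)
  then have "y < ereal (G x - L0)" using x(2) I_eq[of x] ereal_less_uminus_reorder[of y "ereal (L0
      - G x)"]
    by simp
  then obtain z where z: "y < ereal z" "ereal z < ereal (G x - L0)" using ereal_dense2 by blast
  have "\<forall>\<^sub>F N in sequentially. exp (real N * (G x - L0 - (G x - L0 - z))) \<le> measure (P N) U"
    using z by (intro measure_lower O x(1) x01) simp
  then show ?thesis using eventually_gt_at_top[of 0]
  proof eventually_elim
    case (elim N)
    then have "ereal z \<le> elog (measure (P N) U) / ereal (real N)" by (intro elog_div_ge) auto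
    then show ?case using z(1) by (rule less_le_trans[rotated])
  qed
qed

lemma rate_function_I: "rate_function I"
  unfolding rate_function_def
proof (intro conjI allI)
  show "0 \<le> I x" for x using G_le_L0[of x] by (auto simp: I_eq)
  fix c :: real
  \<comment> \<open>As an infimum of affine functions \<open>G\<close> is upper semicontinuous: the
    sublevel set of \<open>I\<close> is cut out of the unit interval by one closed affine condition
    per pair.\<close>
  have "{x. I x \<le> ereal c} = {0..1} \<inter> (\<Inter>(s, r)\<in>\<Lambda>. {x. L0 - (x * s + r) \<le> c})"
  proof (intro set_eqI iffI)
    fix x assume "x \<in> {x. I x \<le> ereal c}"
    then have "x \<in> {0..1}" "L0 - G x \<le> c" by (auto simp: I_eq split: if_splits)
    then show "x \<in> {0..1} \<inter> (\<Inter>(s, r)\<in>\<Lambda>. {x. L0 - (x * s + r) \<le> c})"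
      using G_le[of _ _ x] by fastforce
  next
    fix x assume x: "x \<in> {0..1} \<inter> (\<Inter>(s, r)\<in>\<Lambda>. {x. L0 - (x * s + r) \<le> c})"
    have "L0 - G x \<le> c"
    proof (rule field_le_epsilon)
      fix e :: real assume "e > 0"
      then obtain s r where sr: "(s, r) \<in> \<Lambda>" "x * s + r < G x + e" using G_near[of x e] x by auto
      then have "L0 - (x * s + r) \<le> c" using x by blast
      then show "L0 - G x \<le> c + e" using sr(2) by linarith
    qed
    then show "x \<in> {x. I x \<le> ereal c}" using x by (simp add: I_eq)
  qed
  moreover have "closed (\<Inter>(s, r)\<in>\<Lambda>. {x. L0 - (x * s + r) \<le> c})"
    by (intro closed_INT ballI, unfold case_prod_beta) (intro closed_Collect_le continuous_intros)
  ultimately show "closed {x. I x \<le> ereal c}" by (simp add: closed_Int)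
qed

lemma ldp: "large_deviations_principle P real I"
  unfolding large_deviations_principle_def
proof (intro conjI allI impI rate_function_I)
  fix C :: "real set" assume C: "closed C"
  show "limsup (\<lambda>n. elog (measure (P n) C) / ereal (real n)) \<le> - (INF x\<in>C. I x)"
    unfolding Limsup_le_iff
  proof (intro allI impI)
    fix y assume "- (INF x\<in>C. I x) < y"
    then obtain z where z: "- (INF x\<in>C. I x) < ereal z" "ereal z < y" using ereal_dense2 by blast
    have le: "G x - L0 < z" if "x \<in> C" "x \<in> {0..1}" for x
    proof -
      have "- ereal z < (INF x\<in>C. I x)" using z(1) ereal_uminus_less_reorder by blast
      also have "\<dots> \<le> I x" using that by (intro INF_lower)
      finally show ?thesis using that by (simp add: I_eq)
    qed
    have "\<forall>\<^sub>F n in sequentially. elog (measure (P n) C) / ereal (real n) \<le> ereal z"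
      by (rule log_measure_upper[OF C subset_refl]) (rule le)
    then show "\<forall>\<^sub>F n in sequentially. elog (measure (P n) C) / ereal (real n) < y"
      by eventually_elim (use z(2) in auto)
  qed
next
  fix U :: "real set" assume "open U"
  then show "- (INF x\<in>U. I x) \<le> liminf (\<lambda>n. elog (measure (P n) U) / ereal (real n))"
    unfolding le_Liminf_iff using log_measure_lower by blast
qed

text \<open>A concave function cannot jump upwards at the end of a segment: its value there is the
  limit along the chord to \<open>w\<close>, which lies below the values inside.\<close>

lemma G_le_endpoint:
  assumes x: "x \<in> {0..1}" and w: "w \<in> {0..1}"
    and le: "\<And>t. 0 < t \<Longrightarrow> t < 1 \<Longrightarrow> G ((1 - t) * x + t * w) \<le> z"
  shows "G x \<le> z"
proof (rule tendsto_upperbound)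
  have "((\<lambda>t. (1 - t) * G x + t * G w) \<longlongrightarrow> (1 - 0) * G x + 0 * G w) (at_right 0)"
    by (intro tendsto_intros)
  then show "((\<lambda>t. (1 - t) * G x + t * G w) \<longlongrightarrow> G x) (at_right 0)" by simp
  have "eventually (\<lambda>t::real. t \<in> {0<..<1}) (at_right 0)" by (rule eventually_at_right_real) simp
  then show "\<forall>\<^sub>F t in at_right 0. (1 - t) * G x + t * G w \<le> z"
  proof eventually_elim
    case (elim t)
    then show ?case using G_concave[OF x w, of t] le[of t] by auto
  qed
qed simp

text \<open>Lower bounds are available for the open interval, upper bounds through its closure.
  Concavity of \<open>G\<close> closes the gap, as \<open>I\<close> has the same infimum over
  both.\<close>

lemma interval_limit:
  assumes ab: "0 \<le> a" "a < b" "b \<le> 1"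
  shows "(\<lambda>N. elog (measure (P N) {a<..<b}) / ereal (real N)) \<longlonglongrightarrow> - (INF x\<in>{a<..<b}. I x)"
proof (rule order_tendstoI)
  fix y assume "y < - (INF x\<in>{a<..<b}. I x)"
  then show "\<forall>\<^sub>F N in sequentially. y < elog (measure (P N) {a<..<b}) / ereal (real N)"
    by (intro log_measure_lower) auto
next
  fix y assume "- (INF x\<in>{a<..<b}. I x) < y"
  \<comment> \<open>Two levels are inserted because passing to the closure yields only a weak
    inequality, while \<open>log_measure_upper\<close> asks for a strict one.\<close>
  then obtain z' where z': "- (INF x\<in>{a<..<b}. I x) < ereal z'" "ereal z' < y" using ereal_dense2
      by blast
  from z'(2) obtain z where z: "ereal z' < ereal z" "ereal z < y" using ereal_dense2 by blast
  have inner: "G x - L0 \<le> z'" if "x \<in> {a<..<b}" for x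
  proof -
    have "- ereal z' < (INF x\<in>{a<..<b}. I x)" using z'(1) ereal_uminus_less_reorder by blast
    also have "\<dots> \<le> I x" using that by (intro INF_lower)
    finally show ?thesis using that ab by (auto simp: I_eq)
  qed
  have "G x \<le> z' + L0" if x: "x \<in> {a..b}" for x
  proof (rule G_le_endpoint)
    let ?w = "(a + b) / 2"
    show "x \<in> {0..1}" "?w \<in> {0..1}" using x ab by auto
    fix t :: real assume t: "0 < t" "t < 1"
    have "(1 - t) * a + t * ?w \<le> (1 - t) * x + t * ?w" "(1 - t) * x + t * ?w \<le> (1 - t) * b + t * ?w"
      using x t by (auto intro!: mult_left_mono)
    moreover have "a < (1 - t) * a + t * ?w"
    proof -
      have "t * a < t * ?w" using t ab by (intro mult_strict_left_mono) auto
      then show ?thesis by (simp add: left_diff_distrib)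
    qed
    moreover have "(1 - t) * b + t * ?w < b"
    proof -
      have "t * ?w < t * b" using t ab by (intro mult_strict_left_mono) auto
      then show ?thesis by (simp add: left_diff_distrib)
    qed
    ultimately have "(1 - t) * x + t * ?w \<in> {a<..<b}" by auto
    from inner[OF this] show "G ((1 - t) * x + t * ?w) \<le> z' + L0" by simp
  qed
  then have "G x - L0 < z" if "x \<in> {a..b}" for x using that z(1) by fastforce
  then have "\<forall>\<^sub>F N in sequentially. elog (measure (P N) {a<..<b}) / ereal (real N) \<le> ereal z"
    by (intro log_measure_upper[of "{a..b}"]) auto
  then show "\<forall>\<^sub>F N in sequentially. elog (measure (P N) {a<..<b}) / ereal (real N) < y"
    by eventually_elim (use z(2) in auto)
qed

end

section \<open>The rate function\<close>

lemma xlnx_mult: "0 \<le> y \<Longrightarrow> 0 \<le> z \<Longrightarrow> xlnx (y * z) = y * z * ln y + y * z * ln z"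
  by (cases "y = 0 \<or> z = 0") (auto simp: xlnx_def ln_mult_pos algebra_simps)

lemma xlnx_divide: "0 \<le> y \<Longrightarrow> 0 < z \<Longrightarrow> y * ln (y / z) = xlnx y - y * ln z"
  by (cases "y = 0") (auto simp: xlnx_def ln_div algebra_simps)

text \<open>Gibbs' inequality is the case \<open>w = 1 - x\<close>. The last hypothesis holds for every \<open>F\<close> in an
  interval of which \<open>w\<close> is the point closest to \<open>1 - x\<close>.\<close>

lemma gibbs:
  fixes x F w :: real
  assumes x: "0 \<le> x" "x \<le> 1" and F: "0 < F" "F < 1" and o: "0 \<le> w" "w \<le> 1" "0 < x \<Longrightarrow> w < 1" "x < 1
      \<Longrightarrow> 0 < w"
    and opt: "(F - w) * (1 - x - w) \<le> 0"
  shows "- x * ln (1 - w) - (1 - x) * ln w \<le> - x * ln (1 - F) - (1 - x) * ln F"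
proof -
  have "x = 0 \<or> x = 1 \<or> 0 < x \<and> x < 1" using x by linarith
  then consider "x = 0" | "x = 1" | "0 < x" "x < 1" by blast
  then show ?thesis
  proof cases
    case 1
    then have "F * (1 - w) \<le> w * (1 - w)" "0 < w" using opt o by (auto simp: algebra_simps)
    then have "F \<le> w" using F o by (cases "w = 1") auto
    then show ?thesis using 1 F by simp
  next
    case 2
    then have "w * (w - F) \<le> 0" using opt by (simp add: algebra_simps)
    moreover have "w < 1" using 2 o by simp
    ultimately have "w \<le> F" using F o by (cases "w = 0") (auto simp: mult_le_0_iff)
    then show ?thesis using 2 F \<open>w < 1\<close> by simp
  next
    case 3
    then have w: "0 < w" "w < 1" using o by auto
    \<comment> \<open>The estimate is \<open>ln t \<le> t - 1\<close> at the ratios of the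
      arguments; the resulting combination factors into the expression of \<open>opt\<close> over
      \<open>w * (1 - w)\<close>.\<close>
    have l1: "ln (1 - F) - ln (1 - w) \<le> (w - F) / (1 - w)"
      using ln_le_minus_one[of "(1 - F) / (1 - w)"] w F by (simp add: ln_div field_simps)
    have l2: "ln F - ln w \<le> (F - w) / w"
      using ln_le_minus_one[of "F / w"] w F by (simp add: ln_div field_simps)
    have "x * (ln (1 - F) - ln (1 - w)) + (1 - x) * (ln F - ln w)
        \<le> x * ((w - F) / (1 - w)) + (1 - x) * ((F - w) / w)"
      using l1 l2 3 by (intro add_mono mult_left_mono) auto
    also have "\<dots> = (F - w) * (1 - x - w) / (w * (1 - w))"
      using w by (simp add: field_simps)
    also have "\<dots> \<le> 0" using opt w by (intro divide_nonpos_pos) auto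
    finally show ?thesis by (simp add: algebra_simps)
  qed
qed

locale reservoir_densities =
  fixes \<rho>0 \<rho>1 :: real
  assumes \<rho>1: "0 \<le> \<rho>1" and \<rho>0: "\<rho>0 \<le> 1" and lt: "\<rho>1 < \<rho>0"
begin

definition opt :: "real \<Rightarrow> real" where
  "opt x = max \<rho>1 (min \<rho>0 (1 - x))"

text \<open>On the unit interval \<open>opt x\<close> can be 1 only at \<open>x = 0\<close> and 0
  only at \<open>x = 1\<close>, where the factor in front of the degenerate logarithm
  vanishes.\<close>

definition growth :: "real \<Rightarrow> real" where
  "growth x = - xlnx x - xlnx (1 - x) - x * ln (1 - opt x) - (1 - x) * ln (opt x)"

text \<open>The point between \<rho>1 and \<rho>0 closest to 1 / 2, hence the maximiser of
  \<open>\<rho> * (1 - \<rho>)\<close> there. By \<open>growth_fopt\<close> it is also a density of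
  zero rate.\<close>

definition fopt :: real where
  "fopt = opt (1 / 2)"

definition L0r :: real where
  "L0r = - ln (fopt * (1 - fopt))"

text \<open>The pairs \<open>(s, r)\<close> for which
  \<open>x s + r = - x ln (p (1 - F)) - (1 - x) ln ((1 - p) F)\<close>: \<open>p\<close> comes from the bound
  \<open>p ^ (-k) * (1 - p) ^ (-(N - k))\<close> on a binomial coefficient. For \<open>p = F\<close> the slope is zero.\<close>

definition bounds :: "(real \<times> real) set" where
  "bounds = {(s, r). \<exists>p F. 0 < p \<and> p < 1 \<and> \<rho>1 < F \<and> F < \<rho>0 \<and>
     s = ln ((1 - p) * F) - ln (p * (1 - F)) \<and> r = - ln ((1 - p) * F)}"

lemma opt_bounds: "\<rho>1 \<le> opt x" "opt x \<le> \<rho>0"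
  using lt by (auto simp: opt_def)

lemma opt_pos: "x < 1 \<Longrightarrow> 0 < opt x"
  using \<rho>1 lt by (auto simp: opt_def)

lemma opt_less_1: "0 < x \<Longrightarrow> opt x < 1"
  using \<rho>0 lt by (auto simp: opt_def)

lemma fopt: "0 < fopt" "fopt < 1"
  unfolding fopt_def by (auto intro: opt_pos opt_less_1)

text \<open>Gibbs' inequality is applied twice: with \<open>w = opt x\<close> to the part containing
  \<open>F\<close>, and with \<open>w = 1 - x\<close> to the part containing
  \<open>p\<close>.\<close>

lemma growth_le_bound:
  assumes sr: "(s, r) \<in> bounds" and x: "x \<in> {0..1}"
  shows "growth x \<le> x * s + r"
proof -
  obtain p F where p: "0 < p" "p < 1" and F: "\<rho>1 < F" "F < \<rho>0"
    and s: "s = ln ((1 - p) * F) - ln (p * (1 - F))" and r: "r = - ln ((1 - p) * F)"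
    using sr unfolding bounds_def by auto
  have F01: "0 < F" "F < 1" using F \<rho>0 \<rho>1 by auto
  have "(F - opt x) * (1 - x - opt x) \<le> 0"
  proof -
    consider "opt x = 1 - x" | "opt x = \<rho>0" "\<rho>0 \<le> 1 - x" | "opt x = \<rho>1" "1 - x \<le> \<rho>1"
      using lt unfolding opt_def by linarith
    then show ?thesis using F by cases (auto simp: mult_le_0_iff)
  qed
  then have b1: "- x * ln (1 - opt x) - (1 - x) * ln (opt x) \<le> - x * ln (1 - F) - (1 - x) * ln F"
    using x F01 opt_bounds[of x] \<rho>0 \<rho>1 by (intro gibbs) (auto intro: opt_pos opt_less_1)
  have "- x * ln (1 - (1 - x)) - (1 - x) * ln (1 - x) \<le> - x * ln (1 - (1 - p)) - (1 - x) * ln (1 - p)"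
    using x p by (intro gibbs) auto
  then have b2: "- xlnx x - xlnx (1 - x) \<le> - x * ln p - (1 - x) * ln (1 - p)"
    by (simp add: xlnx_def)
  have "x * s + r = (- x * ln p - (1 - x) * ln (1 - p)) + (- x * ln (1 - F) - (1 - x) * ln F)"
  proof -
    have "ln ((1 - p) * F) = ln (1 - p) + ln F" "ln (p * (1 - F)) = ln p + ln (1 - F)"
      using p F01 by (simp_all add: ln_mult_pos)
    then show ?thesis unfolding s r by (simp add: algebra_simps)
  qed
  then show ?thesis using b1 b2 unfolding growth_def by linarith
qed

text \<open>Pairs in \<open>bounds\<close> require \<open>F\<close> strictly between the densities,
  whereas \<open>opt x\<close> may be an endpoint. Moving towards the midpoint by any positive
  proportion repairs this.\<close>

lemma inner_approximation:
  assumes w: "\<rho>1 \<le> w" "w \<le> \<rho>0" and t: "0 < t" "t < 1"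
  shows "\<rho>1 < (1 - t) * w + t * ((\<rho>0 + \<rho>1) / 2)" "(1 - t) * w + t * ((\<rho>0 + \<rho>1) / 2) < \<rho>0"
proof -
  have "(1 - t) * \<rho>1 \<le> (1 - t) * w" "(1 - t) * w \<le> (1 - t) * \<rho>0" using w t
      by (auto intro!: mult_left_mono)
  moreover have "t * \<rho>1 < t * ((\<rho>0 + \<rho>1) / 2)" "t * ((\<rho>0 + \<rho>1) / 2) < t * \<rho>0"
    using lt t by (auto intro!: mult_strict_left_mono)
  moreover have "(1 - t) * \<rho>1 + t * \<rho>1 = \<rho>1" "(1 - t) * \<rho>0 + t * \<rho>0 = \<rho>0"
      by (simp_all add: algebra_simps)
  ultimately show "\<rho>1 < (1 - t) * w + t * ((\<rho>0 + \<rho>1) / 2)" "(1 - t) * w + t * ((\<rho>0 + \<rho>1) / 2) < \<rho>0"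
    by linarith+
qed

lemma growth_near:
  assumes x: "x \<in> {0..1}" and \<epsilon>: "\<epsilon> > 0"
  shows "\<exists>s r. (s, r) \<in> bounds \<and> x * s + r < growth x + \<epsilon>"
proof -
  define F where "F t = (1 - t) * opt x + t * ((\<rho>0 + \<rho>1) / 2)" for t
  define p where "p t = (1 - t) * x + t * (1 / 2)" for t
  have F: "(F \<longlongrightarrow> opt x) (at_right 0)"
  proof -
    have "(F \<longlongrightarrow> (1 - 0) * opt x + 0 * ((\<rho>0 + \<rho>1) / 2)) (at_right 0)"
      unfolding F_def by (intro tendsto_intros)
    then show ?thesis by simp
  qed
  have p: "(p \<longlongrightarrow> x) (at_right 0)"
  proof -
    have "(p \<longlongrightarrow> (1 - 0) * x + 0 * (1 / 2)) (at_right 0)"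
      unfolding p_def by (intro tendsto_intros)
    then show ?thesis by simp
  qed
  \<comment> \<open>If \<open>x = 0\<close> the logarithm may diverge in the limit, but its
    coefficient is 0; \<open>l2\<close> treats \<open>x = 1\<close> in the same way.\<close>
  have l1: "((\<lambda>t. x * ln (p t * (1 - F t))) \<longlongrightarrow> xlnx x + x * ln (1 - opt x)) (at_right 0)"
  proof (cases "x = 0")
    case False
    then have x0: "0 < x" using x by simp
    have "((\<lambda>t. x * ln (p t * (1 - F t))) \<longlongrightarrow> x * ln (x * (1 - opt x))) (at_right 0)"
      using x0 opt_less_1[OF x0] by (intro tendsto_intros F p) auto
    then show ?thesis using x0 opt_less_1[OF x0] by (simp add: ln_mult_pos xlnx_def distrib_left)
  qed simp
  have l2: "((\<lambda>t. (1 - x) * ln ((1 - p t) * F t)) \<longlongrightarrow> xlnx (1 - x) + (1 - x) * ln (opt x)) (at_right 0)"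
  proof (cases "x = 1")
    case False
    then have x1: "x < 1" using x by simp
    have "((\<lambda>t. (1 - x) * ln ((1 - p t) * F t)) \<longlongrightarrow> (1 - x) * ln ((1 - x) * opt x)) (at_right 0)"
      using x1 opt_pos[OF x1] by (intro tendsto_intros F p) auto
    then show ?thesis using x1 opt_pos[OF x1] by (simp add: ln_mult_pos xlnx_def distrib_left)
  qed simp
  have "((\<lambda>t. - (x * ln (p t * (1 - F t))) - (1 - x) * ln ((1 - p t) * F t)) \<longlongrightarrow>
      - (xlnx x + x * ln (1 - opt x)) - (xlnx (1 - x) + (1 - x) * ln (opt x))) (at_right 0)"
    by (intro tendsto_intros l1 l2)
  then have "\<forall>\<^sub>F t in at_right 0. - (x * ln (p t * (1 - F t))) - (1 - x) * ln ((1 - p t)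
      * F t) < growth x + \<epsilon>"
    by (rule order_tendstoD) (use \<epsilon> in \<open>simp add: growth_def\<close>)
  moreover have "\<forall>\<^sub>F t in at_right 0. t \<in> {0<..<1::real}" by (rule eventually_at_right_real) simp
  ultimately have "\<forall>\<^sub>F t in at_right 0. t \<in> {0<..<1} \<and>
      - (x * ln (p t * (1 - F t))) - (1 - x) * ln ((1 - p t) * F t) < growth x + \<epsilon>"
    by eventually_elim auto
  then obtain t where t: "0 < t" "t < 1"
    "- (x * ln (p t * (1 - F t))) - (1 - x) * ln ((1 - p t) * F t) < growth x + \<epsilon>"
    using eventually_happens'[OF trivial_limit_at_right_real] by force
  have Ft: "\<rho>1 < F t" "F t < \<rho>0"
    unfolding F_def using inner_approximation[OF opt_bounds t(1,2)] by auto
  have pt: "0 < p t" "p t < 1"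
  proof -
    have "0 \<le> (1 - t) * x" "(1 - t) * x \<le> 1 - t" using x t by (auto simp: mult_left_le)
    then show "0 < p t" "p t < 1" using t unfolding p_def by linarith+
  qed
  have "(ln ((1 - p t) * F t) - ln (p t * (1 - F t)), - ln ((1 - p t) * F t)) \<in> bounds"
    using Ft pt unfolding bounds_def by blast
  moreover have "x * (A - B) + - A = - (x * B) - (1 - x) * A" for A B :: real
    by (simp add: algebra_simps)
  ultimately show ?thesis using t(3) by metis
qed

lemma flat_bound:
  assumes \<epsilon>: "\<epsilon> > 0"
  shows "\<exists>r. (0, r) \<in> bounds \<and> r < L0r + \<epsilon>"
proof -
  define F where "F t = (1 - t) * fopt + t * ((\<rho>0 + \<rho>1) / 2)" for t
  have F: "(F \<longlongrightarrow> fopt) (at_right 0)"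
  proof -
    have "(F \<longlongrightarrow> (1 - 0) * fopt + 0 * ((\<rho>0 + \<rho>1) / 2)) (at_right 0)"
      unfolding F_def by (intro tendsto_intros)
    then show ?thesis by simp
  qed
  have "((\<lambda>t. - ln (F t * (1 - F t))) \<longlongrightarrow> - ln (fopt * (1 - fopt))) (at_right 0)"
    using fopt by (intro tendsto_intros F) auto
  then have "\<forall>\<^sub>F t in at_right 0. - ln (F t * (1 - F t)) < L0r + \<epsilon>"
    by (rule order_tendstoD) (use \<epsilon> in \<open>simp add: L0r_def\<close>)
  moreover have "\<forall>\<^sub>F t in at_right 0. t \<in> {0<..<1::real}" by (rule eventually_at_right_real) simp
  ultimately have "\<forall>\<^sub>F t in at_right 0. t \<in> {0<..<1} \<and> - ln (F t * (1 - F t)) < L0r + \<epsilon>"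
    by eventually_elim auto
  then obtain t where t: "0 < t" "t < 1" "- ln (F t * (1 - F t)) < L0r + \<epsilon>"
    using eventually_happens'[OF trivial_limit_at_right_real] by force
  have Ft: "\<rho>1 < F t" "F t < \<rho>0"
    unfolding F_def fopt_def using inner_approximation[OF opt_bounds t(1,2)] by auto
  then have "(0, - ln ((1 - F t) * F t)) \<in> bounds"
    unfolding bounds_def using \<rho>0 \<rho>1 by (auto intro!: exI[of _ "F t"] simp: mult.commute)
  then show ?thesis using t(3) by (auto simp: mult.commute)
qed

text \<open>\<open>fopt\<close> is a fixed point of \<open>opt\<close>, and there the entropy and
  the remaining logarithms combine to \<open>- ln fopt - ln (1 - fopt)\<close>.\<close>

lemma growth_fopt: "growth fopt = L0r"
proof -
  have "opt fopt = fopt \<or> opt fopt = 1 - fopt \<and> fopt = 1 / 2"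
    using lt unfolding fopt_def opt_def by linarith
  then have o: "opt fopt = fopt" by auto
  have "ln (fopt * (1 - fopt)) = ln fopt + ln (1 - fopt)" using fopt by (simp add: ln_mult_pos)
  then show ?thesis unfolding growth_def L0r_def o
    by (simp add: xlnx_def algebra_simps)
qed

lemma asep_L0_eq: "asep_L0 \<rho>0 \<rho>1 = ereal L0r"
proof -
  have "(SUP \<rho>\<in>{\<rho>1..\<rho>0}. elog (\<rho> * (1 - \<rho>))) = ereal (ln (fopt * (1 - fopt)))"
  proof (rule SUP_eqI)
    fix \<rho> assume \<rho>: "\<rho> \<in> {\<rho>1..\<rho>0}"
    \<comment> \<open>The difference \<open>fopt * (1 - fopt) - \<rho> * (1 - \<rho>)\<close>
      factors in this way.\<close>
    have "0 \<le> (fopt - \<rho>) * (1 - fopt - \<rho>)"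
    proof -
      consider "fopt = 1 / 2" | "fopt = \<rho>0" "\<rho>0 \<le> 1 / 2" | "fopt = \<rho>1" "1 / 2 \<le> \<rho>1"
        using lt unfolding fopt_def opt_def by linarith
      then show ?thesis
      proof cases
        case 1
        have "(fopt - \<rho>) * (1 - fopt - \<rho>) = (1 / 2 - \<rho>) * (1 / 2 - \<rho>)" by (simp only: 1) simp
        then show ?thesis by simp
      qed (use \<rho> in \<open>auto simp: zero_le_mult_iff\<close>)
    qed
    then have "\<rho> * (1 - \<rho>) \<le> fopt * (1 - fopt)" by (simp add: algebra_simps)
    then show "elog (\<rho> * (1 - \<rho>)) \<le> ereal (ln (fopt * (1 - fopt)))"
      by (auto simp: elog_def)
  next
    fix y assume y: "\<And>\<rho>. \<rho> \<in> {\<rho>1..\<rho>0} \<Longrightarrow> elog (\<rho> * (1 - \<rho>)) \<le> y"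
    have "fopt \<in> {\<rho>1..\<rho>0}" unfolding fopt_def using opt_bounds by simp
    from y[OF this] show "ereal (ln (fopt * (1 - fopt))) \<le> y" using fopt by (simp add: elog_def)
  qed
  then show ?thesis by (simp add: asep_L0_def L0r_def)
qed

lemma asep_rate_function_eq:
  "asep_rate_function \<rho>0 \<rho>1 x = (if x \<in> {0..1} then ereal (L0r - growth x) else \<infinity>)"
proof -
  have rel: "relative_entropy x p = xlnx x - x * ln p + xlnx (1 - x) - (1 - x) * ln (1 - p)"
    if "0 \<le> x" "x \<le> 1" "0 < p" "p < 1" for p
    using that by (simp add: relative_entropy_def xlnx_divide)
  consider "0 \<le> x" "x < 1 - \<rho>0" | "1 - \<rho>0 \<le> x" "x \<le> 1 - \<rho>1" | "1 - \<rho>1 < x" "x \<le> 1" | "x < 0 \<or> x > 1"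
    by linarith
  then show ?thesis
  proof cases
    case 1
    then have o: "opt x = \<rho>0" using lt by (simp add: opt_def)
    \<comment> \<open>A point \<open>x\<close> in this case excludes \<rho>0 = 1, so the
      \<open>elog\<close> term is finite. Likewise the third case excludes \<rho>1 = 0.\<close>
    have \<rho>: "0 < \<rho>0" "\<rho>0 < 1" using 1 lt \<rho>1 by auto
    have l: "ln (\<rho>0 * (1 - \<rho>0)) = ln \<rho>0 + ln (1 - \<rho>0)" using \<rho> by (simp add: ln_mult_pos)
    have "relative_entropy x \<rho>0 + L0r + ln (\<rho>0 * (1 - \<rho>0)) = L0r - growth x"
      using 1 \<rho> l by (simp add: rel growth_def o algebra_simps)
    then show ?thesis using 1 \<rho> by (simp add: asep_rate_function_def asep_L0_eq elog_def)
  next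
    case 2
    then have o: "opt x = 1 - x" using lt by (simp add: opt_def)
    have x: "0 \<le> x" "x \<le> 1" using 2 \<rho>0 \<rho>1 by auto
    have l4: "ln (4::real) = 2 * ln 2" using ln_realpow[of 2 2] by simp
    have "2 * relative_entropy x (1 / 2) + L0r - ln 4 = L0r - growth x"
      unfolding l4 using x by (simp add: rel growth_def o xlnx_def ln_div algebra_simps)
    then show ?thesis using 2 x by (simp add: asep_rate_function_def asep_L0_eq)
  next
    case 3
    then have o: "opt x = \<rho>1" using lt by (simp add: opt_def)
    have \<rho>: "0 < \<rho>1" "\<rho>1 < 1" using 3 lt \<rho>0 by auto
    have l: "ln (\<rho>1 * (1 - \<rho>1)) = ln \<rho>1 + ln (1 - \<rho>1)" using \<rho> by (simp add: ln_mult_pos)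
    have "relative_entropy x \<rho>1 + L0r + ln (\<rho>1 * (1 - \<rho>1)) = L0r - growth x"
      using 3 \<rho> l by (simp add: rel growth_def o algebra_simps)
    then show ?thesis using 3 \<rho> lt by (simp add: asep_rate_function_def asep_L0_eq elog_def)
  next
    case 4
    then show ?thesis using \<rho>0 \<rho>1 lt by (auto simp: asep_rate_function_def)
  qed
qed

end

section \<open>The large deviations principle\<close>

text \<open>\<open>A\<close> and \<open>B\<close> are the roots of
  \<open>x z^2 - (s - x + y) z - y\<close>. Its value at -1 is \<open>s > 0\<close>; given
  \<open>A \<ge> 0\<close> this amounts to \<open>B > -1\<close>, and it makes
  \<open>1 / (1 + A)\<close> a multiple of \<open>1 + B\<close>, which is how the square root
  formulas for the densities arise.\<close>

lemma boundary_roots: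
  fixes x y s :: real
  assumes x: "x > 0" and y: "y \<ge> 0" and s: "s > 0"
  defines "D \<equiv> sqrt ((s - x + y)\<^sup>2 + 4 * x * y)"
  defines "A \<equiv> (s - x + y + D) / (2 * x)" and "B \<equiv> (s - x + y - D) / (2 * x)"
  shows "0 \<le> A" "-1 < B" "B \<le> 0" "x * ((1 + A) * (1 + B)) = s" "y = - A * B * x"
    "1 / (1 + A) = (s + x + y - D) / (2 * s)"
proof -
  have xy: "0 \<le> 4 * x * y" using x y by simp
  have D2: "D\<^sup>2 = (s - x + y)\<^sup>2 + 4 * x * y" unfolding D_def using xy by simp
  have "\<bar>s - x + y\<bar> \<le> D" unfolding D_def using xy by (intro real_le_rsqrt) simp
  then show A0: "0 \<le> A" and "B \<le> 0" using x by (auto simp: A_def B_def divide_le_0_iff)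
  have sxy: "(s + x + y)\<^sup>2 - D\<^sup>2 = 4 * x * s" unfolding D2 by (simp add: power2_eq_square algebra_simps)
  have "D\<^sup>2 < (s + x + y)\<^sup>2" using sxy mult_pos_pos[OF x s] by linarith
  then have "D < s + x + y" by (rule power_less_imp_less_base) (use x y s in simp)
  then show "-1 < B" using x by (simp add: B_def field_simps)
  have A1: "1 + A = (s + x + y + D) / (2 * x)" using x by (simp add: A_def field_simps)
  have B1: "1 + B = (s + x + y - D) / (2 * x)" using x by (simp add: B_def field_simps)
  have "(1 + A) * (1 + B) = ((s + x + y)\<^sup>2 - D\<^sup>2) / (4 * x * x)"
    unfolding A1 B1 by (simp add: power2_eq_square algebra_simps)
  also have "\<dots> = s / x" unfolding sxy using x by simp
  finally have "(1 + A) * (1 + B) = s / x" .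
  then show xAB: "x * ((1 + A) * (1 + B)) = s" using x by simp
  have "A * B = ((s - x + y)\<^sup>2 - D\<^sup>2) / (4 * x * x)"
    unfolding A_def B_def by (simp add: power2_eq_square algebra_simps)
  also have "\<dots> = - y / x" unfolding D2 using x by simp
  finally show "y = - A * B * x" using x by simp
  have "1 / (1 + A) = x * (1 + B) / s" using xAB A0 s by (simp add: field_simps)
  also have "\<dots> = (s + x + y - D) / (2 * s)" unfolding B1 using x by simp
  finally show "1 / (1 + A) = (s + x + y - D) / (2 * s)" .
qed

section \<open>Growth rate of the masses and law of the mean density\<close>

lemma words_filter_length:
  assumes "xs \<in> words N k"
  shows "length (filter (\<lambda>x. x = 1) xs) = k" "length (filter (\<lambda>x. x \<noteq> 1) xs) = N - k"
proof -
  have *: "set xs \<subseteq> {0, 1} \<Longrightarrow> length (filter (\<lambda>x. x = 1) xs) = sum_list xs" for xs :: "nat list"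
    by (induction xs) auto
  then show 1: "length (filter (\<lambda>x. x = 1) xs) = k" using assms by (auto simp: words_def)
  show "length (filter (\<lambda>x. x \<noteq> 1) xs) = N - k"
    using sum_length_filter_compl[of "\<lambda>x. x = 1" xs] assms 1 by (auto simp: words_def)
qed

context matrix_ansatz
begin

sublocale dens: reservoir_densities "1 / (1 + c)" "a / (1 + a)"
proof
  show "a / (1 + a) < 1 / (1 + c)" using ac1 a0 c0 by (simp add: field_simps)
qed (use a0 c0 in auto)

lemma mass_upper:
  assumes "(s, r) \<in> dens.bounds"
  shows "\<exists>K>0. \<forall>N k. k \<le> N \<longrightarrow> mass N k \<le> K * exp (real k * s + real N * r)"
proof -
  obtain p F where p: "0 < p" "p < 1" and F: "a / (1 + a) < F" "F < 1 / (1 + c)"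
    and s: "s = ln ((1 - p) * F) - ln (p * (1 - F))" and r: "r = - ln ((1 - p) * F)"
    using assms unfolding dens.bounds_def by auto
  have F01: "0 < F" "F < 1" using F dens.\<rho>0 dens.\<rho>1 by linarith+
  \<comment> \<open>Chosen so that the factors \<open>1 + u\<close> and \<open>1 + 1 / u\<close> of
    \<open>phi_upper\<close> become \<open>1 / (1 - F)\<close> and \<open>1 / F\<close>; the bounds
    on \<open>F\<close> translate into its two conditions on \<open>u\<close>.\<close>
  define u where "u = F / (1 - F)"
  have u: "u > 0" "1 + u = 1 / (1 - F)" "1 + 1 / u = 1 / F"
    using F01 by (auto simp: u_def field_simps)
  have "a \<le> u" using F(1) F01 a0 by (simp add: u_def field_simps)
  moreover have "c * u < 1" using F(2) F01 c0 by (simp add: u_def field_simps)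
  ultimately obtain K where K: "K > 0" and le: "\<And>xs. phi xs
      \<le> K * ((1 / (1 - F)) ^ length (filter (\<lambda>x. x = 1) xs)
      * (1 / F) ^ length (filter (\<lambda>x. x \<noteq> 1) xs))"
    using phi_upper[of u] u by auto
  have "mass N k \<le> K * exp (real k * s + real N * r)" if k: "k \<le> N" for N k
  proof -
    have "mass N k \<le> (\<Sum>xs\<in>words N k. K * ((1 / (1 - F)) ^ k * (1 / F) ^ (N - k)))"
      unfolding mass_def using le by (intro sum_mono) (metis words_filter_length)
    also have "\<dots> = real (N choose k) * (K * ((1 / (1 - F)) ^ k * (1 / F) ^ (N - k)))"
      by (simp add: card_words)
    also have "\<dots> \<le> ((1 / p) ^ k * (1 / (1 - p)) ^ (N - k)) * (K * ((1 / (1 - F)) ^ k * (1 / F) ^ (N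
        - k)))"
    proof (rule mult_right_mono)
      have "real (N choose k) * p ^ k * (1 - p) ^ (N - k)
          \<le> (\<Sum>j\<le>N. real (N choose j) * p ^ j * (1 - p) ^ (N - j))"
        using k p by (intro member_le_sum) auto
      also have "\<dots> = 1" using binomial_ring[of p "1 - p" N] by simp
      finally show "real (N choose k) \<le> (1 / p) ^ k * (1 / (1 - p)) ^ (N - k)"
        using p by (simp add: field_simps)
    qed (use K F01 in simp)
    also have "\<dots> = K * ((1 / (p * (1 - F))) ^ k * (1 / ((1 - p) * F)) ^ (N - k))"
      by (simp add: power_mult_distrib power_divide)
    also have "(1 / (p * (1 - F))) ^ k = exp (real k * (- ln (p * (1 - F))))"
      using p F01 by (subst exp_of_nat_mult) (simp add: exp_minus inverse_eq_divide)
    also have "(1 / ((1 - p) * F)) ^ (N - k) = exp (real (N - k) * (- ln ((1 - p) * F)))"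
      using p F01 by (subst exp_of_nat_mult) (simp add: exp_minus inverse_eq_divide)
    also have "exp (real k * (- ln (p * (1 - F)))) * exp (real (N - k) * (- ln ((1 - p) * F)))
        = exp (real k * s + real N * r)"
    proof -
      have "real k * - X + real (N - k) * - Y = real k * (Y - X) + real N * - Y" for X Y
        using k by (simp add: of_nat_diff algebra_simps)
      then show ?thesis unfolding s r exp_add[symmetric] by simp
    qed
    finally show ?thesis .
  qed
  then show ?thesis using K by blast
qed

text \<open>For \<open>F = opt x\<close> the drift \<open>x + F - 1\<close> is nonzero only if
  \<open>F\<close> is an endpoint, and then \<open>a = F / (1 - F)\<close> or
  \<open>c = (1 - F) / F\<close>. The boundary price thus has the common formula \<open>pen\<close>,
  which combines with the entropy of the four fractions to \<open>growth\<close>.\<close>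

lemma mass_growth:
  assumes x: "x \<in> {0..1}" and \<epsilon>: "\<epsilon> > 0"
  shows "\<forall>\<^sub>F N in sequentially. \<exists>k\<le>N. \<bar>real k / real N - x\<bar> < \<epsilon>
    \<and> exp (real N * (dens.growth x - \<epsilon>)) \<le> mass N k"
proof -
  define F where "F = dens.opt x"
  define u where "u = x * F"
  define v where "v = (1 - x) * (1 - F)"
  have F: "a / (1 + a) \<le> F" "F \<le> 1 / (1 + c)" unfolding F_def using dens.opt_bounds by auto
  have F01: "0 \<le> F" "F \<le> 1" using F dens.\<rho>0 dens.\<rho>1 by linarith+
  have uv: "u - v = x + F - 1" by (simp add: u_def v_def algebra_simps)
  have above: "F = a / (1 + a) \<and> 0 < a" if "v < u"
  proof -
    have "1 - x < F" using that uv by linarith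
    then have "F = a / (1 + a)" using dens.lt unfolding F_def dens.opt_def by linarith
    moreover have "a \<noteq> 0" using calculation \<open>1 - x < F\<close> x by auto
    ultimately show ?thesis using a0 by simp
  qed
  have below: "F = 1 / (1 + c) \<and> 0 < c" if "u < v"
  proof -
    have "F < 1 - x" using that uv by linarith
    then have "F = 1 / (1 + c)" using dens.lt unfolding F_def dens.opt_def by linarith
    moreover have "c \<noteq> 0" using calculation \<open>F < 1 - x\<close> x by auto
    ultimately show ?thesis using c0 by simp
  qed
  define R where "R = - (xlnx u + xlnx (x - u) + xlnx v + xlnx (1 - x - v))
      + (if v \<le> u then (u - v) * ln a else (v - u) * ln c)"
  have pen: "(if v \<le> u then (u - v) * ln a else (v - u) * ln c) = (x + F - 1) * (ln F - ln (1 - F))"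
  proof -
    consider "u = v" | "v < u" | "u < v" by linarith
    then show ?thesis
    proof cases
      case 1
      then have "x + F - 1 = 0" using uv by linarith
      then show ?thesis using 1 by simp
    next
      case 2
      then have F: "F = a / (1 + a)" and a: "0 < a" using above by auto
      have "1 - F = 1 / (1 + a)" unfolding F using a by (simp add: field_simps)
      then have "ln a = ln F - ln (1 - F)" unfolding F using a by (simp add: ln_div)
      then show ?thesis using 2 uv by simp
    next
      case 3
      then have F: "F = 1 / (1 + c)" and c: "0 < c" using below by auto
      have "1 - F = c / (1 + c)" unfolding F using c by (simp add: field_simps)
      then have "ln c = ln (1 - F) - ln F" unfolding F using c by (simp add: ln_div)
      moreover have "v - u = - (x + F - 1)" using uv by simp
      ultimately have "(v - u) * ln c = - (x + F - 1) * (ln (1 - F) - ln F)" by (simp only:)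
      then show ?thesis using 3 by (simp add: algebra_simps del: ln_div)
    qed
  qed
  have xu: "x - u = x * (1 - F)" "1 - x - v = (1 - x) * F" by (simp_all add: u_def v_def algebra_simps)
  have "R = dens.growth x"
    unfolding R_def pen unfolding xu unfolding u_def v_def dens.growth_def F_def[symmetric]
    using x F01 by (simp add: xlnx_mult) (simp add: xlnx_def algebra_simps)
  moreover have "\<forall>\<^sub>F N in sequentially. \<exists>k\<le>N. \<bar>real k / real N - x\<bar> < \<epsilon> \<and> exp (real N * (R - \<epsilon>))
      \<le> mass N k"
    unfolding R_def u_def v_def
  proof (rule mass_lower[OF _ _ F01 \<epsilon>])
    show "0 < a" if "(1 - x) * (1 - F) < x * F" using above that unfolding u_def v_def by blast
    show "0 < c" if "x * F < (1 - x) * (1 - F)" using below that unfolding u_def v_def by blast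
  qed (use x in auto)
  ultimately show ?thesis by simp
qed

lemma sum_weight:
  "(\<Sum>\<tau> | \<tau> \<in> asep_states N \<and> mean_density N \<tau> \<in> X. weight N \<tau>)
    = (\<Sum>k | k \<le> N \<and> real k / real N \<in> X. mass N k)"
proof -
  define L where "L \<tau> = map \<tau> [1..<Suc N]" for \<tau> :: "nat \<Rightarrow> nat"
  define A where "A = {xs. length xs = N \<and> set xs \<subseteq> {0, 1::nat} \<and> real (sum_list xs) / real N \<in> X}"
  have finA: "finite A"
    by (rule finite_subset[OF _ finite_lists_length_eq[of "{0, 1::nat}" N]]) (auto simp: A_def)
  have sumL: "real (sum_list (L \<tau>)) / real N = mean_density N \<tau>" for \<tau>
    by (simp add: L_def mean_density_def interv_sum_list_conv_sum_set_nat
        atLeastLessThanSuc_atLeastAtMost del: upt_Suc)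
  have nth: "L \<tau> ! i = \<tau> (Suc i)" if "i < N" for \<tau> i
    using that by (simp add: L_def del: upt_Suc)
  have "bij_betw L {\<tau> \<in> asep_states N. mean_density N \<tau> \<in> X} A"
  proof (rule bij_betwI')
    fix \<tau> \<sigma> assume \<tau>: "\<tau> \<in> {\<tau> \<in> asep_states N. mean_density N \<tau> \<in> X}"
      and \<sigma>: "\<sigma> \<in> {\<tau> \<in> asep_states N. mean_density N \<tau> \<in> X}"
    show "L \<tau> = L \<sigma> \<longleftrightarrow> \<tau> = \<sigma>"
    proof
      assume eq: "L \<tau> = L \<sigma>"
      have "\<tau> j = \<sigma> j" if "j \<in> {1..N}" for j
        using nth[of "j - 1" \<tau>] nth[of "j - 1" \<sigma>] eq that by auto
      then show "\<tau> = \<sigma>" using \<tau> \<sigma> unfolding asep_states_def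
        by (intro PiE_ext[where k = "{1..N}"]) auto
    qed simp
    have "set (L \<tau>) \<subseteq> {0, 1}"
      using asep_states_01[of \<tau> N] \<tau> by (fastforce simp: L_def simp del: upt_Suc)
    then show "L \<tau> \<in> A" using \<tau> sumL[of \<tau>] by (simp add: A_def) (simp add: L_def)
  next
    fix xs assume xs: "xs \<in> A"
    define \<tau> where "\<tau> = restrict (\<lambda>j. xs ! (j - 1)) {1..N}"
    have \<tau>S: "\<tau> \<in> asep_states N"
      unfolding \<tau>_def asep_states_def
    proof (rule restrict_PiE_iff[THEN iffD2], rule ballI)
      fix j assume "j \<in> {1..N}"
      then have "xs ! (j - 1) \<in> set xs" using xs by (intro nth_mem) (auto simp: A_def)
      then show "xs ! (j - 1) \<in> {0, 1}" using xs unfolding A_def by blast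
    qed
    have "L \<tau> = xs"
    proof (rule nth_equalityI)
      show len: "length (L \<tau>) = length xs" using xs by (simp add: A_def L_def del: upt_Suc)
      fix i assume "i < length (L \<tau>)"
      then have "i < N" using len xs by (simp add: A_def)
      then show "L \<tau> ! i = xs ! i" by (simp add: nth \<tau>_def)
    qed
    moreover have "mean_density N \<tau> \<in> X" using sumL[of \<tau>] xs calculation by (simp add: A_def)
    ultimately show "\<exists>\<tau>\<in>{\<tau> \<in> asep_states N. mean_density N \<tau> \<in> X}. xs = L \<tau>" using \<tau>S by blast
  qed
  then have "(\<Sum>\<tau> | \<tau> \<in> asep_states N \<and> mean_density N \<tau> \<in> X. weight N \<tau>) = (\<Sum>xs\<in>A. phi xs)"
    unfolding weight_def L_def[symmetric] by (rule sum.reindex_bij_betw)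
  also have "\<dots> = (\<Sum>k | k \<le> N \<and> real k / real N \<in> X. \<Sum>xs | xs \<in> A \<and> sum_list xs = k. phi xs)"
  proof (rule sum.group[symmetric, OF finA])
    show "sum_list ` A \<subseteq> {k. k \<le> N \<and> real k / real N \<in> X}"
    proof
      fix k assume "k \<in> sum_list ` A"
      then obtain xs where xs: "xs \<in> A" "k = sum_list xs" by blast
      then have "xs \<in> words N k" by (simp add: A_def words_def)
      from words_le[OF this] xs show "k \<in> {k. k \<le> N \<and> real k / real N \<in> X}" by (simp add: A_def)
    qed
  qed simp
  also have "\<dots> = (\<Sum>k | k \<le> N \<and> real k / real N \<in> X. mass N k)"
    unfolding mass_def by (intro sum.cong) (auto simp: A_def words_def)
  finally show ?thesis .
qed

lemma prob_mean_density:
  assumes inv: "asep_invariant \<alpha> \<beta> \<gamma> \<delta> q N \<mu>" and N: "1 \<le> N"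
    and \<alpha>: "\<alpha> * ((1 + c) * (1 + d)) = 1 - q" and \<gamma>: "\<gamma> = - c * d * \<alpha>"
    and \<beta>: "\<beta> * ((1 + a) * (1 + b)) = 1 - q" and \<delta>: "\<delta> = - a * b * \<beta>"
    and pos: "\<alpha> > 0" "\<beta> > 0" "\<gamma> \<ge> 0" "\<delta> \<ge> 0"
  shows "measure (measure_pmf (map_pmf (mean_density N) \<mu>)) X
    = (\<Sum>k | k \<le> N \<and> real k / real N \<in> X. mass N k) / (\<Sum>k\<le>N. mass N k)"
proof -
  let ?S = "asep_states N" and ?Y = "{\<tau> \<in> asep_states N. mean_density N \<tau> \<in> X}"
  have supp: "set_pmf \<mu> \<subseteq> ?S" using inv unfolding asep_invariant_def ctmc_invariant_def by auto
  have "measure (measure_pmf (map_pmf (mean_density N) \<mu>)) X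
      = measure (measure_pmf \<mu>) (mean_density N -` X)"
    by simp
  also have "\<dots> = measure (measure_pmf \<mu>) ?Y"
    using supp by (intro measure_prob_cong_0) (auto simp: set_pmf_iff)
  also have "\<dots> = (\<Sum>\<tau>\<in>?Y. pmf \<mu> \<tau>)" by (rule measure_measure_pmf_finite) simp
  also have "\<dots> = (\<Sum>\<tau>\<in>?Y. weight N \<tau> / (\<Sum>\<sigma>\<in>?S. weight N \<sigma>))"
    using invariant_eq_weight[OF inv N \<alpha> \<gamma> \<beta> \<delta> pos] by (intro sum.cong) auto
  also have "\<dots> = (\<Sum>\<tau>\<in>?Y. weight N \<tau>) / (\<Sum>\<sigma>\<in>?S. weight N \<sigma>)"
    by (simp add: sum_divide_distrib)
  also have "(\<Sum>\<sigma>\<in>?S. weight N \<sigma>) = (\<Sum>k\<le>N. mass N k)"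
    using sum_weight[of N UNIV] by (simp add: atMost_def)
  finally show ?thesis unfolding sum_weight .
qed

end

theorem theorem7:
  fixes \<alpha> \<beta> \<gamma> \<delta> q \<rho>0 \<rho>1 :: real
    and \<pi> :: "nat \<Rightarrow> (nat \<Rightarrow> nat) pmf"
  assumes "\<alpha> > 0" and "\<beta> > 0" and "\<gamma> \<ge> 0" and "\<delta> \<ge> 0" and "0 \<le> q" and "q < 1"
    and "\<rho>0 = (1 - q + \<alpha> + \<gamma> - sqrt ((1 - q - \<alpha> + \<gamma>)\<^sup>2 + 4 * \<alpha> * \<gamma>)) / (2 * (1 - q))"
    and "\<rho>1 = (1 - q - \<beta> - \<delta> + sqrt ((1 - q - \<beta> + \<delta>)\<^sup>2 + 4 * \<beta> * \<delta>)) / (2 * (1 - q))"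
    and "\<rho>0 > \<rho>1"
    and "\<And>N. N \<ge> 2 \<Longrightarrow> asep_invariant \<alpha> \<beta> \<gamma> \<delta> q N (\<pi> N)"
  shows "large_deviations_principle
           (\<lambda>N. measure_pmf (map_pmf (mean_density N) (\<pi> N))) real (asep_rate_function \<rho>0 \<rho>1)
       \<and> (\<forall>a b. 0 \<le> a \<longrightarrow> a < b \<longrightarrow> b \<le> 1 \<longrightarrow>
            ((\<lambda>N. elog (measure_pmf.prob (\<pi> N) {\<tau>. mean_density N \<tau> \<in> {a<..<b}}) / ereal (real N))
               \<longlonglongrightarrow> - (INF x\<in>{a<..<b}. asep_rate_function \<rho>0 \<rho>1 x)))"
proof -
  define s where "s = 1 - q"
  have s: "s > 0" using assms(6) by (simp add: s_def)
  define a where "a = (s - \<beta> + \<delta> + sqrt ((s - \<beta> + \<delta>)\<^sup>2 + 4 * \<beta> * \<delta>)) / (2 * \<beta>)"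
  define b where "b = (s - \<beta> + \<delta> - sqrt ((s - \<beta> + \<delta>)\<^sup>2 + 4 * \<beta> * \<delta>)) / (2 * \<beta>)"
  define c where "c = (s - \<alpha> + \<gamma> + sqrt ((s - \<alpha> + \<gamma>)\<^sup>2 + 4 * \<alpha> * \<gamma>)) / (2 * \<alpha>)"
  define d where "d = (s - \<alpha> + \<gamma> - sqrt ((s - \<alpha> + \<gamma>)\<^sup>2 + 4 * \<alpha> * \<gamma>)) / (2 * \<alpha>)"
  note ab = boundary_roots[OF assms(2,4) s, folded a_def b_def]
  note cd = boundary_roots[OF assms(1,3) s, folded c_def d_def]
  have \<rho>0: "\<rho>0 = 1 / (1 + c)" unfolding cd(6) assms(7) s_def ..
  \<comment> \<open>The last formula of \<open>boundary_roots\<close> has a minus sign in front of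
    the square root, so at the right end it yields the hole density 1 - \<rho>1.\<close>
  have "1 - \<rho>1 = 1 / (1 + a)" unfolding ab(6) assms(8) using s by (simp add: s_def field_simps)
  then have \<rho>1: "\<rho>1 = a / (1 + a)" using ab(1) by (simp add: field_simps)
  have "a * c < 1" using assms(9) ab(1) cd(1) unfolding \<rho>0 \<rho>1 by (simp add: field_simps)
  then interpret matrix_ansatz a b c d q
    using ab(1-3) cd(1-3) assms(5,6) by unfold_locales auto
  let ?P = "\<lambda>N. measure_pmf (map_pmf (mean_density N) (\<pi> N))"
  interpret affine_growth mass dens.growth dens.L0r dens.fopt dens.bounds ?P "asep_rate_function \<rho>0 \<rho>1"
  proof
    show "0 \<le> mass N k" for N k by (rule mass_nonneg)
    show "\<exists>K>0. \<forall>N k. k \<le> N \<longrightarrow> mass N k \<le> K * exp (real k * s + real N * r)"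
      if "(s, r) \<in> dens.bounds" for s r using that by (rule mass_upper)
    show "dens.growth x \<le> x * s + r" if "(s, r) \<in> dens.bounds" "x \<in> {0..1}" for s r x
      using that by (rule dens.growth_le_bound)
    show "\<exists>s r. (s, r) \<in> dens.bounds \<and> x * s + r < dens.growth x + \<epsilon>" if "x \<in> {0..1}" "\<epsilon> > 0" for x \<epsilon>
      using that by (rule dens.growth_near)
    show "\<forall>\<^sub>F N in sequentially. \<exists>k\<le>N. \<bar>real k / real N - x\<bar> < \<epsilon>
      \<and> exp (real N * (dens.growth x - \<epsilon>)) \<le> mass N k" if "x \<in> {0..1}" "\<epsilon> > 0" for x \<epsilon>
      using that by (rule mass_growth)
    show "\<exists>r. (0, r) \<in> dens.bounds \<and> r < dens.L0r + \<epsilon>" if "\<epsilon> > 0" for \<epsilon>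
      using that by (rule dens.flat_bound)
    show "dens.fopt \<in> {0..1}" using dens.fopt by simp
    show "dens.growth dens.fopt = dens.L0r" by (rule dens.growth_fopt)
    show "asep_rate_function \<rho>0 \<rho>1 x = (if x \<in> {0..1} then ereal (dens.L0r
        - dens.growth x) else \<infinity>)" for x
      unfolding \<rho>0 \<rho>1 by (rule dens.asep_rate_function_eq)
    \<comment> \<open>The measures are prescribed to be invariant from \<open>N = 2\<close> on, so
      the identity is claimed eventually.\<close>
    show "\<forall>\<^sub>F N in sequentially. \<forall>X. measure (?P N) X =
        (\<Sum>k | k \<le> N \<and> real k / real N \<in> X. mass N k) / (\<Sum>k\<le>N. mass N k)"
      using eventually_ge_at_top[of 2]
    proof eventually_elim
      case (elim N)
      have \<beta>: "\<beta> * ((1 + a) * (1 + b)) = 1 - q" and \<alpha>: "\<alpha> * ((1 + c) * (1 + d)) = 1 - q"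
        using ab(4) cd(4) by (simp_all add: s_def)
      show ?case
        using prob_mean_density[OF assms(10)[OF elim] _ \<alpha> cd(5) \<beta> ab(5) assms(1-4)] elim by simp
    qed
  qed
  have P: "measure_pmf.prob (\<pi> N) {\<tau>. mean_density N \<tau> \<in> X} = measure (?P N) X" for N X
    by (simp add: vimage_def)
  show ?thesis
    unfolding P using ldp interval_limit by blast
qed

end
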